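(* Let $\mathbb G$ be a group of Heisenberg type with homogeneous dimension $Q$, let $1<p<\infty$, and let $\Omega\subset\mathbb G$ be a smooth, connected, bounded open set. Let $f\ge 0$ be the weak solution of the Dirichlet problem $$\Delta_{H,p}f=-|z|^p\ \text{ in }\Omega,\qquad f=0\ \text{ on }\partial\Omega,$$ and suppose that, for some constant $c\ge 0$, $f$ satisfies the overdetermined condition $|\nabla_H f|=c|z|$ on $\partial\Omega$. Suppose in addition that $f\in\Gamma^{2,\alpha}(\overline\Omega)$ for some $\alpha\in(0,1)$, and that the Riemannian gradient $\nabla f$ does not vanish on $\partial\Omega$. Then $c>0$, and moreover the function $$P(x)=|\nabla_H f(x)|^p+\frac{2p}{(p-1)(Q+p)}\,f(x)\,|z|^p,\qquad x=(z,\sigma)\in\Omega,$$ satisfies $$\int_\Omega P(x)\,dx=c^p\int_\Omega |z|^p\,dx.$$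
   Context: A group of Heisenberg type is a simply connected Lie group $\mathbb G$ whose Lie algebra is $\mathfrak g=\mathfrak h\oplus\mathfrak v$ with $[\mathfrak h,\mathfrak h]=\mathfrak v$, $[\mathfrak h,\mathfrak v]=\{0\}$, equipped with an inner product with $\mathfrak h\perp\mathfrak v$, such that the linear map $J:\mathfrak v\to\operatorname{End}(\mathfrak h)$ defined by $\langle J(\sigma)z,z'\rangle=\langle[z,z'],\sigma\rangle$ satisfies $J(\sigma)^2=-|\sigma|^2I_{\mathfrak h}$ for all $\sigma\in\mathfrak v$. Let $m=\dim\mathfrak h$, $k=\dim\mathfrak v$, $Q=m+2k$, and let $\{e_i\}_{i=1}^m$, $\{\varepsilon_\ell\}_{\ell=1}^k$ be orthonormal bases of $\mathfrak h$, $\mathfrak v$. Points are written in logarithmic coordinates $x=(z,\sigma)$, $z\in\mathfrak h$, $\sigma\in\mathfrak v$, with group law $x\circ x'=(z+z',\sigma+\sigma'+\frac12\sum_\ell\langle J(\varepsilon_\ell)z,z'\rangle\varepsilon_\ell)$; $dx$ is Lebesgue measure (a bi-invariant Haar measure). The left-invariant fields are $X_i=\partial_{z_i}+\frac12\sum_{\ell}\langle J(\varepsilon_\ell)z,e_i\rangle\partial_{\sigma_\ell}$ and $T_\ell=\partial_{\sigma_\ell}$; $\mathbb G$ carries the left-invariant Riemannian metric making $X_1,\dots,X_m,T_1,\dots,T_k$ orthonormal. Set $\nabla_Hf=\sum_iX_if\,X_i$, $\nabla f=\sum_iX_if\,X_i+\sum_\ell T_\ell f\,T_\ell$ (Riemannian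 gradient), and $\Delta_{H,p}f=\sum_{i=1}^mX_i(|\nabla_Hf|^{p-2}X_if)$. Weak solution of the Dirichlet problem: $f\in\overset{\circ}{W}{}^{1,p}_H(\Omega)$ (the closure of $C_0^\infty(\Omega)$ in the norm $\|f\|_{L^p}+\|\nabla_Hf\|_{L^p}$) and $\int_\Omega|\nabla_Hf|^{p-2}\langle\nabla_Hf,\nabla_H\varphi\rangle dx=\int_\Omega|z|^p\varphi\,dx$ for every $\varphi\in\overset{\circ}{W}{}^{1,p}_H(\Omega)$. There is a unique nonnegative such $f$. The condition $|\nabla_Hf|=c|z|$ on $\partial\Omega$ means: for every $\varepsilon>0$ there is an open set $O\supset\partial\Omega$ such that $\big||\nabla_Hf(x)|-c|z|\big|<\varepsilon$ and $f(x)<\varepsilon$ for a.e. $x=(z,\sigma)\in\Omega\cap O$. $\Gamma^{2,\alpha}(\overline\Omega)$ is the Folland–Stein Hölder class: functions $f$ for which $f$, $X_if$, $X_iX_jf$ are continuous up to $\overline\Omega$ and the second-order horizontal derivatives $X_iX_jf$ are Hölder continuous of exponent $\alpha$ with respect to the distance $N(x^{-1}\circ y)$, where $N(z,\sigma)=(|z|^4+16|\sigma|^2)^{1/4}$. *)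

theory Defs
  imports "HOL-Analysis.Analysis"
begin

section \<open>Heisenberg type algebras and groups\<close>

definition lie_bracket :: "('g::euclidean_space \<Rightarrow> 'g \<Rightarrow> 'g) \<Rightarrow> bool" where
  "lie_bracket br \<longleftrightarrow> bilinear br \<and> (\<forall>x. br x x = 0) \<and>
     (\<forall>x y z. br x (br y z) + br y (br z x) + br z (br x y) = 0)"

definition J_map :: "('g::euclidean_space \<Rightarrow> 'g \<Rightarrow> 'g) \<Rightarrow> 'g set \<Rightarrow> 'g \<Rightarrow> 'g \<Rightarrow> 'g" where
  "J_map br H s z = (THE w. w \<in> H \<and> (\<forall>z'\<in>H. w \<bullet> z' = br z z' \<bullet> s))"

definition heisenberg_type ::
    "('g::euclidean_space \<Rightarrow> 'g \<Rightarrow> 'g) \<Rightarrow> 'g set \<Rightarrow> 'g set \<Rightarrow> bool" where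
  "heisenberg_type br H V \<longleftrightarrow>
     lie_bracket br \<and> subspace H \<and> subspace V \<and>
     (\<forall>z\<in>H. \<forall>s\<in>V. z \<bullet> s = 0) \<and> {z + s |z s. z \<in> H \<and> s \<in> V} = UNIV \<and>
     span {br z z' |z z'. z \<in> H \<and> z' \<in> H} = V \<and>
     (\<forall>z\<in>H. \<forall>s\<in>V. br z s = 0) \<and>
     (\<forall>s\<in>V. \<forall>z\<in>H. J_map br H s (J_map br H s z) = - ((norm s)\<^sup>2 *\<^sub>R z))"

definition orthonormal_basis :: "'g::euclidean_space set \<Rightarrow> 'g set \<Rightarrow> bool" where
  "orthonormal_basis B S \<longleftrightarrow> pairwise orthogonal B \<and> (\<forall>e\<in>B. norm e = 1) \<and> span B = S"

definition hom_dim :: "'g::euclidean_space set \<Rightarrow> 'g set \<Rightarrow> nat" where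
  "hom_dim H V = dim H + 2 * dim V"

text \<open>The simply connected group is identified with its Lie algebra by the exponential map.
  For an orthonormal basis \<open>E\<close> of \<open>H\<close> and \<open>F\<close> of \<open>V\<close>, the logarithmic coordinates of a
  point \<open>x\<close> are \<open>z = oproj E x\<close> and \<open>\<sigma> = oproj F x\<close>. The group law is the Baker-Campbell-Hausdorff
  formula in step two; it is written out in coordinates in \<open>gmul_coordinates\<close> below. The
  inverse of \<open>x\<close> is \<open>- x\<close>.\<close>

definition oproj :: "'g::euclidean_space set \<Rightarrow> 'g \<Rightarrow> 'g" where
  "oproj B x = (\<Sum>e\<in>B. (x \<bullet> e) *\<^sub>R e)"

definition gmul :: "('g::euclidean_space \<Rightarrow> 'g \<Rightarrow> 'g) \<Rightarrow> 'g \<Rightarrow> 'g \<Rightarrow> 'g" where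
  "gmul br x y = x + y + (1/2) *\<^sub>R br x y"

definition hnorm :: "'g::euclidean_space set \<Rightarrow> 'g set \<Rightarrow> 'g \<Rightarrow> real" where
  "hnorm E F x = (norm (oproj E x) ^ 4 + 16 * (norm (oproj F x))\<^sup>2) powr (1/4)"

text \<open>\<open>lfield br v\<close> is the left-invariant vector field with value \<open>v\<close> at the identity, so that
  \<open>X\<^sub>i\<close> is differentiation along \<open>lfield br e\<^sub>i\<close> and \<open>T\<^sub>l\<close> along \<open>lfield br \<epsilon>\<^sub>l\<close>; see
  \<open>lfield_horizontal\<close> and \<open>lfield_vertical\<close> below.\<close>

definition lfield :: "('g::euclidean_space \<Rightarrow> 'g \<Rightarrow> 'g) \<Rightarrow> 'g \<Rightarrow> 'g \<Rightarrow> 'g" where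
  "lfield br v x = v + (1/2) *\<^sub>R br x v"

definition ldifferentiable ::
    "('g::euclidean_space \<Rightarrow> 'g \<Rightarrow> 'g) \<Rightarrow> 'g \<Rightarrow> ('g \<Rightarrow> real) \<Rightarrow> 'g \<Rightarrow> bool" where
  "ldifferentiable br v f x \<longleftrightarrow> (\<lambda>t. f (x + t *\<^sub>R lfield br v x)) differentiable (at (0::real))"

definition lderiv ::
    "('g::euclidean_space \<Rightarrow> 'g \<Rightarrow> 'g) \<Rightarrow> 'g \<Rightarrow> ('g \<Rightarrow> real) \<Rightarrow> 'g \<Rightarrow> real" where
  "lderiv br v f x = deriv (\<lambda>t. f (x + t *\<^sub>R lfield br v x)) 0"

text \<open>Tangent vectors are represented by their coefficients in the left-invariant frame, i.e. as
  elements of the Lie algebra. The metric makes this frame orthonormal, so Riemannian norms and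
  inner products are those of the Lie algebra. With \<open>B = E\<close> the following is the horizontal
  gradient, with \<open>B = E \<union> F\<close> the Riemannian gradient.\<close>

definition lgrad ::
    "('g::euclidean_space \<Rightarrow> 'g \<Rightarrow> 'g) \<Rightarrow> 'g set \<Rightarrow> ('g \<Rightarrow> real) \<Rightarrow> 'g \<Rightarrow> 'g" where
  "lgrad br B f x = (\<Sum>e\<in>B. lderiv br e f x *\<^sub>R e)"

lemma J_map_eq:
  assumes H: "heisenberg_type br H V" and z: "z \<in> H"
  shows "J_map br H s z \<in> H" and "z' \<in> H \<Longrightarrow> J_map br H s z \<bullet> z' = br z z' \<bullet> s"
proof -
  let ?P = "\<lambda>w. w \<in> H \<and> (\<forall>z'\<in>H. w \<bullet> z' = br z z' \<bullet> s)"
  have sub: "subspace H" and bil: "bilinear br"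
    using H by (auto simp: heisenberg_type_def lie_bracket_def)
  have lin: "linear (\<lambda>z'. br z z')" using bil by (auto simp: bilinear_def)
  define a where "a = adjoint (\<lambda>z'. br z z') s"
  have a: "a \<bullet> z' = br z z' \<bullet> s" for z'
    using adjoint_works[OF lin, of z' s] unfolding a_def by (simp add: inner_commute)
  obtain y w where y: "y \<in> span H" and w: "\<And>u. u \<in> span H \<Longrightarrow> orthogonal w u" and "a = y + w"
    using orthogonal_subspace_decomp_exists[of H a] by metis
  then have "?P y"
    using sub a by (auto simp: span_eq_iff[THEN iffD2, OF sub] orthogonal_def inner_add_left
        simp flip: a)
  moreover have "v = v'" if "?P v" "?P v'" for v v'
  proof -
    have "v - v' \<in> H" using that sub by (auto intro: subspace_diff)
    moreover have "(v - v') \<bullet> u = 0" if "u \<in> H" for u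
      using that \<open>?P v\<close> \<open>?P v'\<close> by (simp add: inner_diff_left)
    ultimately have "(v - v') \<bullet> (v - v') = 0" by blast
    then show ?thesis by simp
  qed
  ultimately have "\<exists>!w. ?P w" by blast
  from theI'[OF this] show "J_map br H s z \<in> H"
    and "z' \<in> H \<Longrightarrow> J_map br H s z \<bullet> z' = br z z' \<bullet> s"
    unfolding J_map_def by auto
qed

lemma oproj_eq:
  assumes "orthonormal_basis B S" "x \<in> S"
  shows "oproj B x = x"
proof -
  have pw: "pairwise orthogonal B" and n1: "\<And>e. e \<in> B \<Longrightarrow> norm e = 1" and sp: "span B = S"
    using assms by (auto simp: orthonormal_basis_def)
  have "0 \<notin> B" using n1 by fastforce
  then have fin: "finite B" using pairwise_orthogonal_independent[OF pw] independent_imp_finite by blast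
  have "orthogonal (x - oproj B x) y" if "y \<in> span B" for y
  proof -
    have *: "(x - oproj B x) \<bullet> e = 0" if e: "e \<in> B" for e
    proof -
      have "oproj B x \<bullet> e = (\<Sum>d\<in>B. if d = e then x \<bullet> e else 0)"
        unfolding oproj_def inner_sum_left
        by (rule sum.cong) (use e n1 pw in \<open>auto simp: pairwise_def orthogonal_def norm_eq_1\<close>)
      also have "\<dots> = x \<bullet> e" using fin e by simp
      finally show ?thesis by (simp add: inner_diff_left)
    qed
    show ?thesis
      by (rule orthogonal_to_span[OF that]) (use * in \<open>auto simp: orthogonal_def\<close>)
  qed
  moreover have "x - oproj B x \<in> span B"
    using assms(2) sp unfolding oproj_def
    by (auto intro!: span_diff span_sum span_scale intro: span_base)
  ultimately have "(x - oproj B x) \<bullet> (x - oproj B x) = 0" by (simp add: orthogonal_def)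
  then show ?thesis by simp
qed

lemma
  assumes H: "heisenberg_type br H V" and E: "orthonormal_basis E H" and F: "orthonormal_basis F V"
  shows bracket_coordinates:
      "br x y = (\<Sum>\<epsilon>\<in>F. (J_map br H \<epsilon> (oproj E x) \<bullet> oproj E y) *\<^sub>R \<epsilon>)"
    and point_coordinates: "x = oproj E x + oproj F x"
    and lfield_vertical: "v \<in> V \<Longrightarrow> lfield br v x = v"
proof -
  have bil: "bilinear br" and alt: "\<And>x. br x x = 0"
    and jac: "\<And>x y z. br x (br y z) + br y (br z x) + br z (br x y) = 0"
    and sH: "subspace H" and perp: "\<And>z s. z \<in> H \<Longrightarrow> s \<in> V \<Longrightarrow> z \<bullet> s = 0"
    and sum: "{z + s |z s. z \<in> H \<and> s \<in> V} = UNIV"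
    and sp: "span {br z z' |z z'. z \<in> H \<and> z' \<in> H} = V"
    and cen: "\<And>z s. z \<in> H \<Longrightarrow> s \<in> V \<Longrightarrow> br z s = 0"
    using H by (auto simp: heisenberg_type_def lie_bracket_def)
  have E_sub: "e \<in> H" if "e \<in> E" for e using that E span_base[of e E] by (auto simp: orthonormal_basis_def)
  have F_sub: "e \<in> V" if "e \<in> F" for e using that F span_base[of e F] by (auto simp: orthonormal_basis_def)
  have skew: "br x y = - br y x" for x y
  proof -
    have "br (x + y) (x + y) = br x y + br y x"
      by (simp add: bilinear_ladd[OF bil] bilinear_radd[OF bil] alt[of x] alt[of y])
    then have "br x y + br y x = 0" using alt[of "x + y"] by metis
    then show ?thesis by (simp add: eq_neg_iff_add_eq_0)
  qed
  have dec: "x = oproj E x + oproj F x \<and> oproj E x \<in> H \<and> oproj F x \<in> V" for x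
  proof -
    have "x \<in> {z + s |z s. z \<in> H \<and> s \<in> V}" by (simp add: sum)
    then obtain z s where x: "x = z + s" and z: "z \<in> H" and s: "s \<in> V" by blast
    have "oproj E x = oproj E z" unfolding oproj_def
      by (rule sum.cong) (use perp[OF E_sub s] in \<open>auto simp: x inner_commute inner_add_right\<close>)
    moreover have "oproj F x = oproj F s" unfolding oproj_def
      by (rule sum.cong) (use perp[OF z F_sub] in \<open>auto simp: x inner_add_left\<close>)
    ultimately show ?thesis using oproj_eq[OF E z] oproj_eq[OF F s] x z s by simp
  qed
  then have ds: "x = oproj E x + oproj F x" and dH: "oproj E x \<in> H" and dV: "oproj F x \<in> V" for x
    by blast+
  show "x = oproj E x + oproj F x" by (rule ds)
  have VV: "br s s' = 0" if "s \<in> V" "s' \<in> V" for s s'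
  proof -
    have lin: "linear (br s)" using bil by (auto simp: bilinear_def)
    have "br s u = 0" if u_in: "u \<in> {br z z' |z z'. z \<in> H \<and> z' \<in> H}" for u
    proof -
      obtain a b where u: "u = br a b" "a \<in> H" "b \<in> H" using u_in by blast
      have 1: "br b s = 0" "br a s = 0" using u(2,3) cen[OF _ \<open>s \<in> V\<close>] by auto
      then have 2: "br s a = 0" using skew[of s a] by simp
      from jac[of s a b] show ?thesis unfolding u(1) 1 2 by (simp add: bilinear_rzero[OF bil])
    qed
    moreover have "s' \<in> span {br z z' |z z'. z \<in> H \<and> z' \<in> H}" using that sp by simp
    ultimately show ?thesis using linear_eq_0_on_span[OF lin] by blast
  qed
  have xV: "br x s = 0" if "s \<in> V" for x s
  proof -
    have "br x s = br (oproj E x + oproj F x) s" by (simp flip: ds)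
    also have "\<dots> = br (oproj E x) s + br (oproj F x) s" by (rule bilinear_ladd[OF bil])
    also have "\<dots> = 0" using cen[OF dH that] VV[OF dV that] by simp
    finally show ?thesis .
  qed
  then show "v \<in> V \<Longrightarrow> lfield br v x = v" by (simp add: lfield_def)
  have "br x y = br x (oproj E y) + br x (oproj F y)"
    by (simp flip: ds bilinear_radd[OF bil])
  also have "\<dots> = br x (oproj E y)" using xV[OF dV] by simp
  also have "\<dots> = br (oproj E x) (oproj E y) + br (oproj F x) (oproj E y)"
    by (simp flip: ds bilinear_ladd[OF bil])
  also have "\<dots> = br (oproj E x) (oproj E y)"
  proof -
    have "br (oproj E y) (oproj F x) = 0" by (rule xV[OF dV])
    then have "br (oproj F x) (oproj E y) = 0" by (subst skew) simp
    then show ?thesis by simp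
  qed
  finally have 1: "br x y = br (oproj E x) (oproj E y)" .
  have "br (oproj E x) (oproj E y) \<in> V"
    unfolding sp[symmetric] by (rule span_base) (use dH in auto)
  from oproj_eq[OF F this] have "br (oproj E x) (oproj E y) = oproj F (br (oproj E x) (oproj E y))" by simp
  also have "\<dots> = (\<Sum>\<epsilon>\<in>F. (J_map br H \<epsilon> (oproj E x) \<bullet> oproj E y) *\<^sub>R \<epsilon>)"
    unfolding oproj_def[of F]
    by (rule sum.cong) (simp_all add: J_map_eq(2)[OF H dH dH])
  finally show "br x y = (\<Sum>\<epsilon>\<in>F. (J_map br H \<epsilon> (oproj E x) \<bullet> oproj E y) *\<^sub>R \<epsilon>)" using 1 by simp
qed

lemma gmul_coordinates:
  assumes "heisenberg_type br H V" "orthonormal_basis E H" "orthonormal_basis F V"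
  shows "gmul br x y =
    x + y + (1/2) *\<^sub>R (\<Sum>\<epsilon>\<in>F. (J_map br H \<epsilon> (oproj E x) \<bullet> oproj E y) *\<^sub>R \<epsilon>)"
  unfolding gmul_def by (subst bracket_coordinates[OF assms]) (rule refl)

lemma lfield_horizontal:
  assumes "heisenberg_type br H V" "orthonormal_basis E H" "orthonormal_basis F V" "e \<in> H"
  shows "lfield br e x = e + (1/2) *\<^sub>R (\<Sum>\<epsilon>\<in>F. (J_map br H \<epsilon> (oproj E x) \<bullet> e) *\<^sub>R \<epsilon>)"
  unfolding lfield_def
  using bracket_coordinates[OF assms(1-3), of x e] oproj_eq[OF assms(2,4)] by simp

section \<open>Smooth functions and smooth domains\<close>

primrec Ck_on :: "nat \<Rightarrow> 'g::euclidean_space set \<Rightarrow> ('g \<Rightarrow> real) \<Rightarrow> bool" where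
  "Ck_on 0 U f \<longleftrightarrow> continuous_on U f"
| "Ck_on (Suc n) U f \<longleftrightarrow> (\<forall>x\<in>U. f differentiable (at x)) \<and>
     (\<forall>v\<in>Basis. Ck_on n U (\<lambda>x. frechet_derivative f (at x) v))"

definition smooth_on :: "'g::euclidean_space set \<Rightarrow> ('g \<Rightarrow> real) \<Rightarrow> bool" where
  "smooth_on U f \<longleftrightarrow> (\<forall>n. Ck_on n U f)"

definition test_functions :: "'g::euclidean_space set \<Rightarrow> ('g \<Rightarrow> real) set" where
  "test_functions \<Omega> = {\<phi>. smooth_on UNIV \<phi> \<and> compact (closure {x. \<phi> x \<noteq> 0}) \<and>
     closure {x. \<phi> x \<noteq> 0} \<subseteq> \<Omega>}"

definition smooth_domain :: "'g::euclidean_space set \<Rightarrow> bool" where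
  "smooth_domain \<Omega> \<longleftrightarrow> open \<Omega> \<and>
     (\<forall>a\<in>frontier \<Omega>. \<exists>U \<rho>. open U \<and> a \<in> U \<and> smooth_on U \<rho> \<and>
        (\<forall>x\<in>U. frechet_derivative \<rho> (at x) \<noteq> (\<lambda>_. 0)) \<and> \<Omega> \<inter> U = {x\<in>U. \<rho> x < 0})"

section \<open>Horizontal Sobolev spaces and weak solutions\<close>

definition in_Lp :: "real \<Rightarrow> 'g::euclidean_space set \<Rightarrow> ('g \<Rightarrow> 'b::euclidean_space) \<Rightarrow> bool" where
  "in_Lp p \<Omega> u \<longleftrightarrow> set_borel_measurable lborel \<Omega> u \<and>
     set_integrable lborel \<Omega> (\<lambda>x. norm (u x) powr p)"

definition Lp_norm :: "real \<Rightarrow> 'g::euclidean_space set \<Rightarrow> ('g \<Rightarrow> 'b::euclidean_space) \<Rightarrow> real" where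
  "Lp_norm p \<Omega> u = (LINT x:\<Omega>|lborel. norm (u x) powr p) powr (1 / p)"

text \<open>Distributional horizontal gradient; the left-invariant fields are divergence free, so the
  formal adjoint of \<open>X\<^sub>i\<close> is \<open>- X\<^sub>i\<close>. It is unique up to null sets, and \<open>whgrad\<close> picks a
  representative.\<close>

definition has_whgrad ::
    "('g::euclidean_space \<Rightarrow> 'g \<Rightarrow> 'g) \<Rightarrow> 'g set \<Rightarrow> 'g set \<Rightarrow> ('g \<Rightarrow> real) \<Rightarrow> ('g \<Rightarrow> 'g) \<Rightarrow> bool" where
  "has_whgrad br E \<Omega> f g \<longleftrightarrow>
     (\<forall>K. compact K \<and> K \<subseteq> \<Omega> \<longrightarrow> set_integrable lborel K f \<and> set_integrable lborel K g) \<and>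
     (\<forall>x\<in>\<Omega>. g x \<in> span E) \<and>
     (\<forall>\<phi>\<in>test_functions \<Omega>. \<forall>e\<in>E.
        (LINT x:\<Omega>|lborel. f x * lderiv br e \<phi> x) = - (LINT x:\<Omega>|lborel. (g x \<bullet> e) * \<phi> x))"

definition whgrad ::
    "('g::euclidean_space \<Rightarrow> 'g \<Rightarrow> 'g) \<Rightarrow> 'g set \<Rightarrow> 'g set \<Rightarrow> ('g \<Rightarrow> real) \<Rightarrow> 'g \<Rightarrow> 'g" where
  "whgrad br E \<Omega> f = (SOME g. has_whgrad br E \<Omega> f g)"

definition W1H ::
    "('g::euclidean_space \<Rightarrow> 'g \<Rightarrow> 'g) \<Rightarrow> 'g set \<Rightarrow> real \<Rightarrow> 'g set \<Rightarrow> ('g \<Rightarrow> real) set" where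
  "W1H br E p \<Omega> = {f. in_Lp p \<Omega> f \<and> (\<exists>g. has_whgrad br E \<Omega> f g \<and> in_Lp p \<Omega> g)}"

definition W1H_norm ::
    "('g::euclidean_space \<Rightarrow> 'g \<Rightarrow> 'g) \<Rightarrow> 'g set \<Rightarrow> real \<Rightarrow> 'g set \<Rightarrow> ('g \<Rightarrow> real) \<Rightarrow> real" where
  "W1H_norm br E p \<Omega> f = Lp_norm p \<Omega> f + Lp_norm p \<Omega> (whgrad br E \<Omega> f)"

definition W1H0 ::
    "('g::euclidean_space \<Rightarrow> 'g \<Rightarrow> 'g) \<Rightarrow> 'g set \<Rightarrow> real \<Rightarrow> 'g set \<Rightarrow> ('g \<Rightarrow> real) set" where
  "W1H0 br E p \<Omega> = {f \<in> W1H br E p \<Omega>. \<exists>\<phi>. (\<forall>n. \<phi> n \<in> test_functions \<Omega>) \<and>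
     (\<lambda>n. W1H_norm br E p \<Omega> (\<lambda>x. \<phi> n x - f x)) \<longlonglongrightarrow> 0}"

text \<open>For \<open>p < 2\<close> the field \<open>|\<nabla>f|\<^sup>p\<^sup>-\<^sup>2 \<nabla>f\<close> is understood as zero where the gradient
  vanishes; this is automatic, as the inner product is then zero.\<close>

definition weak_solution ::
    "('g::euclidean_space \<Rightarrow> 'g \<Rightarrow> 'g) \<Rightarrow> 'g set \<Rightarrow> real \<Rightarrow> 'g set \<Rightarrow> ('g \<Rightarrow> real) \<Rightarrow> bool" where
  "weak_solution br E p \<Omega> f \<longleftrightarrow> f \<in> W1H0 br E p \<Omega> \<and>
     (\<forall>\<phi>\<in>W1H0 br E p \<Omega>.
        (LINT x:\<Omega>|lborel. norm (whgrad br E \<Omega> f x) powr (p - 2) *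
            (whgrad br E \<Omega> f x \<bullet> whgrad br E \<Omega> \<phi> x)) =
        (LINT x:\<Omega>|lborel. norm (oproj E x) powr p * \<phi> x))"

definition overdetermined ::
    "('g::euclidean_space \<Rightarrow> 'g \<Rightarrow> 'g) \<Rightarrow> 'g set \<Rightarrow> 'g set \<Rightarrow> real \<Rightarrow> ('g \<Rightarrow> real) \<Rightarrow> bool" where
  "overdetermined br E \<Omega> c f \<longleftrightarrow>
     (\<forall>\<epsilon>>0. \<exists>O'. open O' \<and> frontier \<Omega> \<subseteq> O' \<and>
        (AE x in lborel. x \<in> \<Omega> \<inter> O' \<longrightarrow>
           \<bar>norm (whgrad br E \<Omega> f x) - c * norm (oproj E x)\<bar> < \<epsilon> \<and> f x < \<epsilon>))"

section \<open>Regularity up to the boundary\<close>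

definition continuous_up_to :: "'g::euclidean_space set \<Rightarrow> ('g \<Rightarrow> 'b::euclidean_space) \<Rightarrow> bool" where
  "continuous_up_to \<Omega> u \<longleftrightarrow> (\<exists>v. continuous_on (closure \<Omega>) v \<and> (\<forall>x\<in>\<Omega>. v x = u x))"

text \<open>The Hoelder condition is imposed on the open set; by continuity it then holds for the
  extension to the closure.\<close>

definition folland_stein2 ::
    "('g::euclidean_space \<Rightarrow> 'g \<Rightarrow> 'g) \<Rightarrow> 'g set \<Rightarrow> 'g set \<Rightarrow> real \<Rightarrow> 'g set \<Rightarrow> ('g \<Rightarrow> real) set" where
  "folland_stein2 br E F \<alpha> \<Omega> = {f. continuous_up_to \<Omega> f \<and>
     (\<forall>e\<in>E. (\<forall>x\<in>\<Omega>. ldifferentiable br e f x) \<and> continuous_up_to \<Omega> (lderiv br e f)) \<and>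
     (\<forall>d\<in>E. \<forall>e\<in>E. (\<forall>x\<in>\<Omega>. ldifferentiable br d (lderiv br e f) x) \<and>
        continuous_up_to \<Omega> (lderiv br d (lderiv br e f)) \<and>
        (\<exists>C. \<forall>x\<in>\<Omega>. \<forall>y\<in>\<Omega>.
           \<bar>lderiv br d (lderiv br e f) x - lderiv br d (lderiv br e f) y\<bar>
             \<le> C * hnorm E F (gmul br (- x) y) powr \<alpha>))}"

text \<open>The boundary values of the Riemannian gradient are those of its continuous extension. For
  functions of class \<open>\<Gamma>\<^sup>2\<^sup>,\<^sup>\<alpha>\<close> the extension exists, because the fields \<open>T\<^sub>l\<close> are combinations
  of commutators of the \<open>X\<^sub>i\<close>.\<close>

definition gradient_nonzero_on_frontier ::
    "('g::euclidean_space \<Rightarrow> 'g \<Rightarrow> 'g) \<Rightarrow> 'g set \<Rightarrow> 'g set \<Rightarrow> 'g set \<Rightarrow> ('g \<Rightarrow> real) \<Rightarrow> bool" where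
  "gradient_nonzero_on_frontier br E F \<Omega> f \<longleftrightarrow>
     (\<exists>G. continuous_on (closure \<Omega>) G \<and> (\<forall>x\<in>\<Omega>. G x = lgrad br (E \<union> F) f x) \<and>
        (\<forall>x\<in>frontier \<Omega>. G x \<noteq> 0))"

definition P_function ::
    "('g::euclidean_space \<Rightarrow> 'g \<Rightarrow> 'g) \<Rightarrow> 'g set \<Rightarrow> real \<Rightarrow> real \<Rightarrow> ('g \<Rightarrow> real) \<Rightarrow> 'g \<Rightarrow> real" where
  "P_function br E Q p f x = norm (lgrad br E f x) powr p +
     2 * p / ((p - 1) * (Q + p)) * f x * norm (oproj E x) powr p"

end

theory Submission
  imports Defs
begin

text \<open>The identity is of Pohozaev type. Let \<open>\<delta>\<^sub>s\<close> be the dilations and \<open>Z\<close> their generator. By the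
  commutator relations \<open>\<Gamma>\<^sup>2\<^sup>,\<^sup>\<alpha>\<close> functions are \<open>C\<^sup>1\<close> in the Euclidean sense, and no
  more than this is used. For \<open>\<psi> \<ge> 0\<close> with compact support, testing the equation with
  \<open>\<psi> (f \<circ> \<delta>\<^sub>s - f)\<close>, using convexity of \<open>|\<cdot>|\<^sup>p\<close> and differentiating at \<open>s = 0\<close> gives
  \<open>p \<integral>|\<nabla>f|\<^sup>p\<^sup>-\<^sup>2\<langle>\<nabla>f, \<nabla>\<psi>\<rangle> Zf + (p - Q) \<integral>\<psi>|\<nabla>f|\<^sup>p - \<integral>|\<nabla>f|\<^sup>p Z\<psi> = p \<integral>\<psi>|z|\<^sup>p Zf\<close>,
  where \<open>\<nabla>\<close> is the horizontal gradient. Boundary integrals are replaced by boundary layers: take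
  \<open>\<psi> = h(f/\<epsilon>)\<close> near the boundary, so that \<open>\<nabla>\<psi> = \<kappa>\<nabla>f\<close> and \<open>Z\<psi> = \<kappa> Zf\<close> with \<open>\<kappa> = h'(f/\<epsilon>)/\<epsilon>\<close>. Since the
  full gradient of \<open>f\<close> does not vanish on the boundary, there is a smooth field \<open>Y\<close> with
  \<open>Yf \<ge> const > 0\<close> there, and integrating \<open>Y\<psi>\<close> by parts bounds \<open>\<integral>\<kappa>\<close> uniformly in \<open>\<epsilon>\<close>. As
  \<open>|\<nabla>f|\<^sup>p - c\<^sup>p|z|\<^sup>p\<close> tends to \<open>0\<close> at the boundary, \<open>|\<nabla>f|\<^sup>p\<close> may be replaced by \<open>c\<^sup>p|z|\<^sup>p\<close> in \<open>\<integral>\<kappa> |\<nabla>f|\<^sup>p Zf\<close>,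
  and the remaining integrals are computed from \<open>\<integral>|z|\<^sup>p Zu = - (Q + p) \<integral>|z|\<^sup>p u\<close>. In the limit
  \<open>(p - 1)(Q + p) c\<^sup>p \<integral>|z|\<^sup>p = (p - Q + p(Q + p)) I\<close> with \<open>I = \<integral>|\<nabla>f|\<^sup>p = \<integral>|z|\<^sup>p f > 0\<close>, where the last
  equality is the equation tested with \<open>f\<close>.\<close>

section \<open>Functions of class C1\<close>

text \<open>A pointwise divergence identity would differentiate |grad f|^(p-2) grad f, which
  degenerates where the horizontal gradient vanishes, and also Zf, which already contains a vertical
  derivative of f. Vertical derivatives are merely continuous here. So the variation is done under
  the integral sign: convexity gives only an inequality, but it holds for both signs of s with
  equality at s = 0, and differentiation turns it into an equation. At the boundary the horizontal
  gradient may vanish, namely at characteristic points, so a transversal field can only come from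
  the full gradient. The layer density kappa replaces surface measure divided by the size of the
  gradient: its mass stays bounded, it concentrates at the boundary, and f is small where it lives.
  Since grad psi = kappa grad f there, the first and third integrals of the local identity merge
  into (p - 1) times a single one. The constant in P comes from (p - 1)(Q + p) + 2p = p - Q + p(Q +
  p), the coefficient of I in the limit.\<close>

abbreviation fderiv :: "('g::euclidean_space \<Rightarrow> real) \<Rightarrow> 'g \<Rightarrow> 'g \<Rightarrow> real" where
  "fderiv u x \<equiv> frechet_derivative u (at x)"

text \<open>Derivatives are taken at \<open>at x\<close> rather than within \<open>U\<close>, so on
  a compact \<open>U\<close> this speaks of a neighbourhood of each point. Continuity one direction
  at a time amounts, in finite dimension, to continuity of the derivative.\<close>

definition C1_on :: "'g::euclidean_space set \<Rightarrow> ('g \<Rightarrow> real) \<Rightarrow> bool" where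
  "C1_on U u \<longleftrightarrow> (\<forall>x\<in>U. u differentiable (at x)) \<and> (\<forall>v. continuous_on U (\<lambda>x. fderiv u x v))"

text \<open>Support is encoded by any compact witness \<open>K\<close>, which need not be the closed
  support, so that larger compact sets serve equally well.\<close>

definition C1c :: "'g::euclidean_space set \<Rightarrow> ('g \<Rightarrow> real) set" where
  "C1c U = {u. C1_on UNIV u \<and> (\<exists>K. compact K \<and> K \<subseteq> U \<and> (\<forall>x. x \<notin> K \<longrightarrow> u x = 0))}"

lemma C1_on_has_derivative: "C1_on U u \<Longrightarrow> x \<in> U \<Longrightarrow> (u has_derivative fderiv u x) (at x)"
  by (auto simp: C1_on_def frechet_derivative_works)

lemma fderiv_eqI: "(u has_derivative u') (at x) \<Longrightarrow> fderiv u x = u'"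
  by (rule frechet_derivative_at[symmetric])

lemma C1_onI:
  assumes "\<And>x. x \<in> U \<Longrightarrow> (u has_derivative u' x) (at x)"
    and "\<And>v. continuous_on U (\<lambda>x. u' x v)"
  shows "C1_on U u"
proof -
  have "continuous_on U (\<lambda>x. fderiv u x v)" for v
    using continuous_on_cong[of U U "\<lambda>x. fderiv u x v" "\<lambda>x. u' x v"] assms fderiv_eqI by metis
  then show ?thesis using assms(1) by (auto simp: C1_on_def differentiable_def)
qed

lemma C1_on_imp_continuous_on: "C1_on U u \<Longrightarrow> continuous_on U u"
  by (meson C1_on_has_derivative continuous_at_imp_continuous_on has_derivative_continuous)

lemma C1_on_subset: "C1_on U u \<Longrightarrow> W \<subseteq> U \<Longrightarrow> C1_on W u"
  by (auto simp: C1_on_def intro: continuous_on_subset)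

lemma C1_on_linear: "C1_on U u \<Longrightarrow> x \<in> U \<Longrightarrow> linear (fderiv u x)"
  using C1_on_has_derivative has_derivative_linear by blast

lemma C1_on_fderiv_Basis:
  assumes "C1_on U u" "x \<in> U"
  shows "fderiv u x v = (\<Sum>b\<in>Basis. (v \<bullet> b) * fderiv u x b)"
proof -
  interpret linear "fderiv u x" by (rule C1_on_linear[OF assms])
  have "fderiv u x v = fderiv u x (\<Sum>b\<in>Basis. (v \<bullet> b) *\<^sub>R b)" by (simp add: euclidean_representation)
  then show ?thesis by (simp add: sum scale)
qed

lemma C1_on_iff_Ck_on: "C1_on U u \<longleftrightarrow> Ck_on (Suc 0) U u"
proof
  assume *: "Ck_on (Suc 0) U u"
  have "continuous_on U (\<lambda>x. fderiv u x v)" for v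
  proof -
    have eq: "fderiv u x v = (\<Sum>b\<in>Basis. (v \<bullet> b) * fderiv u x b)" if "x \<in> U" for x
    proof -
      have "linear (fderiv u x)" using * that by (auto intro: linear_frechet_derivative)
      then interpret linear "fderiv u x" .
      have "fderiv u x v = fderiv u x (\<Sum>b\<in>Basis. (v \<bullet> b) *\<^sub>R b)" by (simp add: euclidean_representation)
      then show ?thesis by (simp add: sum scale)
    qed
    have "continuous_on U (\<lambda>x. \<Sum>b\<in>Basis. (v \<bullet> b) * fderiv u x b)"
      using * by (auto intro!: continuous_intros)
    then show ?thesis by (rule continuous_on_eq) (simp add: eq)
  qed
  then show "C1_on U u" using * by (auto simp: C1_on_def)
qed (auto simp: C1_on_def)

lemma C1_on_continuous_fderiv:
  assumes u: "C1_on U u" and w: "continuous_on U w"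
  shows "continuous_on U (\<lambda>x. fderiv u x (w x))"
proof -
  have "continuous_on U (\<lambda>x. \<Sum>b\<in>Basis. (w x \<bullet> b) * fderiv u x b)"
    using u w by (auto intro!: continuous_intros simp: C1_on_def)
  then show ?thesis by (rule continuous_on_eq) (use C1_on_fderiv_Basis[OF u] in metis)
qed

lemma has_derivative_cong_open:
  assumes "(u has_derivative u') (at x)" "open U" "x \<in> U" "\<And>y. y \<in> U \<Longrightarrow> w y = u y"
  shows "(w has_derivative u') (at x)"
  using assms has_derivative_transform_within_open[of u u' x UNIV U w] by auto

lemma fderiv_cong:
  assumes "open U" "x \<in> U" "\<And>y. y \<in> U \<Longrightarrow> w y = u y"
  shows "fderiv w x = fderiv u x"
proof -
  have "(w has_derivative d) (at x) \<longleftrightarrow> (u has_derivative d) (at x)" for d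
    using has_derivative_cong_open[of u d x U w] has_derivative_cong_open[of w d x U u] assms by auto
  then show ?thesis by (simp add: frechet_derivative_def)
qed

lemma C1_on_cong:
  assumes "C1_on U u" "open U" "\<And>y. y \<in> U \<Longrightarrow> w y = u y"
  shows "C1_on U w"
proof (rule C1_onI)
  show "(w has_derivative fderiv u x) (at x)" if "x \<in> U" for x
    using has_derivative_cong_open[OF C1_on_has_derivative[OF assms(1) that] assms(2) that assms(3)] .
  show "continuous_on U (\<lambda>x. fderiv u x v)" for v using assms(1) by (auto simp: C1_on_def)
qed

lemma C1_on_Un:
  assumes "C1_on U u" "C1_on W u" "open U" "open W"
  shows "C1_on (U \<union> W) u"
  using assms unfolding C1_on_def by (auto intro: continuous_on_open_Un)

lemma C1_on_const [simp]: "C1_on U (\<lambda>x. c)"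
  by (rule C1_onI[where u'="\<lambda>_ _. 0"]) (auto intro!: derivative_eq_intros)

lemma C1_on_inner [simp]: "C1_on U (\<lambda>x. x \<bullet> a)"
  by (rule C1_onI[where u'="\<lambda>_ v. v \<bullet> a"]) (auto intro!: derivative_eq_intros)

lemma C1_on_add:
  assumes "C1_on U u" "C1_on U w"
  shows "C1_on U (\<lambda>x. u x + w x)"
proof (rule C1_onI)
  show "((\<lambda>x. u x + w x) has_derivative (\<lambda>v. fderiv u x v + fderiv w x v)) (at x)" if "x \<in> U" for x
    using that assms by (auto intro!: has_derivative_add C1_on_has_derivative)
  show "continuous_on U (\<lambda>x. fderiv u x v + fderiv w x v)" for v
    using assms by (auto intro!: continuous_intros simp: C1_on_def)
qed

lemma fderiv_mult:
  assumes "C1_on U u" "C1_on U w" "x \<in> U"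
  shows "fderiv (\<lambda>x. u x * w x) x v = u x * fderiv w x v + fderiv u x v * w x"
  using fderiv_eqI[OF has_derivative_mult[OF C1_on_has_derivative[OF assms(1,3)]
        C1_on_has_derivative[OF assms(2,3)]]] by simp

lemma C1_on_mult:
  assumes "C1_on U u" "C1_on U w"
  shows "C1_on U (\<lambda>x. u x * w x)"
proof (rule C1_onI)
  show "((\<lambda>x. u x * w x) has_derivative (\<lambda>v. u x * fderiv w x v + fderiv u x v * w x)) (at x)" if "x \<in> U" for x
    using that assms by (auto intro!: has_derivative_mult C1_on_has_derivative)
  show "continuous_on U (\<lambda>x. u x * fderiv w x v + fderiv u x v * w x)" for v
    using assms C1_on_imp_continuous_on by (auto intro!: continuous_intros simp: C1_on_def)
qed

lemma C1_on_diff: "C1_on U u \<Longrightarrow> C1_on U w \<Longrightarrow> C1_on U (\<lambda>x. u x - w x)"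
  using C1_on_add[of U u "\<lambda>x. (-1) * w x"] C1_on_mult[of U "\<lambda>_. -1" w] by simp

lemma fderiv_diff:
  assumes "C1_on U u" "C1_on U w" "x \<in> U"
  shows "fderiv (\<lambda>x. u x - w x) x v = fderiv u x v - fderiv w x v"
  using fderiv_eqI[OF has_derivative_diff[OF C1_on_has_derivative[OF assms(1,3)]
        C1_on_has_derivative[OF assms(2,3)]]] by simp

lemma
  fixes h :: "real \<Rightarrow> real"
  assumes u: "C1_on U u" and h: "\<And>t. (h has_real_derivative h' t) (at t)" and h': "continuous_on UNIV h'"
  shows C1_on_compose_real: "C1_on U (\<lambda>x. h (u x))"
    and fderiv_compose_real: "x \<in> U \<Longrightarrow> fderiv (\<lambda>x. h (u x)) x v = h' (u x) * fderiv u x v"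
proof -
  have der: "((\<lambda>x. h (u x)) has_derivative (\<lambda>v. h' (u x) * fderiv u x v)) (at x)" if "x \<in> U" for x
  proof -
    have "((\<lambda>x. h (u x)) has_derivative (\<lambda>v. fderiv u x v * h' (u x))) (at x)"
      using has_derivative_compose[OF C1_on_has_derivative[OF u that] h[of "u x", unfolded has_field_derivative_def]]
      by (simp add: mult.commute)
    then show ?thesis by (simp add: mult.commute)
  qed
  show "x \<in> U \<Longrightarrow> fderiv (\<lambda>x. h (u x)) x v = h' (u x) * fderiv u x v"
    using fderiv_eqI[OF der] by simp
  show "C1_on U (\<lambda>x. h (u x))"
  proof (rule C1_onI[OF der])
    show "continuous_on U (\<lambda>x. h' (u x) * fderiv u x v)" for v
      using u C1_on_imp_continuous_on[OF u]
      by (auto intro!: continuous_intros continuous_on_compose2[OF h'] simp: C1_on_def)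
  qed
qed

lemma
  fixes \<Phi> :: "'g::euclidean_space \<Rightarrow> 'g"
  assumes u: "C1_on UNIV u" and \<Phi>: "\<And>x. (\<Phi> has_derivative \<Phi>' x) (at x)"
    and c: "\<And>v. continuous_on UNIV (\<lambda>x. \<Phi>' x v)"
  shows C1_on_compose: "C1_on UNIV (\<lambda>x. u (\<Phi> x))"
    and fderiv_compose: "fderiv (\<lambda>x. u (\<Phi> x)) x v = fderiv u (\<Phi> x) (\<Phi>' x v)"
proof -
  have der: "((\<lambda>x. u (\<Phi> x)) has_derivative (\<lambda>v. fderiv u (\<Phi> x) (\<Phi>' x v))) (at x)" for x
    using has_derivative_compose[OF \<Phi> C1_on_has_derivative[OF u UNIV_I]] by simp
  show "fderiv (\<lambda>x. u (\<Phi> x)) x v = fderiv u (\<Phi> x) (\<Phi>' x v)" using fderiv_eqI[OF der] by simp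
  have c\<Phi>: "continuous_on UNIV \<Phi>"
    using \<Phi> by (meson continuous_at_imp_continuous_on has_derivative_continuous)
  have cD: "continuous_on UNIV (\<lambda>x. fderiv u x b)" for b using u by (simp add: C1_on_def)
  show "C1_on UNIV (\<lambda>x. u (\<Phi> x))"
  proof (rule C1_onI[OF der])
    fix v
    have "continuous_on UNIV (\<lambda>x. \<Sum>b\<in>Basis. (\<Phi>' x v \<bullet> b) * fderiv u (\<Phi> x) b)"
      by (intro continuous_intros c continuous_on_compose2[OF cD c\<Phi>]) auto
    then show "continuous_on UNIV (\<lambda>x. fderiv u (\<Phi> x) (\<Phi>' x v))"
      by (subst C1_on_fderiv_Basis[OF u]) auto
  qed
qed

lemma C1cI:
  "C1_on UNIV u \<Longrightarrow> compact K \<Longrightarrow> K \<subseteq> U \<Longrightarrow> (\<And>x. x \<notin> K \<Longrightarrow> u x = 0) \<Longrightarrow> u \<in> C1c U"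
  unfolding C1c_def by blast

lemma has_derivative_outside_support:
  assumes "compact K" "\<And>y. y \<notin> K \<Longrightarrow> u y = 0" "x \<notin> K"
  shows "(u has_derivative (\<lambda>_. 0)) (at x)"
  by (rule has_derivative_cong_open[of "\<lambda>_. 0" _ _ "- K"])
    (use assms in \<open>auto simp: compact_imp_closed open_Compl\<close>)

lemma fderiv_outside_support:
  assumes "compact K" "\<And>y. y \<notin> K \<Longrightarrow> u y = 0" "x \<notin> K"
  shows "fderiv u x v = 0"
  using fderiv_eqI[OF has_derivative_outside_support[of K u x, OF assms]] by simp

lemma C1cE:
  assumes "u \<in> C1c U"
  obtains K where "C1_on UNIV u" "compact K" "K \<subseteq> U" "\<And>x. x \<notin> K \<Longrightarrow> u x = 0"
    "\<And>x v. x \<notin> K \<Longrightarrow> fderiv u x v = 0"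
proof -
  obtain K where K: "C1_on UNIV u" "compact K" "K \<subseteq> U" "\<And>x. x \<notin> K \<Longrightarrow> u x = 0"
    using assms unfolding C1c_def by blast
  note fderiv_outside_support[of K u, OF K(2,4)]
  with K show ?thesis using that by blast
qed

lemma C1c_C1_on: "u \<in> C1c U \<Longrightarrow> C1_on W u"
  unfolding C1c_def using C1_on_subset[of UNIV u W] by auto

lemma C1c_mono: "u \<in> C1c U \<Longrightarrow> U \<subseteq> W \<Longrightarrow> u \<in> C1c W"
  unfolding C1c_def by blast

text \<open>Outside \<open>U\<close> the function \<open>u\<close> is arbitrary.\<close>

lemma C1c_mult:
  assumes u: "C1_on U u" and "open U" and w: "w \<in> C1c U"
  shows "(\<lambda>x. u x * w x) \<in> C1c U"
proof -
  obtain K where K: "C1_on UNIV w" "compact K" "K \<subseteq> U" "\<And>x. x \<notin> K \<Longrightarrow> w x = 0"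
    using C1cE[OF w] by metis
  have 1: "C1_on U (\<lambda>x. u x * w x)" using u C1c_C1_on[OF w] by (rule C1_on_mult)
  have 2: "C1_on (- K) (\<lambda>x. u x * w x)"
    by (rule C1_on_cong[of _ "\<lambda>_. 0"]) (use K in \<open>auto simp: compact_imp_closed open_Compl\<close>)
  have "C1_on UNIV (\<lambda>x. u x * w x)"
    using C1_on_Un[OF 1 2 \<open>open U\<close>] K(2,3)
    by (metis Compl_Un Compl_subset_Compl_iff Un_UNIV_right Un_commute compact_imp_closed double_complement
        open_Compl subset_UNIV sup.orderE sup_compl_top_left1)
  then show ?thesis using K by (intro C1cI[of _ K]) auto
qed

section \<open>Integrals of compactly supported functions and their derivatives along flows\<close>

lemma integrable_compact_support:
  fixes u :: "'g::euclidean_space \<Rightarrow> 'b::{banach, second_countable_topology}"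
  assumes "compact K" "continuous_on K u" "\<And>x. x \<notin> K \<Longrightarrow> u x = 0"
  shows "integrable lborel u"
proof -
  have "(\<lambda>x. indicator K x *\<^sub>R u x) = u" using assms(3) by (auto simp: indicator_def fun_eq_iff)
  then show ?thesis using borel_integrable_compact[OF assms(1,2)] by simp
qed

lemma integrable_C1c_mult:
  assumes "u \<in> C1c U" "continuous_on U m"
  shows "integrable lborel (\<lambda>x. m x * u x)"
proof -
  obtain K where "C1_on UNIV u" "compact K" "K \<subseteq> U" "\<And>x. x \<notin> K \<Longrightarrow> u x = 0"
    using C1cE[OF assms(1)] by metis
  then show ?thesis using assms(2) C1_on_imp_continuous_on[of K u]
    by (intro integrable_compact_support[of K]) (auto intro!: continuous_intros intro: continuous_on_subset C1_on_subset)
qed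

lemma integrable_C1c_fderiv_mult:
  assumes "u \<in> C1c U" "continuous_on U m" "continuous_on U w"
  shows "integrable lborel (\<lambda>x. m x * fderiv u x (w x))"
proof -
  obtain K where K: "C1_on UNIV u" "compact K" "K \<subseteq> U" "\<And>x v. x \<notin> K \<Longrightarrow> fderiv u x v = 0"
    using C1cE[OF assms(1)] by metis
  then have "continuous_on K (\<lambda>x. fderiv u x (w x))"
    using assms C1_on_subset[of UNIV u K] by (intro C1_on_continuous_fderiv) (auto intro: continuous_on_subset)
  then show ?thesis using assms(2) K
    by (intro integrable_compact_support[of K]) (auto intro!: continuous_intros intro: continuous_on_subset)
qed

lemma C1c_integrable: "u \<in> C1c U \<Longrightarrow> integrable lborel u"
  using integrable_C1c_mult[of u U "\<lambda>_. 1"] by simp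

lemma C1c_fderiv_bound:
  assumes "u \<in> C1c U"
  obtains B where "B > 0" "\<And>x v. \<bar>fderiv u x v\<bar> \<le> B * norm v"
proof -
  obtain K where K: "C1_on UNIV u" "compact K" "\<And>x v. x \<notin> K \<Longrightarrow> fderiv u x v = 0"
    using C1cE[OF assms] by metis
  have "bounded ((\<lambda>x. \<Sum>b\<in>Basis. \<bar>fderiv u x b\<bar>) ` K)"
    using K(1,2) by (intro compact_imp_bounded compact_continuous_image continuous_intros)
      (auto simp: C1_on_def intro: continuous_on_subset)
  then obtain B where B: "B > 0" "\<And>x. x \<in> K \<Longrightarrow> \<bar>\<Sum>b\<in>Basis. \<bar>fderiv u x b\<bar>\<bar> \<le> B"
    by (auto simp: bounded_pos)
  have "\<bar>fderiv u x v\<bar> \<le> B * norm v" for x v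
  proof (cases "x \<in> K")
    case True
    have "\<bar>fderiv u x v\<bar> \<le> (\<Sum>b\<in>Basis. \<bar>(v \<bullet> b) * fderiv u x b\<bar>)"
      by (subst C1_on_fderiv_Basis[OF K(1)]) (auto intro: sum_abs)
    also have "\<dots> \<le> (\<Sum>b\<in>Basis. norm v * \<bar>fderiv u x b\<bar>)"
      by (intro sum_mono) (auto simp: abs_mult intro!: mult_right_mono Basis_le_norm)
    also have "\<dots> = norm v * (\<Sum>b\<in>Basis. \<bar>fderiv u x b\<bar>)" by (simp add: sum_distrib_left)
    also have "\<dots> \<le> norm v * B" using B(2)[OF True] by (intro mult_left_mono) auto
    finally show ?thesis by (simp add: mult.commute)
  qed (use K B in auto)
  then show ?thesis using that B(1) by blast
qed

lemma C1c_lipschitz: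
  assumes "u \<in> C1c U"
  obtains B where "B > 0" "\<And>x y. \<bar>u x - u y\<bar> \<le> B * norm (x - y)"
proof -
  obtain B where B: "B > 0" "\<And>x v. \<bar>fderiv u x v\<bar> \<le> B * norm v"
    using C1c_fderiv_bound[OF assms] by blast
  have "norm (u x - u y) \<le> B * norm (x - y)" for x y
  proof (rule differentiable_bound[of UNIV])
    show "(u has_derivative fderiv u z) (at z within UNIV)" for z
      using C1_on_has_derivative[OF C1c_C1_on[OF assms]] by auto
    show "onorm (fderiv u z) \<le> B" for z by (rule onorm_bound) (use B in auto)
  qed auto
  then show ?thesis using that B(1) by auto
qed

text \<open>Only \<open>u\<close> is moved by the flow, so continuity of the weight \<open>m\<close>
  is enough. By \<open>proper\<close> all the functions \<open>u (\<Phi> s x)\<close> with |s| at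
  most 1 vanish off one ball; there \<open>lip\<close> and the Lipschitz constant of
  \<open>u\<close> bound the difference quotients, and dominated convergence applies. It is used for
  translations and for dilations.\<close>

lemma has_real_derivative_integral_flow:
  fixes u m :: "'g::euclidean_space \<Rightarrow> real" and \<Phi> :: "real \<Rightarrow> 'g \<Rightarrow> 'g"
  assumes u: "u \<in> C1c U" and m: "continuous_on UNIV m"
    and id: "\<And>x. \<Phi> 0 x = x"
    and der: "\<And>x. ((\<lambda>s. \<Phi> s x) has_vector_derivative Z x) (at 0)"
    and cont: "\<And>s. continuous_on UNIV (\<Phi> s)"
    and lip: "\<And>R. \<exists>C. \<forall>x s. norm x \<le> R \<longrightarrow> \<bar>s\<bar> \<le> 1 \<longrightarrow> norm (\<Phi> s x - x) \<le> C * \<bar>s\<bar>"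
    and proper: "\<And>R. \<exists>R'. \<forall>x s. \<bar>s\<bar> \<le> 1 \<longrightarrow> norm (\<Phi> s x) \<le> R \<longrightarrow> norm x \<le> R'"
  shows "((\<lambda>s. LINT x|lborel. m x * u (\<Phi> s x)) has_real_derivative (LINT x|lborel. m x * fderiv u x (Z x))) (at 0)"
proof -
  obtain K where K: "C1_on UNIV u" "compact K" "\<And>x. x \<notin> K \<Longrightarrow> u x = 0"
    using C1cE[OF u] by metis
  obtain R where R: "\<And>x. x \<in> K \<Longrightarrow> norm x \<le> R"
    using compact_imp_bounded[OF K(2)] by (auto simp: bounded_iff)
  obtain R' where R': "\<And>x s. \<bar>s\<bar> \<le> 1 \<Longrightarrow> norm (\<Phi> s x) \<le> R \<Longrightarrow> norm x \<le> R'" using proper[of R] by blast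
  have supp: "u (\<Phi> s x) = 0" if "\<bar>s\<bar> \<le> 1" "norm x > R'" for s x
    using K(3)[of "\<Phi> s x"] R R' that by force
  have supp0: "u x = 0" if "norm x > R'" for x using supp[of 0 x] that id by simp
  obtain C where C: "\<And>x s. norm x \<le> R' \<Longrightarrow> \<bar>s\<bar> \<le> 1 \<Longrightarrow> norm (\<Phi> s x - x) \<le> C * \<bar>s\<bar>"
    using lip[of R'] by blast
  obtain B where B: "B > 0" "\<And>x y. \<bar>u x - u y\<bar> \<le> B * norm (x - y)" using C1c_lipschitz[OF u] by blast
  have cu: "continuous_on UNIV u" using C1_on_imp_continuous_on[OF K(1)] .
  have cu\<Phi>: "continuous_on UNIV (\<lambda>x. u (\<Phi> s x))" for s
    by (rule continuous_on_compose2[OF cu cont]) auto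
  have "bounded (m ` cball 0 R')"
    by (intro compact_imp_bounded compact_continuous_image) (use m in \<open>auto intro: continuous_on_subset\<close>)
  then obtain M where M: "M > 0" "\<And>x. norm x \<le> R' \<Longrightarrow> \<bar>m x\<bar> \<le> M" by (auto simp: bounded_pos)
  have int: "integrable lborel (\<lambda>x. m x * u (\<Phi> s x))" if "\<bar>s\<bar> \<le> 1" for s
  proof (rule integrable_compact_support[of "cball 0 R'"])
    show "continuous_on (cball 0 R') (\<lambda>x. m x * u (\<Phi> s x))"
      using m cu\<Phi>[of s] by (auto intro!: continuous_intros intro: continuous_on_subset)
  qed (use supp that in auto)
  have "((\<lambda>s. ((LINT x|lborel. m x * u (\<Phi> s x)) - (LINT x|lborel. m x * u (\<Phi> 0 x))) / (s - 0))
      \<longlongrightarrow> (LINT x|lborel. m x * fderiv u x (Z x))) (at 0)"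
    unfolding tendsto_at_iff_sequentially comp_def
  proof (intro allI impI)
    fix X :: "nat \<Rightarrow> real" assume X: "\<forall>i. X i \<in> UNIV - {0}" "X \<longlonglongrightarrow> 0"
    have "eventually (\<lambda>n. \<bar>X n\<bar> < 1) sequentially"
      using X(2) by (auto simp: tendsto_iff dist_real_def)
    then obtain N where N: "\<And>n. n \<ge> N \<Longrightarrow> \<bar>X n\<bar> \<le> 1" unfolding eventually_sequentially by (meson less_imp_le)
    \<comment> \<open>Dropping finitely many terms brings the whole sequence into the range where
      \<open>lip\<close> and \<open>proper\<close> apply.\<close>
    define Y where "Y n = X (n + N)" for n
    have Y: "Y n \<noteq> 0" "\<bar>Y n\<bar> \<le> 1" for n using X(1) N by (auto simp: Y_def)
    have Y0: "Y \<longlonglongrightarrow> 0" unfolding Y_def using X(2) by (rule LIMSEQ_ignore_initial_segment)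
    let ?q = "\<lambda>n x. m x * ((u (\<Phi> (Y n) x) - u x) / Y n)"
    have "(\<lambda>n. LINT x|lborel. ?q n x) \<longlonglongrightarrow> (LINT x|lborel. m x * fderiv u x (Z x))"
    proof (rule integral_dominated_convergence[where w="\<lambda>x. indicator (cball 0 R') x * (M * (B * C))"])
      show meas: "?q n \<in> borel_measurable lborel" for n
        using borel_measurable_continuous_onI[OF m] borel_measurable_continuous_onI[OF cu]
          borel_measurable_continuous_onI[OF cu\<Phi>[of "Y n"]] by simp
      have lim: "(\<lambda>n. ?q n x) \<longlonglongrightarrow> m x * fderiv u x (Z x)" for x
      proof -
        have "((\<lambda>s. u (\<Phi> s x)) has_derivative (\<lambda>s. fderiv u (\<Phi> 0 x) (s *\<^sub>R Z x))) (at 0)"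
          using has_derivative_compose[OF der[of x, unfolded has_vector_derivative_def]
              C1_on_has_derivative[OF K(1) UNIV_I]] by simp
        then have "((\<lambda>s. u (\<Phi> s x)) has_derivative (\<lambda>s. s * fderiv u x (Z x))) (at 0)"
          using linear_scale[OF C1_on_linear[OF K(1) UNIV_I, of x]] id by simp
        then have "((\<lambda>s. u (\<Phi> s x)) has_real_derivative fderiv u x (Z x)) (at 0)"
          by (simp add: has_field_derivative_def mult_commute_abs)
        then have "((\<lambda>s. (u (\<Phi> s x) - u (\<Phi> 0 x)) / (s - 0)) \<longlongrightarrow> fderiv u x (Z x)) (at 0)"
          by (simp add: has_field_derivative_iff)
        then have "((\<lambda>s. (u (\<Phi> s x) - u x) / s) \<longlongrightarrow> fderiv u x (Z x)) (at 0)" by (simp add: id)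
        then have "(\<lambda>n. (u (\<Phi> (Y n) x) - u x) / Y n) \<longlonglongrightarrow> fderiv u x (Z x)"
          unfolding tendsto_at_iff_sequentially comp_def using Y Y0 by auto
        then show ?thesis by (intro tendsto_intros)
      qed
      then show "AE x in lborel. (\<lambda>n. ?q n x) \<longlonglongrightarrow> m x * fderiv u x (Z x)" by simp
      show "(\<lambda>x. m x * fderiv u x (Z x)) \<in> borel_measurable lborel"
        by (rule borel_measurable_LIMSEQ_real[OF _ meas]) (use lim in auto)
      show "integrable lborel (\<lambda>x::'g. indicator (cball 0 R') x * (M * (B * C)))"
        using borel_integrable_compact[of "cball (0::'g) R'" "\<lambda>_. M * (B * C)"] by simp
      show "AE x in lborel. norm (?q n x) \<le> indicator (cball 0 R') x * (M * (B * C))" for n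
      proof (rule AE_I2)
        fix x :: 'g
        show "norm (?q n x) \<le> indicator (cball 0 R') x * (M * (B * C))"
        proof (cases "norm x \<le> R'")
          case True
          have "\<bar>u (\<Phi> (Y n) x) - u x\<bar> \<le> B * norm (\<Phi> (Y n) x - x)" by (rule B)
          also have "\<dots> \<le> B * (C * \<bar>Y n\<bar>)" using C[OF True Y(2)] B(1) by (intro mult_left_mono) auto
          finally have "\<bar>u (\<Phi> (Y n) x) - u x\<bar> / \<bar>Y n\<bar> \<le> B * C" using Y(1)[of n] by (simp add: field_simps)
          then have "\<bar>m x\<bar> * (\<bar>u (\<Phi> (Y n) x) - u x\<bar> / \<bar>Y n\<bar>) \<le> M * (B * C)"
            using M(2)[OF True] M(1) by (intro mult_mono) auto
          then show ?thesis using True by (simp add: abs_mult)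
        next
          case False
          then show ?thesis using supp[OF Y(2)[of n]] supp0 by simp
        qed
      qed
    qed
    also have "(\<lambda>n. LINT x|lborel. ?q n x) =
        (\<lambda>n. ((LINT x|lborel. m x * u (\<Phi> (Y n) x)) - (LINT x|lborel. m x * u (\<Phi> 0 x))) / Y n)"
    proof
      fix n
      have "(LINT x|lborel. ?q n x) = (LINT x|lborel. (m x * u (\<Phi> (Y n) x) - m x * u (\<Phi> 0 x)) / Y n)"
        by (simp add: id right_diff_distrib diff_divide_distrib)
      then show "(LINT x|lborel. ?q n x) =
        ((LINT x|lborel. m x * u (\<Phi> (Y n) x)) - (LINT x|lborel. m x * u (\<Phi> 0 x))) / Y n"
        using int[OF Y(2)[of n]] int[of 0] by simp
    qed
    finally have "(\<lambda>n. ((LINT x|lborel. m x * u (\<Phi> (X (n + N)) x)) - (LINT x|lborel. m x * u (\<Phi> 0 x))) / X (n + N))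
        \<longlonglongrightarrow> (LINT x|lborel. m x * fderiv u x (Z x))" by (simp add: Y_def)
    from LIMSEQ_offset[OF this[folded Y_def, unfolded Y_def]]
    show "(\<lambda>n. ((LINT x|lborel. m x * u (\<Phi> (X n) x)) - (LINT x|lborel. m x * u (\<Phi> 0 x))) / (X n - 0))
        \<longlonglongrightarrow> (LINT x|lborel. m x * fderiv u x (Z x))"
      by (simp add: LIMSEQ_offset)
  qed
  then show ?thesis by (simp add: has_field_derivative_iff)
qed

lemma integral_translate:
  fixes u :: "'g::euclidean_space \<Rightarrow> real"
  assumes "u \<in> borel_measurable borel"
  shows "(LINT x|lborel. u (a + x)) = (LINT x|lborel. u x)"
  using assms by (subst (2) lborel_affine[of 1 a]) (simp_all add: density_1 integral_distr)

lemma integral_reflect: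
  fixes u :: "'g::euclidean_space \<Rightarrow> real"
  assumes "u \<in> borel_measurable borel"
  shows "(LINT x|lborel. u (a - x)) = (LINT x|lborel. u x)"
  using assms by (subst (2) lborel_affine[of "-1" a]) (simp_all add: density_1 integral_distr)

text \<open>By translation invariance the integral of \<open>u (x + s *\<^sub>R v)\<close> is
  constant in \<open>s\<close>; its derivative at 0 is the integral in question.\<close>

lemma integral_fderiv_eq_0:
  assumes u: "u \<in> C1c U"
  shows "(LINT x|lborel. fderiv u x v) = 0"
proof -
  have "((\<lambda>s. LINT x|lborel. 1 * u (x + s *\<^sub>R v)) has_real_derivative (LINT x|lborel. 1 * fderiv u x v)) (at 0)"
  proof (rule has_real_derivative_integral_flow[OF u])
    show "((\<lambda>s. x + s *\<^sub>R v) has_vector_derivative v) (at 0)" for x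
      by (auto intro!: derivative_eq_intros)
    show "\<exists>C. \<forall>x s. norm x \<le> R \<longrightarrow> \<bar>s\<bar> \<le> 1 \<longrightarrow> norm (x + s *\<^sub>R v - x) \<le> C * \<bar>s\<bar>" for R
      by (rule exI[of _ "norm v"]) (auto simp: mult.commute)
    show "\<exists>R'. \<forall>x s. \<bar>s\<bar> \<le> 1 \<longrightarrow> norm (x + s *\<^sub>R v) \<le> R \<longrightarrow> norm x \<le> R'" for R
    proof (intro exI allI impI)
      fix x s assume *: "\<bar>s\<bar> \<le> 1" "norm (x + s *\<^sub>R v) \<le> R"
      have "norm x \<le> norm (x + s *\<^sub>R v) + norm (s *\<^sub>R v)"
        by (metis add_diff_cancel norm_triangle_ineq4)
      moreover have "norm (s *\<^sub>R v) \<le> norm v" using *(1) by (simp add: mult_left_le_one_le)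
      ultimately show "norm x \<le> R + norm v" using * by linarith
    qed
  qed (auto intro!: continuous_intros)
  moreover have "u \<in> borel_measurable borel"
    by (intro borel_measurable_continuous_onI C1_on_imp_continuous_on C1c_C1_on[OF u])
  then have "(LINT x|lborel. 1 * u (x + s *\<^sub>R v)) = (LINT x|lborel. u x)" for s
    using integral_translate[of u "s *\<^sub>R v"] by (simp add: add.commute)
  ultimately have "((\<lambda>s::real. (LINT x|lborel. u x)) has_real_derivative (LINT x|lborel. fderiv u x v)) (at 0)"
    by simp
  then show ?thesis using DERIV_unique DERIV_const by blast
qed

section \<open>Mollification and smooth cutoffs\<close>

lemma Ck_on_add:
  assumes "Ck_on n UNIV u" "Ck_on n UNIV w"
  shows "Ck_on n UNIV (\<lambda>x. u x + w x)"
  using assms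
proof (induction n arbitrary: u w)
  case (Suc n)
  have "fderiv (\<lambda>x. u x + w x) x v = fderiv u x v + fderiv w x v" for x v
    using Suc.prems fderiv_eqI[OF has_derivative_add[of u "fderiv u x" "at x" w "fderiv w x"]]
    by (auto simp: frechet_derivative_works)
  then show ?case using Suc by (auto intro: differentiable_add)
qed (auto intro: continuous_intros)

text \<open>All derivatives of \<open>exp (-1/t)\<close>, extended by \<open>0\<close>, are of this form.\<close>

definition flat_exp :: "real poly \<Rightarrow> real \<Rightarrow> real" where
  "flat_exp P t = (if t > 0 then poly P (1 / t) * exp (- (1 / t)) else 0)"

text \<open>Writing X for 1/t, differentiation of P(X) exp(-X) with respect to t replaces P by X^2
  (P - P').\<close>

definition flat_exp_deriv :: "real poly \<Rightarrow> real poly" where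
  "flat_exp_deriv P = [:0, 0, 1:] * (P - pderiv P)"

lemma poly_exp_tendsto_0: "((\<lambda>x::real. poly P x * exp (- x)) \<longlongrightarrow> 0) at_top"
proof -
  have "((\<lambda>x. \<Sum>i\<le>degree P. coeff P i * (x ^ i / exp x)) \<longlongrightarrow> (\<Sum>i\<le>degree P. coeff P i * 0)) at_top"
    by (intro tendsto_intros tendsto_power_div_exp_0)
  then show ?thesis by (simp add: poly_altdef sum_distrib_right exp_minus divide_inverse mult.assoc)
qed

lemma flat_exp_has_derivative: "(flat_exp P has_real_derivative flat_exp (flat_exp_deriv P) t) (at t)"
proof -
  consider "t > 0" | "t < 0" | "t = 0" by linarith
  then show ?thesis
  proof cases
    case 1
    have d: "((\<lambda>t. 1 / t) has_real_derivative - (1 / t\<^sup>2)) (at t)"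
      using 1 by (auto intro!: derivative_eq_intros simp: power2_eq_square)
    have "((\<lambda>t. poly P (1 / t)) has_real_derivative poly (pderiv P) (1 / t) * (- (1 / t\<^sup>2))) (at t)"
      by (rule DERIV_chain2[OF poly_DERIV d])
    from DERIV_mult[OF this DERIV_chain2[OF DERIV_exp DERIV_minus[OF d]]]
    have "((\<lambda>t. poly P (1 / t) * exp (- (1 / t))) has_real_derivative flat_exp (flat_exp_deriv P) t) (at t)"
      by (rule DERIV_cong)
        (use 1 in \<open>simp add: flat_exp_def flat_exp_deriv_def algebra_simps power2_eq_square\<close>)
    then show ?thesis
      by (rule has_field_derivative_transform_within_open[of _ _ _ "{0<..}"])
        (use 1 in \<open>auto simp: flat_exp_def\<close>)
  next
    case 2
    have "((\<lambda>t. 0) has_real_derivative flat_exp (flat_exp_deriv P) t) (at t)"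
      using 2 by (auto simp: flat_exp_def)
    then show ?thesis
      by (rule has_field_derivative_transform_within_open[of _ _ _ "{..<0}"])
        (use 2 in \<open>auto simp: flat_exp_def\<close>)
  next
    case 3
    have "((\<lambda>t. flat_exp P t / t) \<longlongrightarrow> 0) (at_left 0)"
      by (rule tendsto_eventually) (auto simp: flat_exp_def eventually_at_filter)
    moreover have "((\<lambda>t. flat_exp P t / t) \<longlongrightarrow> 0) (at_right 0)"
    proof -
      \<comment> \<open>With X = 1/t the difference quotient at 0 is X P(X) exp(-X), where X tends
        to infinity.\<close>
      have "((\<lambda>t. poly ([:0, 1:] * P) (inverse t) * exp (- inverse t)) \<longlongrightarrow> 0) (at_right (0::real))"
        by (rule filterlim_compose[OF poly_exp_tendsto_0 filterlim_inverse_at_top_right])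
      moreover have "eventually (\<lambda>t. poly ([:0, 1:] * P) (inverse t) * exp (- inverse t) = flat_exp P t / t) (at_right (0::real))"
        by (auto simp: eventually_at_filter flat_exp_def field_simps)
      ultimately show ?thesis by (rule Lim_transform_eventually)
    qed
    ultimately have "((\<lambda>t. flat_exp P t / t) \<longlongrightarrow> 0) (at 0)" by (simp add: filterlim_at_split)
    then show ?thesis using 3 by (simp add: has_field_derivative_iff flat_exp_def)
  qed
qed

text \<open>The direction is the first argument of \<open>q'\<close>, so that for each fixed
  direction the derivative is again a polynomial in the base point and can be differentiated
  further.\<close>

lemma real_polynomial_function_has_derivative:
  fixes q :: "'g::euclidean_space \<Rightarrow> real"
  assumes "real_polynomial_function q"
  shows "\<exists>q'. (\<forall>x. (q has_derivative (\<lambda>v. q' v x)) (at x)) \<and> (\<forall>v. real_polynomial_function (q' v))"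
  using assms
proof induction
  case (linear f)
  then show ?case by (intro exI[of _ "\<lambda>v x. f v"]) (auto intro: bounded_linear_imp_has_derivative)
next
  case (const c)
  then show ?case by (intro exI[of _ "\<lambda>v x. 0"]) auto
next
  case (add f g)
  then obtain f' g' where "\<forall>x. (f has_derivative (\<lambda>v. f' v x)) (at x)" "\<forall>v. real_polynomial_function (f' v)"
    "\<forall>x. (g has_derivative (\<lambda>v. g' v x)) (at x)" "\<forall>v. real_polynomial_function (g' v)" by blast
  then show ?case by (intro exI[of _ "\<lambda>v x. f' v x + g' v x"]) (auto intro!: has_derivative_add)
next
  case (mult f g)
  then obtain f' g' where *: "\<forall>x. (f has_derivative (\<lambda>v. f' v x)) (at x)" "\<forall>v. real_polynomial_function (f' v)"
    "\<forall>x. (g has_derivative (\<lambda>v. g' v x)) (at x)" "\<forall>v. real_polynomial_function (g' v)" by blast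
  show ?case
    by (intro exI[of _ "\<lambda>v x. f x * g' v x + f' v x * g x"])
      (use * mult in \<open>auto intro!: has_derivative_mult real_polynomial_function.intros(3,4)\<close>)
qed

lemma C1_on_real_polynomial_function:
  fixes q :: "'g::euclidean_space \<Rightarrow> real"
  assumes "real_polynomial_function q"
  shows "C1_on U q"
proof -
  obtain q' where q': "\<forall>x. (q has_derivative (\<lambda>v. q' v x)) (at x)" "\<forall>v. real_polynomial_function (q' v)"
    using real_polynomial_function_has_derivative[OF assms] by blast
  show ?thesis
    by (rule C1_onI[of _ _ "\<lambda>x v. q' v x"])
      (use q' in \<open>auto intro!: continuous_at_imp_continuous_on continuous_real_polymonial_function\<close>)
qed

text \<open>Up to sums, products of this form are closed under directional differentiation: the
  derivative hits either the polynomial, or \<open>flat_exp P\<close> with inner factor -2 (x . v).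
  Hence both \<open>q\<close> and \<open>P\<close> vary in the induction.\<close>

lemma Ck_on_polynomial_flat_exp:
  fixes q :: "'g::euclidean_space \<Rightarrow> real"
  assumes "real_polynomial_function q"
  shows "Ck_on n UNIV (\<lambda>x. q x * flat_exp P (r - x \<bullet> x))"
  using assms
proof (induction n arbitrary: q P)
  case 0
  have "continuous_on UNIV (flat_exp P)"
    by (rule DERIV_continuous_on[OF has_field_derivative_at_within[OF flat_exp_has_derivative]])
  then have "continuous_on UNIV (\<lambda>x::'g. flat_exp P (r - x \<bullet> x))"
    by (rule continuous_on_compose2) (auto intro!: continuous_intros)
  then show ?case
    using C1_on_imp_continuous_on[OF C1_on_real_polynomial_function[OF 0]] by (auto intro!: continuous_intros)
next
  case (Suc n)
  obtain q' where q': "\<And>x. (q has_derivative (\<lambda>v. q' v x)) (at x)" "\<And>v. real_polynomial_function (q' v)"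
    using real_polynomial_function_has_derivative[OF Suc.prems] by blast
  have der: "((\<lambda>x. q x * flat_exp P (r - x \<bullet> x)) has_derivative
      (\<lambda>v. q' v x * flat_exp P (r - x \<bullet> x) +
         (q x * (- 2 * (x \<bullet> v))) * flat_exp (flat_exp_deriv P) (r - x \<bullet> x))) (at x)" for x
  proof -
    have "((\<lambda>x. r - x \<bullet> x) has_derivative (\<lambda>v. 0 - (x \<bullet> v + v \<bullet> x))) (at x)"
      by (intro has_derivative_diff has_derivative_const has_derivative_inner has_derivative_ident)
    then have "((\<lambda>x. r - x \<bullet> x) has_derivative (\<lambda>v. - 2 * (x \<bullet> v))) (at x)"
      by (simp add: inner_commute)
    from has_derivative_compose[OF this flat_exp_has_derivative[of P "r - x \<bullet> x", unfolded has_field_derivative_def]]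
    have "((\<lambda>x. flat_exp P (r - x \<bullet> x)) has_derivative
        (\<lambda>v. flat_exp (flat_exp_deriv P) (r - x \<bullet> x) * (- 2 * (x \<bullet> v)))) (at x)" by simp
    from has_derivative_mult[OF q'(1) this] show ?thesis
      by (rule has_derivative_eq_rhs) (simp add: fun_eq_iff)
  qed
  have "Ck_on n UNIV (\<lambda>x. q' v x * flat_exp P (r - x \<bullet> x) +
         (q x * (- 2 * (x \<bullet> v))) * flat_exp (flat_exp_deriv P) (r - x \<bullet> x))" for v
    using Suc.prems q'(2) real_polynomial_function.intros(1)[OF bounded_linear_inner_left[of v]]
    by (intro Ck_on_add Suc.IH real_polynomial_function.intros(2-4)) simp_all
  moreover have "fderiv (\<lambda>x. q x * flat_exp P (r - x \<bullet> x)) x v = q' v x * flat_exp P (r - x \<bullet> x) +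
         (q x * (- 2 * (x \<bullet> v))) * flat_exp (flat_exp_deriv P) (r - x \<bullet> x)" for x v
    using fderiv_eqI[OF der] by metis
  ultimately have "Ck_on n UNIV (\<lambda>x. fderiv (\<lambda>x. q x * flat_exp P (r - x \<bullet> x)) x v)" for v
    by presburger
  then show ?case using der unfolding Ck_on.simps differentiable_def by blast
qed

text \<open>The kernel is exp(-1/(\<delta>^2 - |x|^2)) divided by its mass; the mass is nonzero
  since the kernel is positive on a ball, which is not a null set.\<close>

lemma bump_exists:
  assumes "\<delta> > 0"
  obtains \<eta> :: "'g::euclidean_space \<Rightarrow> real" where "smooth_on UNIV \<eta>" "\<And>x. 0 \<le> \<eta> x"
    "\<And>x. norm x > \<delta> \<Longrightarrow> \<eta> x = 0" "(LINT x|lborel. \<eta> x) = 1"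
proof -
  define k :: "'g \<Rightarrow> real" where "k x = 1 * flat_exp 1 (\<delta>\<^sup>2 - x \<bullet> x)" for x
  have ck: "continuous_on UNIV k"
    unfolding k_def by (rule Ck_on_polynomial_flat_exp[of "\<lambda>_. 1" 0, simplified Ck_on.simps]) auto
  have supp: "k x = 0" if "norm x > \<delta>" for x
  proof -
    have "\<delta>\<^sup>2 \<le> (norm x)\<^sup>2" using that assms by (intro power_mono) auto
    then show ?thesis by (simp add: k_def flat_exp_def dot_square_norm)
  qed
  have nn: "k x \<ge> 0" for x by (simp add: k_def flat_exp_def)
  have int: "integrable lborel k"
    by (rule integrable_compact_support[of "cball 0 \<delta>"]) (use supp ck in \<open>auto intro: continuous_on_subset\<close>)
  have "(LINT x|lborel. k x) \<noteq> 0"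
  proof
    assume "(LINT x|lborel. k x) = 0"
    then have "AE x in lborel. k x = 0" using integral_nonneg_eq_0_iff_AE[OF int] nn by auto
    moreover have "k x \<noteq> 0" if "norm x < \<delta>" for x
    proof -
      have "(norm x)\<^sup>2 < \<delta>\<^sup>2" using that by (intro power_strict_mono) auto
      then show ?thesis by (simp add: k_def flat_exp_def dot_square_norm)
    qed
    ultimately have "AE x::'g in lborel. x \<notin> ball 0 \<delta>" by auto
    then have "ball (0::'g) \<delta> \<in> null_sets lborel" by (subst AE_iff_null_sets) auto
    then have "negligible (ball (0::'g) \<delta>)" by (simp add: negligible_iff_null_sets null_sets_completionI)
    then show False using open_not_negligible[of "ball (0::'g) \<delta>"] assms by simp
  qed
  moreover have "(LINT x|lborel. k x) \<ge> 0" using nn by (intro Bochner_Integration.integral_nonneg)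
  ultimately have pos: "(LINT x|lborel. k x) > 0" by simp
  define c where "c = 1 / (LINT x|lborel. k x)"
  have "smooth_on UNIV (\<lambda>x. c * k x)"
    unfolding smooth_on_def k_def mult_1 by (intro allI Ck_on_polynomial_flat_exp real_polynomial_function.intros)
  moreover have "(LINT x|lborel. c * k x) = 1" using pos by (simp add: c_def)
  moreover have "0 \<le> c * k x" for x using nn pos by (simp add: c_def)
  ultimately show ?thesis using that[of "\<lambda>x. c * k x"] supp by auto
qed

section \<open>Convolution and smooth approximation\<close>

definition conv :: "('g::euclidean_space \<Rightarrow> real) \<Rightarrow> ('g \<Rightarrow> real) \<Rightarrow> 'g \<Rightarrow> real" where
  "conv k u x = (LINT y|lborel. k (x - y) * u y)"

text \<open>A fixed box containing the support of \<open>u\<close> makes \<open>leibniz_rule\<close>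
  and \<open>integral_continuous_on_param\<close> applicable.\<close>

lemma conv_eq_integral_cbox:
  assumes k: "continuous_on UNIV k" and u: "continuous_on UNIV u" "\<And>y. y \<notin> cbox a b \<Longrightarrow> u y = 0"
  shows "conv k u x = integral (cbox a b) (\<lambda>y. k (x - y) * u y)"
proof -
  have c: "continuous_on UNIV (\<lambda>y. k (x - y) * u y)"
    by (intro continuous_intros u continuous_on_compose2[OF k]) auto
  have "integrable lborel (\<lambda>y. k (x - y) * u y)"
    by (rule integrable_compact_support[of "cbox a b"]) (use u c in \<open>auto intro: continuous_on_subset\<close>)
  then have "conv k u x = integral UNIV (\<lambda>y. k (x - y) * u y)"
    unfolding conv_def by (simp add: integral_lborel)
  also have "\<dots> = integral UNIV (\<lambda>y. if y \<in> cbox a b then k (x - y) * u y else 0)"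
    using u(2) by (intro arg_cong[where f="integral UNIV"]) auto
  finally show ?thesis by (simp only: integral_restrict_UNIV)
qed

lemma conv_has_derivative:
  assumes k: "C1_on UNIV k" and u: "continuous_on UNIV u" "compact K" "\<And>y. y \<notin> K \<Longrightarrow> u y = 0"
  shows "(conv k u has_derivative (\<lambda>v. conv (\<lambda>x. fderiv k x v) u x)) (at x)"
proof -
  obtain a b where "K \<subseteq> cbox a b" using bounded_subset_cbox_symmetric[OF compact_imp_bounded[OF u(2)]] by metis
  then have u3: "\<And>y. y \<notin> cbox a b \<Longrightarrow> u y = 0" using u(3) by blast
  have ck: "continuous_on UNIV k" and ckd: "\<And>v. continuous_on UNIV (\<lambda>x. fderiv k x v)"
    using k C1_on_imp_continuous_on by (auto simp: C1_on_def)
  \<comment> \<open>The derivative in \<open>x\<close> is packaged as a bounded linear operator, the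
    form in which \<open>leibniz_rule\<close> takes it.\<close>
  define F where "F x y = Blinfun (\<lambda>v. fderiv k (x - y) v * u y)" for x y
  have bl: "bounded_linear (\<lambda>v. fderiv k (x - y) v * u y)" for x y
    using has_derivative_bounded_linear[OF C1_on_has_derivative[OF k UNIV_I]]
    by (rule bounded_linear_mult_const)
  have F: "blinfun_apply (F x y) = (\<lambda>v. fderiv k (x - y) v * u y)" for x y
    unfolding F_def using bl by (rule bounded_linear_Blinfun_apply)
  have "((\<lambda>x. integral (cbox a b) (\<lambda>y. k (x - y) * u y)) has_derivative
      integral (cbox a b) (F x)) (at x within UNIV)"
  proof (rule leibniz_rule)
    show "((\<lambda>x. k (x - y) * u y) has_derivative blinfun_apply (F x y)) (at x within UNIV)" for x y
    proof -
      have "((\<lambda>x. k (x - y)) has_derivative (\<lambda>v. fderiv k (x - y) v)) (at x)"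
        by (rule has_derivative_compose[OF _ C1_on_has_derivative[OF k UNIV_I], of "\<lambda>x. x - y" "\<lambda>v. v" x UNIV, simplified])
          (auto intro!: derivative_eq_intros)
      then show ?thesis unfolding F by (auto intro: has_derivative_mult_left)
    qed
    show "(\<lambda>y. k (x - y) * u y) integrable_on cbox a b" for x
      by (intro integrable_continuous continuous_intros continuous_on_compose2[OF ck] continuous_on_subset[OF u(1)]) auto
    show "continuous_on (UNIV \<times> cbox a b) (\<lambda>(x, y). F x y)"
    proof (rule continuous_on_blinfun_componentwise)
      fix v :: 'a
      show "continuous_on (UNIV \<times> cbox a b) (\<lambda>z. blinfun_apply (case z of (x, y) \<Rightarrow> F x y) v)"
        unfolding case_prod_beta F
        by (intro continuous_intros continuous_on_compose2[OF ckd] continuous_on_compose2[OF u(1)]) auto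
    qed
  qed auto
  moreover have "blinfun_apply (integral (cbox a b) (F x)) = (\<lambda>v. conv (\<lambda>x. fderiv k x v) u x)"
  proof
    fix v
    have "F x integrable_on cbox a b"
    proof (rule integrable_continuous)
      show "continuous_on (cbox a b) (F x)"
        by (rule continuous_on_blinfun_componentwise, unfold F)
          (intro continuous_intros continuous_on_compose2[OF ckd] continuous_on_subset[OF u(1)]; simp)
    qed
    then have "blinfun_apply (integral (cbox a b) (F x)) v = integral (cbox a b) (\<lambda>y. blinfun_apply (F x y) v)"
      by (rule blinfun_apply_integral)
    then show "blinfun_apply (integral (cbox a b) (F x)) v = conv (\<lambda>x. fderiv k x v) u x"
      unfolding F using conv_eq_integral_cbox[OF ckd u(1), of a b v x] u3 by simp
  qed
  moreover have "conv k u = (\<lambda>x. integral (cbox a b) (\<lambda>y. k (x - y) * u y))"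
    using conv_eq_integral_cbox[OF ck u(1) u3] by (rule ext)
  ultimately show ?thesis by simp
qed

lemma continuous_on_conv:
  assumes k: "continuous_on UNIV k" and u: "continuous_on UNIV u" "compact K" "\<And>y. y \<notin> K \<Longrightarrow> u y = 0"
  shows "continuous_on UNIV (conv k u)"
proof -
  obtain a b where "K \<subseteq> cbox a b" using bounded_subset_cbox_symmetric[OF compact_imp_bounded[OF u(2)]] by metis
  then have u3: "\<And>y. y \<notin> cbox a b \<Longrightarrow> u y = 0" using u(3) by blast
  have "continuous_on UNIV (\<lambda>x. integral (cbox a b) (\<lambda>y. k (x - y) * u y))"
    by (rule integral_continuous_on_param, unfold case_prod_beta)
      (intro continuous_intros continuous_on_compose2[OF k] continuous_on_compose2[OF u(1)]; auto)
  moreover have "conv k u = (\<lambda>x. integral (cbox a b) (\<lambda>y. k (x - y) * u y))"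
    using conv_eq_integral_cbox[OF k u(1) u3] by (rule ext)
  ultimately show ?thesis by simp
qed

lemma Ck_on_conv:
  assumes u: "continuous_on UNIV u" "compact K" "\<And>y. y \<notin> K \<Longrightarrow> u y = 0" and k: "Ck_on n UNIV k"
  shows "Ck_on n UNIV (conv k u)"
  using k
proof (induction n arbitrary: k)
  case 0
  then show ?case using continuous_on_conv[OF _ u] by auto
next
  case (Suc n)
  have "Ck_on (Suc 0) UNIV k" using Suc.prems by (cases n) (auto intro!: continuous_at_imp_continuous_on differentiable_imp_continuous_within)
  then have "C1_on UNIV k" by (simp only: C1_on_iff_Ck_on)
  note d = conv_has_derivative[OF this u]
  have "fderiv (conv k u) x v = conv (\<lambda>x. fderiv k x v) u x" for x v using fderiv_eqI[OF d] by metis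
  then have "(\<lambda>x. fderiv (conv k u) x v) = conv (\<lambda>x. fderiv k x v) u" for v by (rule ext)
  then show ?case using d Suc by (auto simp: differentiable_def)
qed

text \<open>Substitution of x - y for y. It lets a derivative of a mollified function fall on the
  function instead of the kernel.\<close>

lemma conv_commute:
  assumes "continuous_on UNIV k" "continuous_on UNIV u"
  shows "conv k u x = conv u k x"
proof -
  have "continuous_on UNIV (\<lambda>y. k (x - y) * u y)"
    by (intro continuous_intros assms continuous_on_compose2[OF assms(1)]) auto
  from integral_reflect[OF borel_measurable_continuous_onI[OF this], of x]
  show ?thesis unfolding conv_def by (simp add: mult.commute)
qed

text \<open>A convolution with a kernel of mass one is an average. The reference value
  \<open>t\<close> is free: t = u x gives uniform closeness, e = 0 the exact value where
  \<open>u\<close> is locally constant, and t = e = 1/2 keeps values between 0 and 1.\<close>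

lemma conv_approx:
  assumes u: "continuous_on UNIV u"
    and \<eta>: "continuous_on UNIV \<eta>" "\<And>x. 0 \<le> \<eta> x" "\<And>x. norm x > \<delta> \<Longrightarrow> \<eta> x = 0" "(LINT x|lborel. \<eta> x) = 1"
    and close: "\<And>y. dist y x \<le> \<delta> \<Longrightarrow> \<bar>u y - t\<bar> \<le> e"
  shows "\<bar>conv \<eta> u x - t\<bar> \<le> e"
proof -
  have i1: "integrable lborel \<eta>"
    by (rule integrable_compact_support[of "cball 0 \<delta>"]) (use \<eta> in \<open>auto intro: continuous_on_subset\<close>)
  have i2: "integrable lborel (\<lambda>y. u (x - y) * \<eta> y)"
  proof (rule integrable_compact_support[of "cball 0 \<delta>"])
    show "continuous_on (cball 0 \<delta>) (\<lambda>y. u (x - y) * \<eta> y)"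
      by (intro continuous_intros continuous_on_compose2[OF u] continuous_on_subset[OF \<eta>(1)]) auto
  qed (use \<eta> in auto)
  have i3: "integrable lborel (\<lambda>y. (u (x - y) - t) * \<eta> y)"
    using i1 i2 by (simp add: left_diff_distrib)
  have "conv \<eta> u x - t = (LINT y|lborel. u (x - y) * \<eta> y) - (LINT y|lborel. t * \<eta> y)"
    using conv_commute[OF \<eta>(1) u] \<eta>(4) by (simp add: conv_def)
  also have "\<dots> = (LINT y|lborel. (u (x - y) - t) * \<eta> y)"
    using i1 i2 by (subst Bochner_Integration.integral_diff[symmetric]) (auto simp: left_diff_distrib)
  finally have "\<bar>conv \<eta> u x - t\<bar> \<le> (LINT y|lborel. \<bar>(u (x - y) - t) * \<eta> y\<bar>)"
    by (simp add: integral_abs_bound)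
  also have "\<dots> \<le> (LINT y|lborel. e * \<eta> y)"
  proof (rule integral_mono)
    show "\<bar>(u (x - y) - t) * \<eta> y\<bar> \<le> e * \<eta> y" for y
    proof (cases "norm y > \<delta>")
      case False
      then have "\<bar>u (x - y) - t\<bar> \<le> e" by (intro close) (simp add: dist_norm)
      then show ?thesis using \<eta>(2)[of y] by (simp add: abs_mult mult_right_mono)
    qed (simp add: \<eta>(3))
  qed (use i1 i3 in auto)
  also have "\<dots> = e" using \<eta>(4) by simp
  finally show ?thesis .
qed

lemma smooth_on_imp_C1_on: "smooth_on UNIV u \<Longrightarrow> C1_on UNIV u"
  unfolding C1_on_iff_Ck_on smooth_on_def by blast

lemma compact_thickening:
  fixes K :: "'g::euclidean_space set"
  assumes "compact K"
  shows "compact {x. \<exists>y\<in>K. dist y x \<le> r}"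
proof -
  have "{x. \<exists>y\<in>K. dist y x \<le> r} = {y + z |y z. y \<in> K \<and> z \<in> cball (0::'g) r}"
  proof (intro set_eqI iffI; clarsimp)
    fix x y assume "y \<in> K" "dist y x \<le> r"
    then show "\<exists>y z. x = y + z \<and> y \<in> K \<and> norm z \<le> r"
      by (intro exI[of _ y] exI[of _ "x - y"]) (auto simp: dist_norm norm_minus_commute)
  next
    fix y z :: 'g assume "y \<in> K" "norm z \<le> r"
    then show "\<exists>ya\<in>K. dist ya (y + z) \<le> r" by (intro bexI[of _ y]) (auto simp: dist_norm)
  qed
  then show ?thesis using compact_sums[OF assms compact_cball[of 0 r]] by simp
qed

text \<open>Mollification at a scale below the uniform continuity scales of \<open>u\<close> and of
  its partial derivatives. The clause on derivatives is conditional so that the same lemma serves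
  functions that are only continuous, such as Urysohn functions.\<close>

lemma smooth_approx:
  fixes u :: "'g::euclidean_space \<Rightarrow> real"
  assumes u: "continuous_on UNIV u" and K: "compact K" "\<And>y. y \<notin> K \<Longrightarrow> u y = 0" and "e > 0" "\<delta> > 0"
  obtains w where "smooth_on UNIV w" "\<And>x. \<bar>w x - u x\<bar> \<le> e"
    "\<And>x. (\<And>y. y \<in> K \<Longrightarrow> dist y x > \<delta>) \<Longrightarrow> w x = 0"
    "C1_on UNIV u \<Longrightarrow> (\<forall>x. \<forall>b\<in>Basis. \<bar>fderiv w x b - fderiv u x b\<bar> \<le> e)"
    "\<And>x t d. (\<And>y. dist y x \<le> \<delta> \<Longrightarrow> \<bar>u y - t\<bar> \<le> d) \<Longrightarrow> \<bar>w x - t\<bar> \<le> d"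
proof -
  have unif: "\<exists>d>0. \<forall>x y. dist y x \<le> d \<longrightarrow> \<bar>v y - v x\<bar> \<le> e" 
    if v: "continuous_on UNIV v" "\<And>y. y \<notin> K \<Longrightarrow> v y = 0" for v :: "'g \<Rightarrow> real"
  proof -
    \<comment> \<open>Two points at distance at most 1, one of them in \<open>K\<close>, both lie in
      this compact set, so uniform continuity on \<open>L\<close> covers every pair at which
      \<open>v\<close> is not zero twice.\<close>
    define L where "L = {x. \<exists>y\<in>K. dist y x \<le> 1}"
    have "compact L" unfolding L_def by (rule compact_thickening[OF K(1)])
    then have "uniformly_continuous_on L v"
      using v(1) by (intro compact_uniformly_continuous) (auto intro: continuous_on_subset)
    then obtain d where d: "d > 0" "\<And>x y. x \<in> L \<Longrightarrow> y \<in> L \<Longrightarrow> dist y x < d \<Longrightarrow> dist (v y) (v x) < e"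
      unfolding uniformly_continuous_on_def using \<open>e > 0\<close> by metis
    have near: "y \<in> L" if "x \<in> K" "dist y x \<le> 1" for x y
      using that by (auto simp: L_def dist_commute intro!: bexI[of _ x])
    have "\<bar>v y - v x\<bar> \<le> e" if "dist y x \<le> min 1 (d / 2)" for x y
    proof (cases "x \<in> K \<or> y \<in> K")
      case True
      then have "x \<in> L" "y \<in> L" using near[of x y] near[of y x] near[of x x] near[of y y] that
        by (auto simp: dist_commute)
      then have "dist (v y) (v x) < e" using that \<open>d > 0\<close> by (intro d) auto
      then show ?thesis by (simp add: dist_real_def)
    qed (use v \<open>e > 0\<close> in auto)
    then show ?thesis using \<open>d > 0\<close> by (intro exI[of _ "min 1 (d / 2)"]) auto
  qed
  obtain d0 where d0: "d0 > 0" "\<And>x y. dist y x \<le> d0 \<Longrightarrow> \<bar>u y - u x\<bar> \<le> e" using unif[OF u K(2)] by blast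
  have "\<exists>d>0. \<forall>x y. \<forall>b\<in>Basis. dist y x \<le> d \<longrightarrow> \<bar>fderiv u y b - fderiv u x b\<bar> \<le> e" if C1: "C1_on UNIV u"
  proof -
    have "\<forall>b. \<exists>d>0. \<forall>x y. dist y x \<le> d \<longrightarrow> \<bar>fderiv u y b - fderiv u x b\<bar> \<le> e"
      using C1 fderiv_outside_support[of K u, OF K] by (intro allI unif) (auto simp: C1_on_def)
    then obtain dd where dd: "\<And>b. dd b > 0" "\<And>b x y. dist y x \<le> dd b \<Longrightarrow> \<bar>fderiv u y b - fderiv u x b\<bar> \<le> e"
      by metis
    show ?thesis
      by (rule exI[of _ "Min (dd ` Basis)"]) (use dd in auto)
  qed
  \<comment> \<open>If \<open>u\<close> is not of class C1 the implication is vacuous and any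
    positive \<open>d\<close> serves.\<close>
  then have "\<exists>d>0. C1_on UNIV u \<longrightarrow> (\<forall>x y. \<forall>b\<in>Basis. dist y x \<le> d \<longrightarrow> \<bar>fderiv u y b - fderiv u x b\<bar> \<le> e)"
    using zero_less_one by (cases "C1_on UNIV u") blast+
  then obtain d1 where d1: "d1 > 0" "\<And>x y b. C1_on UNIV u \<Longrightarrow> b \<in> Basis \<Longrightarrow> dist y x \<le> d1 \<Longrightarrow> \<bar>fderiv u y b - fderiv u x b\<bar> \<le> e"
    by blast
  define r where "r = min \<delta> (min d0 d1)"
  have "r > 0" using d0 d1 \<open>\<delta> > 0\<close> by (simp add: r_def)
  obtain \<eta> :: "'g \<Rightarrow> real" where \<eta>: "smooth_on UNIV \<eta>" "\<And>x. 0 \<le> \<eta> x" "\<And>x. norm x > r \<Longrightarrow> \<eta> x = 0"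
    "(LINT x|lborel. \<eta> x) = 1" using bump_exists[OF \<open>r > 0\<close>] by blast
  have C1\<eta>: "C1_on UNIV \<eta>" by (rule smooth_on_imp_C1_on[OF \<eta>(1)])
  have c\<eta>: "continuous_on UNIV \<eta>" by (rule C1_on_imp_continuous_on[OF C1\<eta>])
  let ?w = "conv \<eta> u"
  have 5: "\<bar>?w x - t\<bar> \<le> d" if "\<And>y. dist y x \<le> \<delta> \<Longrightarrow> \<bar>u y - t\<bar> \<le> d" for x t d
    by (rule conv_approx[OF u c\<eta> \<eta>(2-4)]) (use that in \<open>auto simp: r_def\<close>)
  show ?thesis
  proof (rule that)
    show "smooth_on UNIV ?w" using \<eta>(1) Ck_on_conv[OF u K] by (simp add: smooth_on_def)
    show "\<bar>?w x - u x\<bar> \<le> e" for x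
      by (rule conv_approx[OF u c\<eta> \<eta>(2-4)]) (use d0 in \<open>auto simp: r_def\<close>)
    show "?w x = 0" if "\<And>y. y \<in> K \<Longrightarrow> dist y x > \<delta>" for x
    proof -
      have "\<bar>?w x - 0\<bar> \<le> 0" by (rule 5) (use K(2) that in force)
      then show ?thesis by simp
    qed
    show "\<forall>x. \<forall>b\<in>Basis. \<bar>fderiv ?w x b - fderiv u x b\<bar> \<le> e" if C1: "C1_on UNIV u"
    proof (intro allI ballI)
      fix x b :: 'g assume b: "b \<in> Basis"
      have cd: "continuous_on UNIV (\<lambda>x. fderiv u x b)" using C1 by (simp add: C1_on_def)
      \<comment> \<open>With the factors exchanged, \<open>u\<close> is the differentiated kernel
        and \<open>\<eta>\<close> the compactly supported factor.\<close>
      have eq: "?w = conv u \<eta>" using conv_commute[OF c\<eta> u] by (rule ext)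
      have "fderiv ?w x = (\<lambda>v. conv (\<lambda>x. fderiv u x v) \<eta> x)"
        unfolding eq by (rule fderiv_eqI[OF conv_has_derivative[OF C1 c\<eta> compact_cball[of 0 r]]]) (use \<eta> in auto)
      then have "fderiv ?w x b = conv \<eta> (\<lambda>x. fderiv u x b) x"
        using conv_commute[OF c\<eta> cd] by simp
      moreover have "\<bar>conv \<eta> (\<lambda>x. fderiv u x b) x - fderiv u x b\<bar> \<le> e"
        by (rule conv_approx[OF cd c\<eta> \<eta>(2-4)]) (use d1(2)[OF C1 b] in \<open>auto simp: r_def\<close>)
      ultimately show "\<bar>fderiv ?w x b - fderiv u x b\<bar> \<le> e" by simp
    qed
  qed (rule 5)
qed

lemma test_functionsI:
  assumes "smooth_on UNIV w" "compact K" "K \<subseteq> U" "\<And>x. x \<notin> K \<Longrightarrow> w x = 0"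
  shows "w \<in> test_functions U"
proof -
  have "closure {x. w x \<noteq> 0} \<subseteq> K"
    using assms by (intro closure_minimal) (auto simp: compact_imp_closed)
  moreover have "compact (closure {x. w x \<noteq> 0})"
    using bounded_subset[OF compact_imp_bounded[OF assms(2)], of "{x. w x \<noteq> 0}"] assms(4)
    by (auto simp: compact_closure)
  ultimately show ?thesis using assms by (auto simp: test_functions_def)
qed

lemma test_functions_C1c: "w \<in> test_functions U \<Longrightarrow> w \<in> C1c U"
  by (rule C1cI[of _ "closure {x. w x \<noteq> 0}"])
    (use closure_subset[of "{x. w x \<noteq> 0}"] in \<open>auto simp: test_functions_def intro: smooth_on_imp_C1_on\<close>)

lemma compact_cball_neighbourhood:
  fixes K :: "'g::euclidean_space set"
  assumes "compact K" "open U" "K \<subseteq> U"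
  obtains \<delta> where "\<delta> > 0" "\<And>r. r \<le> \<delta> \<Longrightarrow> compact {x. \<exists>y\<in>K. dist y x \<le> r}"
    "\<And>r. r \<le> \<delta> \<Longrightarrow> {x. \<exists>y\<in>K. dist y x \<le> r} \<subseteq> U"
proof -
  obtain d where "d > 0" and d: "(\<Union>y\<in>K. cball y d) \<subseteq> U"
    using compact_subset_open_imp_cball_epsilon_subset[OF assms] by blast
  show ?thesis
  proof (rule that[OF \<open>d > 0\<close>])
    fix r assume "r \<le> d"
    show "compact {x. \<exists>y\<in>K. dist y x \<le> r}" by (rule compact_thickening[OF assms(1)])
    show "{x. \<exists>y\<in>K. dist y x \<le> r} \<subseteq> U"
    proof
      fix x assume "x \<in> {x. \<exists>y\<in>K. dist y x \<le> r}"
      then obtain y where "y \<in> K" "dist y x \<le> d" using \<open>r \<le> d\<close> by auto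
      then have "x \<in> (\<Union>y\<in>K. cball y d)" by auto
      then show "x \<in> U" using d by (rule subsetD[rotated])
    qed
  qed
qed

text \<open>A Urysohn function that is 1 on the \<delta>/2-neighbourhood of \<open>K\<close> and 0
  off the 3\<delta>/4-neighbourhood is mollified at scale \<delta>/4. What remains is exactly 1 on
  the \<delta>/4-neighbourhood and 0 off the \<delta>-neighbourhood.\<close>

lemma smooth_cutoff:
  fixes K :: "'g::euclidean_space set"
  assumes "compact K" "open U" "K \<subseteq> U"
  obtains w W where "w \<in> test_functions U" "\<And>x. 0 \<le> w x" "\<And>x. w x \<le> 1" "open W" "K \<subseteq> W"
    "\<And>x. x \<in> W \<Longrightarrow> w x = 1"
proof -
  obtain \<delta> where \<delta>: "\<delta> > 0" "\<And>r. r \<le> \<delta> \<Longrightarrow> compact {x. \<exists>y\<in>K. dist y x \<le> r}"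
    "\<And>r. r \<le> \<delta> \<Longrightarrow> {x. \<exists>y\<in>K. dist y x \<le> r} \<subseteq> U"
    using compact_cball_neighbourhood[OF assms] by blast
  define S where "S r = {x. \<exists>y\<in>K. dist y x \<le> r}" for r
  define W where "W = (\<Union>y\<in>K. ball y (\<delta> / 4))"
  have S: "compact (S r)" "S r \<subseteq> U" if "r \<le> \<delta>" for r using \<delta> that by (auto simp: S_def)
  define T where "T = - (\<Union>y\<in>K. ball y (3 * \<delta> / 4))"
  have "closed T" by (auto simp: T_def)
  have "closed (S (\<delta> / 2))" using S \<delta>(1) by (simp add: compact_imp_closed)
  have disj: "T \<inter> S (\<delta> / 2) = {}" using \<delta>(1) by (force simp: T_def S_def)
  obtain g :: "'g \<Rightarrow> real" where g: "continuous_on UNIV g" "\<And>x. g x \<in> closed_segment 0 1"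
    "\<And>x. x \<in> T \<Longrightarrow> g x = 0" "\<And>x. x \<in> S (\<delta> / 2) \<Longrightarrow> g x = 1"
    using Urysohn[OF \<open>closed T\<close> \<open>closed (S (\<delta> / 2))\<close> disj, of 0 1] by metis
  have g01: "0 \<le> g x" "g x \<le> 1" for x using g(2)[of x] by (auto simp: closed_segment_eq_real_ivl)
  have g0: "g x = 0" if "x \<notin> S (3 * \<delta> / 4)" for x
    using that by (intro g(3)) (force simp: T_def S_def)
  have cS: "compact (S (3 * \<delta> / 4))" using S \<delta>(1) by simp
  obtain w where w: "smooth_on UNIV w" "\<And>x. (\<And>y. y \<in> S (3 * \<delta> / 4) \<Longrightarrow> dist y x > \<delta> / 4) \<Longrightarrow> w x = 0"
    "\<And>x t d. (\<And>y. dist y x \<le> \<delta> / 4 \<Longrightarrow> \<bar>g y - t\<bar> \<le> d) \<Longrightarrow> \<bar>w x - t\<bar> \<le> d"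
    using smooth_approx[OF g(1) cS g0, of 1 "\<delta> / 4"] \<delta>(1) by (metis divide_pos_pos zero_less_numeral zero_less_one)
  show ?thesis
  proof (rule that[of w W])
    show "w \<in> test_functions U"
    proof (rule test_functionsI[OF w(1) S[of \<delta>]])
      show "w x = 0" if "x \<notin> S \<delta>" for x
      proof (rule w(2))
        fix y assume "y \<in> S (3 * \<delta> / 4)"
        then obtain z where z: "z \<in> K" "dist z y \<le> 3 * \<delta> / 4" by (auto simp: S_def)
        have "dist z x > \<delta>" using that z(1) by (force simp: S_def)
        then show "\<delta> / 4 < dist y x" using z(2) dist_triangle[of z x y] by linarith
      qed
    qed auto
    have half: "\<bar>w x - 1 / 2\<bar> \<le> 1 / 2" for x
    proof (rule w(3))
      show "\<bar>g y - 1 / 2\<bar> \<le> 1 / 2" for y using g01[of y] by linarith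
    qed
    show "0 \<le> w x" "w x \<le> 1" for x using half[of x] by linarith+
    show "open W" by (auto simp: W_def)
    show "K \<subseteq> W" using \<delta>(1) by (force simp: W_def)
    show "w x = 1" if x: "x \<in> W" for x
    proof -
      have "\<bar>w x - 1\<bar> \<le> 0"
      proof (rule w(3))
        fix y assume y: "dist y x \<le> \<delta> / 4"
        obtain z where z: "z \<in> K" "dist z x < \<delta> / 4" using x by (auto simp: W_def)
        have "dist z y \<le> \<delta> / 2" using dist_triangle[of z y x] y z(2) dist_commute[of x y] by linarith
        then have "y \<in> S (\<delta> / 2)" using z(1) by (auto simp: S_def)
        then show "\<bar>g y - 1\<bar> \<le> 0" using g(4) by simp
      qed
      then show ?thesis by simp
    qed
  qed
qed

section \<open>Fundamental lemma of the calculus of variations\<close>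

lemma set_lebesgue_integral_support:
  assumes "\<And>x. x \<notin> U \<Longrightarrow> u x = (0::real)"
  shows "(LINT x:U|M. u x) = (LINT x|M. u x)"
  unfolding set_lebesgue_integral_def
  by (rule Bochner_Integration.integral_cong) (use assms in \<open>auto simp: indicator_def\<close>)

text \<open>Closed sets are an intersection-stable generator of the Borel sets, and the sets over
  which \<open>h\<close> integrates to zero form a Dynkin system. Then \<open>h\<close> and 0 are
  densities of the same signed measure.\<close>

lemma AE_zero_of_closed_integrals:
  fixes h :: "'g::euclidean_space \<Rightarrow> real"
  assumes h: "integrable lborel h" and z: "\<And>C. closed C \<Longrightarrow> (LINT x:C|lborel. h x) = 0"
  shows "AE x in lborel. h x = 0"
proof (rule density_unique_real[OF h, of "\<lambda>_. 0"])
  fix A :: "'g set" assume "A \<in> sets lborel"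
  then have "A \<in> sigma_sets UNIV {C. closed C}" by (simp add: borel_eq_closed sets_measure_of_conv)
  moreover have "Int_stable {C::'g set. closed C}" by (auto simp: Int_stable_def)
  moreover have "{C::'g set. closed C} \<subseteq> Pow UNIV" by simp
  ultimately have "A \<in> sigma_sets UNIV {C. closed C}" "Int_stable {C::'g set. closed C}"
    "{C::'g set. closed C} \<subseteq> Pow UNIV" by blast+
  from this(2,3,1) have "(LINT x:A|lborel. h x) = 0"
  proof (induction rule: sigma_sets_induct_disjoint)
    case (basic A)
    then show ?case using z by auto
  next
    case (compl A)
    have A: "A \<in> sets lborel" using compl(1) by (simp add: borel_eq_closed sets_measure_of_conv)
    have "(LINT x:UNIV|lborel. h x) = (LINT x:A|lborel. h x) + (LINT x:UNIV - A|lborel. h x)"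
      using A h by (subst set_integral_Un[symmetric])
        (auto simp: set_integrable_def intro!: integrable_mult_indicator simp del: real_scaleR_def)
    then show ?case using compl z[of UNIV] by simp
  next
    case (union A)
    have "range A \<subseteq> sets lborel" using union(2) by (simp add: borel_eq_closed sets_measure_of_conv)
    then have "(LINT x:(\<Union>i. A i)|lborel. h x) = (\<Sum>i. LINT x:A i|lborel. h x)"
      using union(1) h by (intro lebesgue_integral_countable_add)
        (auto simp: disjoint_family_on_def set_integrable_def intro!: integrable_mult_indicator simp del: real_scaleR_def)
    then show ?case using union by simp
  qed (simp_all add: set_lebesgue_integral_def)
  then show "(LINT x:A|lborel. h x) = (LINT x:A|lborel. 0)" by simp
qed simp

section \<open>Weak horizontal gradients\<close>

lemma tendsto_indicator_exhaustion:
  assumes "\<And>n. C n \<subseteq> U" "\<And>n. C n \<subseteq> C (Suc n)" "(\<Union>n. C n) = U"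
  shows "(\<lambda>n. indicator (C n) x :: real) \<longlonglongrightarrow> indicator U x"
proof -
  have "incseq C" using assms(2) by (rule incseq_SucI)
  then show ?thesis using LIMSEQ_indicator_incseq[of C x] assms(3) by simp
qed

lemma open_exhaustion:
  fixes U :: "'g::euclidean_space set"
  assumes "open U"
  obtains C :: "nat \<Rightarrow> 'g set" where "\<And>n. compact (C n)" "\<And>n. C n \<subseteq> U" "\<And>n. C n \<subseteq> C (Suc n)" "(\<Union>n. C n) = U"
  using open_Union_compact_subsets[OF assms] interior_subset by (metis subset_trans)

text \<open>Cutoffs equal to 1 on \<open>K\<close> and supported in shrinking neighbourhoods
  \<open>W n\<close> converge pointwise to the indicator of \<open>K\<close>. All are supported in
  one compact \<open>L\<close>, on which |h| is an integrable majorant.\<close>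

lemma closed_integrals_zero_of_test_functions:
  fixes h :: "'g::euclidean_space \<Rightarrow> real"
  assumes "open U" and loc: "\<And>K. compact K \<Longrightarrow> K \<subseteq> U \<Longrightarrow> set_integrable lborel K h"
    and z: "\<And>w. w \<in> test_functions U \<Longrightarrow> (LINT x:U|lborel. h x * w x) = 0"
    and K: "compact K" "K \<subseteq> U"
  shows "(LINT x:K|lborel. h x) = 0"
proof -
  obtain \<delta> where \<delta>: "\<delta> > 0" "\<And>r. r \<le> \<delta> \<Longrightarrow> compact {x. \<exists>y\<in>K. dist y x \<le> r}"
    "\<And>r. r \<le> \<delta> \<Longrightarrow> {x. \<exists>y\<in>K. dist y x \<le> r} \<subseteq> U"
    using compact_cball_neighbourhood[OF K(1) \<open>open U\<close> K(2)] by blast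
  define L where "L = {x. \<exists>y\<in>K. dist y x \<le> \<delta>}"
  have L: "compact L" "L \<subseteq> U" using \<delta> by (auto simp: L_def)
  define W where "W n = (\<Union>y\<in>K. ball y (\<delta> / Suc n))" for n
  have oW: "open (W n)" and KW: "K \<subseteq> W n" for n using \<delta>(1) by (force simp: W_def)+
  have WL: "W n \<subseteq> L" for n
  proof
    fix x assume "x \<in> W n"
    then obtain y where y: "y \<in> K" "dist y x < \<delta> / Suc n" by (auto simp: W_def)
    have "\<delta> / Suc n \<le> \<delta>" using \<delta>(1) by (simp add: divide_le_eq)
    then show "x \<in> L" using y by (auto simp: L_def intro!: bexI[of _ y])
  qed
  have "\<exists>w. w \<in> test_functions (W n) \<and> (\<forall>x. 0 \<le> w x \<and> w x \<le> 1) \<and> (\<forall>x\<in>K. w x = 1)" for n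
    using smooth_cutoff[OF K(1) oW KW] by (metis subsetD)
  then obtain w where w: "\<And>n. w n \<in> test_functions (W n)" "\<And>n x. 0 \<le> w n x" "\<And>n x. w n x \<le> 1"
    "\<And>n x. x \<in> K \<Longrightarrow> w n x = 1" by metis
  have w0: "w n x = 0" if "x \<notin> W n" for n x
    using w(1)[of n] that closure_subset[of "{x. w n x \<noteq> 0}"] by (auto simp: test_functions_def)
  have wU: "w n \<in> test_functions U" for n
    using w(1)[of n] WL[of n] L(2) by (auto simp: test_functions_def)
  have lim: "(\<lambda>n. w n x) \<longlonglongrightarrow> indicator K x" for x
  proof (cases "x \<in> K")
    case False
    have "eventually (\<lambda>n. w n x = 0) sequentially"
    proof (cases "K = {}")
      case True
      then show ?thesis using w0 by (auto simp: W_def)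
    next
      case ne: False
      then have "infdist x K > 0"
        using False compact_imp_closed[OF K(1)] by (simp add: infdist_pos_not_in_closed)
      then have "infdist x K / \<delta> > 0" using \<delta>(1) by simp
      from reals_Archimedean[OF this] obtain N where "inverse (real (Suc N)) < infdist x K / \<delta>" by blast
      then have N: "\<delta> / Suc N < infdist x K" using \<delta>(1) by (simp add: field_simps)
      show ?thesis unfolding eventually_sequentially
      proof (intro exI allI impI)
        fix n assume n: "N \<le> n"
        show "w n x = 0"
        proof (rule w0, rule notI)
          assume "x \<in> W n"
          then obtain y where y: "y \<in> K" "dist y x < \<delta> / Suc n" by (auto simp: W_def)
          have "infdist x K \<le> dist x y" using y(1) by (rule infdist_le)
          moreover have "\<delta> / Suc n \<le> \<delta> / Suc N" using n \<delta>(1) by (intro divide_left_mono) auto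
          ultimately show False using y(2) N by (simp add: dist_commute)
        qed
      qed
    qed
    then show ?thesis using False by (simp add: tendsto_eventually)
  qed (simp add: w(4))
  have intL: "set_integrable lborel L h" by (rule loc[OF L])
  have "(\<lambda>n. LINT x|lborel. (indicator L x *\<^sub>R h x) * w n x) \<longlonglongrightarrow> (LINT x|lborel. (indicator L x *\<^sub>R h x) * indicator K x)"
  proof (rule integral_dominated_convergence[where w="\<lambda>x. norm (indicator L x *\<^sub>R h x)"])
    have [measurable]: "(\<lambda>x. indicator L x *\<^sub>R h x) \<in> borel_measurable lborel"
      using intL by (simp add: set_integrable_def)
    have [measurable]: "w n \<in> borel_measurable borel" for n
      by (rule borel_measurable_continuous_onI[OF C1_on_imp_continuous_on[OF C1c_C1_on[OF test_functions_C1c[OF w(1)]]]])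
    show "(\<lambda>x. (indicator L x *\<^sub>R h x) * w n x) \<in> borel_measurable lborel" for n by measurable
    have [measurable]: "K \<in> sets borel" using K(1) by (rule borel_compact)
    show "(\<lambda>x. (indicator L x *\<^sub>R h x) * indicator K x) \<in> borel_measurable lborel" by measurable
    show "integrable lborel (\<lambda>x. norm (indicator L x *\<^sub>R h x))"
      using intL by (simp add: set_integrable_def integrable_norm del: real_scaleR_def)
    show "AE x in lborel. (\<lambda>n. (indicator L x *\<^sub>R h x) * w n x) \<longlonglongrightarrow> (indicator L x *\<^sub>R h x) * indicator K x"
      by (intro AE_I2 tendsto_intros lim)
    show "AE x in lborel. norm ((indicator L x *\<^sub>R h x) * w n x) \<le> norm (indicator L x *\<^sub>R h x)" for n
    proof (rule AE_I2)
      fix x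
      have "\<bar>w n x\<bar> \<le> 1" using w(2,3)[of n x] by simp
      then show "norm ((indicator L x *\<^sub>R h x) * w n x) \<le> norm (indicator L x *\<^sub>R h x)"
        by (simp add: abs_mult mult_left_le)
    qed
  qed
  moreover have "(LINT x|lborel. (indicator L x *\<^sub>R h x) * w n x) = 0" for n
  proof -
    have "(LINT x|lborel. (indicator L x *\<^sub>R h x) * w n x) = (LINT x:U|lborel. h x * w n x)"
      unfolding set_lebesgue_integral_def
      by (rule Bochner_Integration.integral_cong) (use w0[of _ n] WL[of n] L(2) in \<open>auto simp: indicator_def\<close>)
    then show ?thesis using z[OF wU] by simp
  qed
  moreover have "(LINT x|lborel. (indicator L x *\<^sub>R h x) * indicator K x) = (LINT x:K|lborel. h x)"
    unfolding set_lebesgue_integral_def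
    by (rule Bochner_Integration.integral_cong) (use \<delta>(1) in \<open>auto simp: indicator_def L_def intro!: bexI\<close>)
  ultimately show ?thesis by (simp add: LIMSEQ_const_iff)
qed

text \<open>Since \<open>h\<close> is only locally integrable, it is first cut off to the members of
  a compact exhaustion; a closed set meets each of them in a compact set, where the preceding lemma
  applies.\<close>

lemma AE_zero_of_test_functions:
  fixes h :: "'g::euclidean_space \<Rightarrow> real"
  assumes "open U" and loc: "\<And>K. compact K \<Longrightarrow> K \<subseteq> U \<Longrightarrow> set_integrable lborel K h"
    and z: "\<And>w. w \<in> test_functions U \<Longrightarrow> (LINT x:U|lborel. h x * w x) = 0"
  shows "AE x in lborel. x \<in> U \<longrightarrow> h x = 0"
proof -
  obtain C :: "nat \<Rightarrow> 'g set" where C: "\<And>n. compact (C n)" "\<And>n. C n \<subseteq> U" "(\<Union>n. C n) = U"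
    using open_exhaustion[OF \<open>open U\<close>] by metis
  have "AE x in lborel. indicator (C n) x *\<^sub>R h x = 0" for n
  proof (rule AE_zero_of_closed_integrals)
    show "integrable lborel (\<lambda>x. indicator (C n) x *\<^sub>R h x)"
      using loc[OF C(1,2)] by (simp add: set_integrable_def)
    fix S :: "'g set" assume "closed S"
    have "(LINT x:S|lborel. indicator (C n) x *\<^sub>R h x) = (LINT x:C n \<inter> S|lborel. h x)"
      unfolding set_lebesgue_integral_def by (simp add: indicator_inter_arith mult_ac)
    also have "\<dots> = 0"
      using C(1,2)[of n] \<open>closed S\<close> by (intro closed_integrals_zero_of_test_functions[OF assms]) (auto intro: compact_Int_closed)
    finally show "(LINT x:S|lborel. indicator (C n) x *\<^sub>R h x) = 0" .
  qed
  then have "AE x in lborel. \<forall>n. indicator (C n) x *\<^sub>R h x = 0" unfolding AE_all_countable by blast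
  then show ?thesis
  proof eventually_elim
    case (elim x)
    show ?case
    proof
      assume "x \<in> U"
      then obtain n where "x \<in> C n" using C(3) by blast
      then show "h x = 0" using elim[rule_format, of n] by simp
    qed
  qed
qed

lemma lderiv_eq_fderiv:
  assumes "u differentiable (at x)"
  shows "lderiv br v u x = fderiv u x (lfield br v x)"
proof -
  have u: "(u has_derivative fderiv u x) (at (x + 0 *\<^sub>R lfield br v x))"
    using assms by (simp add: frechet_derivative_works)
  have "((\<lambda>t. x + t *\<^sub>R lfield br v x) has_derivative (\<lambda>t. t *\<^sub>R lfield br v x)) (at 0)"
    by (auto intro!: derivative_eq_intros)
  from has_derivative_compose[OF this u]
  have "((\<lambda>t. u (x + t *\<^sub>R lfield br v x)) has_derivative (\<lambda>t. t * fderiv u x (lfield br v x))) (at 0)"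
    using assms by (simp add: linear_cmul[OF linear_frechet_derivative])
  then show ?thesis
    unfolding lderiv_def by (intro DERIV_imp_deriv) (simp add: has_field_derivative_def mult_commute_abs)
qed

lemma C1_on_lderiv: "C1_on U u \<Longrightarrow> x \<in> U \<Longrightarrow> lderiv br v u x = fderiv u x (lfield br v x)"
  by (rule lderiv_eq_fderiv) (simp add: C1_on_def)

locale heisenberg_frame =
  fixes br :: "'g::euclidean_space \<Rightarrow> 'g \<Rightarrow> 'g" and H V E F :: "'g set"
  assumes heis: "heisenberg_type br H V" and E: "orthonormal_basis E H" and F: "orthonormal_basis F V"
begin

lemma bilinear_br: "bilinear br" and br_self [simp]: "br x x = 0"
  and subspace_H: "subspace H" and subspace_V: "subspace V"
  and H_V_orthogonal: "z \<in> H \<Longrightarrow> s \<in> V \<Longrightarrow> z \<bullet> s = 0"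
  and span_brackets: "span {br z z' |z z'. z \<in> H \<and> z' \<in> H} = V"
  using heis by (auto simp: heisenberg_type_def lie_bracket_def)

sublocale br: bounded_bilinear br
  using bilinear_br by (simp add: bilinear_conv_bounded_bilinear)

lemma E_subset: "e \<in> E \<Longrightarrow> e \<in> H" and F_subset: "e \<in> F \<Longrightarrow> e \<in> V"
  using E F span_base by (auto simp: orthonormal_basis_def)

lemma br_in_V: "br x y \<in> V"
  unfolding bracket_coordinates[OF heis E F, of x y]
  using subspace_V F_subset by (intro subspace_sum subspace_scale) auto

lemma br_V_right [simp]: "v \<in> V \<Longrightarrow> br x v = 0"
  using lfield_vertical[OF heis E F, of v x] by (simp add: lfield_def)

lemma br_skew: "br x y = - br y x"
proof -
  have "br (x + y) (x + y) = br x y + br y x" by (simp only: br.add_left br.add_right) simp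
  moreover have "br (x + y) (x + y) = 0" by (rule br_self)
  ultimately show ?thesis by (metis eq_neg_iff_add_eq_0)
qed

lemma br_V_left [simp]: "v \<in> V \<Longrightarrow> br v x = 0"
  by (subst br_skew) simp

lemma br_br [simp]: "br x (br y z) = 0" "br (br y z) x = 0"
  using br_in_V by auto

lemma finite_E: "finite E" and finite_F: "finite F"
proof -
  have "finite B" if "orthonormal_basis B S" for B S :: "'g set"
    using that pairwise_orthogonal_independent[of B] independent_imp_finite unfolding orthonormal_basis_def by force
  then show "finite E" "finite F" using E F by auto
qed

lemma E_F_disjoint: "E \<inter> F = {}"
proof -
  have "e \<bullet> e = 0" if "e \<in> E" "e \<in> F" for e using H_V_orthogonal E_subset F_subset that by blast
  then show ?thesis using E by (force simp: orthonormal_basis_def)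
qed

lemma frame_orthonormal: "a \<in> E \<union> F \<Longrightarrow> b \<in> E \<union> F \<Longrightarrow> a \<bullet> b = (if a = b then 1 else 0)"
proof -
  have *: "a \<bullet> b = (if a = b then 1 else 0)" if "orthonormal_basis B S" "a \<in> B" "b \<in> B" for B S :: "'g set" and a b
    using that by (auto simp: orthonormal_basis_def pairwise_def orthogonal_def norm_eq_1)
  have "a \<bullet> b = 0 \<and> b \<bullet> a = 0 \<and> a \<noteq> b" if "a \<in> E" "b \<in> F" for a b
    using that H_V_orthogonal[OF E_subset F_subset] E_F_disjoint by (auto simp: inner_commute)
  from this[of a b] this[of b a]
  show "a \<in> E \<union> F \<Longrightarrow> b \<in> E \<union> F \<Longrightarrow> a \<bullet> b = (if a = b then 1 else 0)"
    using *[OF E, of a b] *[OF F, of a b] by auto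
qed

lemma frame_expansion: "x = (\<Sum>b\<in>E \<union> F. (x \<bullet> b) *\<^sub>R b)"
  using point_coordinates[OF heis E F, of x] finite_E finite_F E_F_disjoint
  by (simp add: oproj_def sum.union_disjoint)

lemma norm_frame: "b \<in> E \<union> F \<Longrightarrow> norm b = 1"
  using frame_orthonormal[of b b] by (simp add: norm_eq_1)

lemma card_E: "card E = dim H" and card_F: "card F = dim V"
proof -
  have "card B = dim S" if "orthonormal_basis B S" for B S :: "'g set"
  proof -
    have "independent B" using that pairwise_orthogonal_independent[of B] by (force simp: orthonormal_basis_def)
    then have "dim (span B) = card B" by (rule dim_span_eq_card_independent)
    then show ?thesis using that unfolding orthonormal_basis_def by metis
  qed
  then show "card E = dim H" "card F = dim V" using E F by auto
qed

definition Q :: real where "Q = real (hom_dim H V)"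

lemma Q_eq: "Q = real (card E) + 2 * real (card F)"
  by (simp add: Q_def hom_dim_def card_E card_F)

lemma continuous_lfield: "continuous_on U (lfield br v)"
  unfolding lfield_def by (intro continuous_intros br.continuous_on)

lemma continuous_on_lderiv: "C1_on U u \<Longrightarrow> continuous_on U (lderiv br v u)"
  by (rule continuous_on_eq[OF C1_on_continuous_fderiv[OF _ continuous_lfield[of U v]]])
    (simp_all add: C1_on_lderiv)

lemma continuous_on_lgrad: "C1_on U u \<Longrightarrow> continuous_on U (lgrad br B u)"
  unfolding lgrad_def by (intro continuous_intros continuous_on_lderiv)

lemma lgrad_inner: "e \<in> E \<Longrightarrow> lgrad br E u x \<bullet> e = lderiv br e u x"
  unfolding lgrad_def inner_sum_left
  using finite_E frame_orthonormal by (subst sum.cong[OF refl, of E _ "\<lambda>d. if d = e then lderiv br e u x else 0"]) auto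

lemma lderiv_outside:
  assumes "\<And>y. y \<notin> K \<Longrightarrow> u y = 0" "compact K" "x \<notin> K"
  shows "lderiv br v u x = 0"
proof -
  have "(u has_derivative (\<lambda>_. 0)) (at x)" by (rule has_derivative_outside_support[OF assms(2,1,3)])
  then have "fderiv u x = (\<lambda>_. 0)" "u differentiable (at x)" by (auto simp: fderiv_eqI differentiable_def)
  then show ?thesis by (simp add: lderiv_eq_fderiv)
qed

text \<open>Left-invariant fields are divergence free: the coefficient of a vertical direction
  \<open>f\<close> in \<open>lfield br v\<close> depends on the base point only through its bracket
  with \<open>v\<close>, and that does not change along \<open>f\<close>. The coefficient can thus
  be moved under the derivative, which leaves derivatives in constant directions.\<close>

lemma integral_lderiv_eq_0:
  assumes u: "u \<in> C1c U"
  shows "(LINT x|lborel. lderiv br v u x) = 0"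
proof -
  have C1: "C1_on UNIV u" by (rule C1c_C1_on[OF u])
  let ?w = "\<lambda>b x. (br x v \<bullet> b) * u x"
  have a: "C1_on UNIV (\<lambda>x. br x v \<bullet> b)" "fderiv (\<lambda>x. br x v \<bullet> b) x c = br c v \<bullet> b" for b c x
  proof -
    have d: "((\<lambda>x. br x v \<bullet> b) has_derivative (\<lambda>c. br c v \<bullet> b)) (at x)" for x
      by (intro bounded_linear_imp_has_derivative bounded_linear_inner_left_comp br.bounded_linear_left)
    show "C1_on UNIV (\<lambda>x. br x v \<bullet> b)" by (rule C1_onI[OF d]) auto
    show "fderiv (\<lambda>x. br x v \<bullet> b) x c = br c v \<bullet> b" using fderiv_eqI[OF d] by metis
  qed
  have w: "?w b \<in> C1c UNIV" for b by (rule C1c_mult[OF a(1) open_UNIV C1c_mono[OF u]]) simp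
  \<comment> \<open>The term in which the derivative hits the coefficient is
    \<open>br f v \<bullet> f\<close>, and brackets with vertical vectors vanish.\<close>
  have fw: "fderiv (?w f) x f = (br x v \<bullet> f) * fderiv u x f" if "f \<in> F" for x f
    using that F_subset by (simp add: fderiv_mult[OF a(1) C1] a(2))
  have eq: "lderiv br v u x = fderiv u x v + (1/2) * (\<Sum>f\<in>F. fderiv (?w f) x f)" for x
  proof -
    interpret linear "fderiv u x" by (rule C1_on_linear[OF C1 UNIV_I])
    have "br x v = oproj F (br x v)" by (rule oproj_eq[OF F br_in_V, symmetric])
    then have "fderiv u x (br x v) = fderiv u x (\<Sum>f\<in>F. (br x v \<bullet> f) *\<^sub>R f)" by (simp add: oproj_def)
    then have "fderiv u x (br x v) = (\<Sum>f\<in>F. fderiv (?w f) x f)" by (simp add: sum scale fw)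
    then show ?thesis by (simp add: C1_on_lderiv[OF C1] lfield_def add scale)
  qed
  have i1: "integrable lborel (\<lambda>x. fderiv u x v)"
    using integrable_C1c_fderiv_mult[OF u, of "\<lambda>_. 1" "\<lambda>_. v"] by simp
  have i2: "integrable lborel (\<lambda>x. fderiv (?w f) x f)" for f
    using integrable_C1c_fderiv_mult[OF w, of "\<lambda>_. 1" "\<lambda>_. f"] by simp
  show ?thesis unfolding eq using i1 i2 integral_fderiv_eq_0[OF u] integral_fderiv_eq_0[OF w]
    by (simp add: Bochner_Integration.integral_sum)
qed

lemma lderiv_mult:
  assumes "C1_on U u" "C1_on U w" "x \<in> U"
  shows "lderiv br v (\<lambda>x. u x * w x) x = u x * lderiv br v w x + lderiv br v u x * w x"
  using assms C1_on_mult[OF assms(1,2)] by (simp add: C1_on_lderiv fderiv_mult)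

lemma lderiv_integration_by_parts:
  assumes "C1_on U u" "open U" and w: "w \<in> C1c U"
  shows "(LINT x|lborel. u x * lderiv br v w x) = - (LINT x|lborel. lderiv br v u x * w x)"
proof -
  obtain K where K: "C1_on UNIV w" "compact K" "K \<subseteq> U" "\<And>x. x \<notin> K \<Longrightarrow> w x = 0"
    using C1cE[OF w] by metis
  have uw: "(\<lambda>x. u x * w x) \<in> C1c U" by (rule C1c_mult[OF assms])
  have eq: "lderiv br v (\<lambda>x. u x * w x) x = u x * lderiv br v w x + lderiv br v u x * w x" for x
  proof (cases "x \<in> U")
    case True
    then show ?thesis by (rule lderiv_mult[OF assms(1) C1c_C1_on[OF w]])
  next
    case False
    then have "x \<notin> K" using K(3) by auto
    then show ?thesis
      using lderiv_outside[OF _ K(2), of w x v] lderiv_outside[OF _ K(2), of "\<lambda>x. u x * w x" x v] K(4) by simp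
  qed
  have i1: "integrable lborel (\<lambda>x. u x * lderiv br v w x)"
    using integrable_C1c_fderiv_mult[OF w C1_on_imp_continuous_on[OF assms(1)] continuous_lfield[of U v]]
    by (simp add: C1_on_lderiv[OF K(1)])
  have i2: "integrable lborel (\<lambda>x. lderiv br v u x * w x)"
    by (rule integrable_C1c_mult[OF w continuous_on_lderiv[OF assms(1)]])
  show ?thesis using integral_lderiv_eq_0[OF uw, of v] i1 i2 unfolding eq by simp
qed

section \<open>Weak versus classical horizontal gradients\<close>

lemma has_whgrad_classical:
  assumes "open U" "C1_on U u"
  shows "has_whgrad br E U u (lgrad br E u)"
  unfolding has_whgrad_def
proof (intro conjI allI impI ballI)
  fix K assume K: "compact K \<and> K \<subseteq> U"
  show "set_integrable lborel K u" unfolding set_integrable_def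
    by (rule borel_integrable_compact) (use K C1_on_imp_continuous_on[OF assms(2)] in \<open>auto intro: continuous_on_subset\<close>)
  show "set_integrable lborel K (lgrad br E u)" unfolding set_integrable_def
    by (rule borel_integrable_compact) (use K continuous_on_lgrad[OF assms(2), of E] in \<open>auto intro: continuous_on_subset\<close>)
next
  show "lgrad br E u x \<in> span E" for x unfolding lgrad_def by (intro span_sum span_scale span_base)
next
  fix w e assume w: "w \<in> test_functions U" and e: "e \<in> E"
  have w': "w \<in> C1c U" by (rule test_functions_C1c[OF w])
  obtain K where K: "C1_on UNIV w" "compact K" "K \<subseteq> U" "\<And>x. x \<notin> K \<Longrightarrow> w x = 0"
    using C1cE[OF w'] by metis
  have "(LINT x:U|lborel. u x * lderiv br e w x) = (LINT x|lborel. u x * lderiv br e w x)"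
    using lderiv_outside[of K w, OF K(4,2)] K(3) by (intro set_lebesgue_integral_support) auto
  moreover have "(LINT x:U|lborel. (lgrad br E u x \<bullet> e) * w x) = (LINT x|lborel. lderiv br e u x * w x)"
    using K(3,4) e by (subst set_lebesgue_integral_support) (auto simp: lgrad_inner)
  ultimately show "(LINT x:U|lborel. u x * lderiv br e w x) = - (LINT x:U|lborel. (lgrad br E u x \<bullet> e) * w x)"
    using lderiv_integration_by_parts[OF assms(2,1) w'] by simp
qed

text \<open>Testing determines each component along \<open>E\<close> almost everywhere. As both
  gradients take values in \<open>span E\<close>, a difference orthogonal to \<open>E\<close> is
  orthogonal to itself.\<close>

lemma has_whgrad_unique:
  assumes "open U" and g: "has_whgrad br E U u g" and g': "has_whgrad br E U u g'"
  shows "AE x in lborel. x \<in> U \<longrightarrow> g x = g' x"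
proof -
  \<comment> \<open>On the compact support of \<open>w\<close> the gradient is integrable and
    \<open>w\<close> is bounded; this is what permits splitting the integral of the
    difference.\<close>
  have int: "set_integrable lborel U (\<lambda>x. (g x \<bullet> e) * w x)" 
    if g: "has_whgrad br E U u g" and w: "w \<in> test_functions U" for g e w
  proof -
    obtain K where K: "C1_on UNIV w" "compact K" "K \<subseteq> U" "\<And>x. x \<notin> K \<Longrightarrow> w x = 0"
      using C1cE[OF test_functions_C1c[OF w]] by metis
    have cw: "continuous_on UNIV w" by (rule C1_on_imp_continuous_on[OF K(1)])
    have "bounded (w ` K)" using K cw by (intro compact_imp_bounded compact_continuous_image) (auto intro: continuous_on_subset)
    then obtain M where M: "\<And>x. x \<in> K \<Longrightarrow> \<bar>w x\<bar> \<le> M" by (auto simp: bounded_iff)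
    have gK: "integrable lborel (\<lambda>x. indicator K x *\<^sub>R g x)"
      using g K(2,3) by (simp add: has_whgrad_def set_integrable_def)
    have "integrable lborel (\<lambda>x. ((indicator K x *\<^sub>R g x) \<bullet> e) * w x)"
    proof (rule Bochner_Integration.integrable_bound)
      show "integrable lborel (\<lambda>x. M * norm ((indicator K x *\<^sub>R g x) \<bullet> e))"
        by (intro integrable_mult_right integrable_norm integrable_inner_left gK)
      show "(\<lambda>x. ((indicator K x *\<^sub>R g x) \<bullet> e) * w x) \<in> borel_measurable lborel"
        by (intro borel_measurable_times borel_measurable_inner borel_measurable_integrable[OF gK])
          (simp_all add: borel_measurable_continuous_onI[OF cw])
      show "AE x in lborel. norm (((indicator K x *\<^sub>R g x) \<bullet> e) * w x) \<le> norm (M * norm ((indicator K x *\<^sub>R g x) \<bullet> e))"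
      proof (rule AE_I2)
        fix x
        show "norm (((indicator K x *\<^sub>R g x) \<bullet> e) * w x) \<le> norm (M * norm ((indicator K x *\<^sub>R g x) \<bullet> e))"
        proof (cases "x \<in> K")
          case True
          have "\<bar>w x\<bar> \<le> \<bar>M\<bar>" using M[OF True] by linarith
          then have "\<bar>g x \<bullet> e\<bar> * \<bar>w x\<bar> \<le> \<bar>g x \<bullet> e\<bar> * \<bar>M\<bar>" by (rule mult_left_mono) simp
          then show ?thesis using True by (simp add: abs_mult mult.commute)
        qed simp
      qed
    qed
    moreover have "(\<lambda>x. ((indicator K x *\<^sub>R g x) \<bullet> e) * w x) = (\<lambda>x. indicator U x *\<^sub>R ((g x \<bullet> e) * w x))"
      using K(3,4) by (auto simp: indicator_def fun_eq_iff)
    ultimately show ?thesis by (simp add: set_integrable_def)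
  qed
  have "AE x in lborel. x \<in> U \<longrightarrow> (g x - g' x) \<bullet> e = 0" if e: "e \<in> E" for e
  proof (rule AE_zero_of_test_functions[OF \<open>open U\<close>])
    fix K assume K: "compact K" "K \<subseteq> U"
    have "integrable lborel (\<lambda>x. (indicator K x *\<^sub>R g x) \<bullet> e - (indicator K x *\<^sub>R g' x) \<bullet> e)"
      using g g' K by (intro Bochner_Integration.integrable_diff integrable_inner_left) (auto simp: has_whgrad_def set_integrable_def)
    then show "set_integrable lborel K (\<lambda>x. (g x - g' x) \<bullet> e)"
      by (simp add: set_integrable_def inner_diff_left right_diff_distrib)
  next
    fix w assume w: "w \<in> test_functions U"
    have "(LINT x:U|lborel. (g x \<bullet> e) * w x) = (LINT x:U|lborel. (g' x \<bullet> e) * w x)"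
      using g g' w e by (simp add: has_whgrad_def)
    then have "(LINT x:U|lborel. (g x \<bullet> e) * w x - (g' x \<bullet> e) * w x) = 0"
      using int[OF g w] int[OF g' w] by simp
    then show "(LINT x:U|lborel. ((g x - g' x) \<bullet> e) * w x) = 0" by (simp add: inner_diff_left left_diff_distrib)
  qed
  then have "AE x in lborel. \<forall>e\<in>E. x \<in> U \<longrightarrow> (g x - g' x) \<bullet> e = 0"
    by (intro AE_finite_allI[OF finite_E])
  then show ?thesis
  proof eventually_elim
    case (elim x)
    show ?case
    proof
      assume x: "x \<in> U"
      have "g x - g' x \<in> span E" using g g' x by (auto simp: has_whgrad_def intro: span_diff)
      moreover have "orthogonal (g x - g' x) y" if "y \<in> span E" for y
        by (rule orthogonal_to_span[OF that]) (use elim x in \<open>auto simp: orthogonal_def\<close>)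
      ultimately have "orthogonal (g x - g' x) (g x - g' x)" by blast
      then show "g x = g' x" by (simp add: orthogonal_def)
    qed
  qed
qed

text \<open>Local integrability yields measurability on compact subsets only; the limit along an
  exhaustion carries it to \<open>U\<close>.\<close>

lemma has_whgrad_measurable:
  assumes "open U" "has_whgrad br E U u g"
  shows "set_borel_measurable lborel U g"
proof -
  obtain C :: "nat \<Rightarrow> 'g set" where C: "\<And>n. compact (C n)" "\<And>n. C n \<subseteq> U" "\<And>n. C n \<subseteq> C (Suc n)" "(\<Union>n. C n) = U"
    using open_exhaustion[OF assms(1)] by blast
  show ?thesis unfolding set_borel_measurable_def
  proof (rule borel_measurable_LIMSEQ_metric)
    show "(\<lambda>x. indicator (C n) x *\<^sub>R g x) \<in> borel_measurable lborel" for n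
      using assms(2) C(1,2)[of n] by (auto simp: has_whgrad_def set_integrable_def)
    show "(\<lambda>n. indicator (C n) x *\<^sub>R g x) \<longlonglongrightarrow> indicator U x *\<^sub>R g x" for x
      by (intro tendsto_intros tendsto_indicator_exhaustion C)
  qed
qed

text \<open>\<open>whgrad\<close> is an arbitrary choice, accessible only through existence, here
  witnessed by \<open>lgrad\<close>, and uniqueness almost everywhere.\<close>

lemma whgrad_classical:
  assumes "open U" "C1_on U u"
  shows "has_whgrad br E U u (whgrad br E U u)"
    and "AE x in lborel. x \<in> U \<longrightarrow> whgrad br E U u x = lgrad br E u x"
proof -
  show "has_whgrad br E U u (whgrad br E U u)"
    unfolding whgrad_def by (rule someI[of "has_whgrad br E U u", OF has_whgrad_classical[OF assms]])
  then show "AE x in lborel. x \<in> U \<longrightarrow> whgrad br E U u x = lgrad br E u x"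
    using has_whgrad_unique[OF assms(1)] has_whgrad_classical[OF assms] by blast
qed

end

section \<open>Dilations and a local Pohozaev identity\<close>

text \<open>The supporting hyperplane of |.|^p at \<open>a\<close>, from Cauchy-Schwarz and Young's
  inequality with exponents p/(p-1) and p. For a = 0 the left side vanishes because of the inner
  product, also when p < 2.\<close>

lemma norm_powr_convex:
  fixes a b :: "'a::real_inner"
  assumes "p > 1"
  shows "p * (norm a powr (p - 2) * (a \<bullet> (b - a))) \<le> norm b powr p - norm a powr p"
proof (cases "a = 0")
  case False
  then have a: "norm a > 0" by simp
  have 1: "norm a powr (p - 2) * norm a = norm a powr (p - 1)"
    using powr_add[of "norm a" "p - 2" 1] a by simp
  have 2: "norm a powr (p - 2) * (norm a)\<^sup>2 = norm a powr p"
    using powr_add[of "norm a" "p - 2" 2] a by (simp add: powr_numeral)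
  have "norm a powr (p - 1) * norm b \<le> (norm a powr (p - 1)) powr (p / (p - 1)) / (p / (p - 1)) + norm b powr p / p"
    using assms by (intro Youngs_inequality) (auto simp: field_simps)
  also have "(norm a powr (p - 1)) powr (p / (p - 1)) = norm a powr p" using assms by (simp add: powr_powr)
  finally have 3: "p * (norm a powr (p - 1) * norm b) \<le> (p - 1) * norm a powr p + norm b powr p"
    using assms by (simp add: field_simps)
  have "norm a powr (p - 2) * (a \<bullet> b) \<le> norm a powr (p - 2) * (norm a * norm b)"
    by (intro mult_left_mono norm_cauchy_schwarz) simp
  also have "\<dots> = norm a powr (p - 1) * norm b" by (simp add: 1 flip: mult.assoc)
  finally have "p * (norm a powr (p - 2) * (a \<bullet> b)) \<le> p * (norm a powr (p - 1) * norm b)"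
    using assms by (intro mult_left_mono) auto
  moreover have "norm a powr (p - 2) * (a \<bullet> (b - a)) = norm a powr (p - 2) * (a \<bullet> b) - norm a powr p"
    using 2 by (simp add: inner_diff_right right_diff_distrib dot_square_norm)
  ultimately show ?thesis using 3 by (simp add: algebra_simps)
qed simp

lemma norm_powr_inner_self: "norm v powr (p - 2) * (v \<bullet> v) = norm v powr p" for v :: "'a::real_inner"
proof (cases "v = 0")
  case False
  then show ?thesis using powr_add[of "norm v" "p - 2" 2] by (simp add: powr_numeral dot_square_norm)
qed simp

text \<open>For p < 2 the scalar factor is unbounded near zeros of \<open>a\<close>, but the product
  has norm |a|^(p-1), which tends to 0 there.\<close>

lemma continuous_norm_powr_scaleR:
  fixes a :: "'b::topological_space \<Rightarrow> 'a::real_normed_vector"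
  assumes p: "p > 1" and a: "continuous_on U a"
  shows "continuous_on U (\<lambda>x. norm (a x) powr (p - 2) *\<^sub>R a x)"
proof -
  have "isCont (\<lambda>v::'a. norm v powr (p - 2) *\<^sub>R v) v" for v
  proof (cases "v = 0")
    case False
    then show ?thesis by (intro continuous_intros) auto
  next
    case True
    have "((\<lambda>v::'a. norm v powr (p - 1)) \<longlongrightarrow> norm (0::'a) powr (p - 1)) (at 0)"
      by (rule tendsto_powr2[OF tendsto_norm[OF tendsto_ident_at] tendsto_const]) (use p in auto)
    moreover have "norm (norm v powr (p - 2) *\<^sub>R v) = norm v powr (p - 1)" if "v \<noteq> 0" for v :: 'a
      using powr_add[of "norm v" "p - 2" 1] that by simp
    ultimately have "((\<lambda>v::'a. norm (norm v powr (p - 2) *\<^sub>R v)) \<longlongrightarrow> 0) (at 0)"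
      by (subst tendsto_cong[where g="\<lambda>v. norm v powr (p - 1)"]) (auto simp: eventually_at_filter)
    then have "((\<lambda>v::'a. norm v powr (p - 2) *\<^sub>R v) \<longlongrightarrow> 0) (at 0)" by (rule tendsto_norm_zero_cancel)
    then show ?thesis using True by (simp add: isCont_def)
  qed
  then have "continuous_on UNIV (\<lambda>v::'a. norm v powr (p - 2) *\<^sub>R v)"
    by (simp add: continuous_at_imp_continuous_on)
  then show ?thesis by (rule continuous_on_compose2[OF _ a]) auto
qed

lemma continuous_on_norm_powr:
  assumes "p > 0" "continuous_on U a"
  shows "continuous_on U (\<lambda>x. norm (a x) powr p)"
  using assms by (intro continuous_on_powr' continuous_intros) auto

lemma abs_exp_minus_1_le: "\<bar>exp (k * s) - 1\<bar> \<le> k * exp k * \<bar>s\<bar>" if "\<bar>s\<bar> \<le> 1" "k \<ge> 0" for s k :: real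
proof -
  have "norm (exp (k * s) - exp (k * 0)) \<le> k * exp k * norm (s - 0)"
  proof (rule field_differentiable_bound[of "{-1..1}"])
    show "((\<lambda>s. exp (k * s)) has_field_derivative k * exp (k * x)) (at x within {-1..1})" for x
      by (auto intro!: derivative_eq_intros)
    show "norm (k * exp (k * x)) \<le> k * exp k" if "x \<in> {-1..1}" for x
    proof -
      have "k * x \<le> k" using that \<open>k \<ge> 0\<close> by (simp add: mult_left_le)
      then show ?thesis using \<open>k \<ge> 0\<close> by (simp add: abs_mult mult_left_mono)
    qed
  qed (use that in auto)
  then show ?thesis by simp
qed

lemma linear_oproj: "linear (oproj B)"
  by (rule linearI) (simp_all add: oproj_def inner_add_left scaleR_add_left sum.distrib scaleR_sum_right)

lemma bounded_linear_oproj: "bounded_linear (oproj B)"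
  using linear_oproj linear_conv_bounded_linear by blast

lemmas oproj_add = linear_add[OF linear_oproj] and oproj_scaleR = linear_cmul[OF linear_oproj]

lemma continuous_oproj [continuous_intros]: "continuous_on U u \<Longrightarrow> continuous_on U (\<lambda>x. oproj B (u x))"
  by (rule bounded_linear.continuous_on[OF bounded_linear_oproj])

section \<open>Dilations and their Jacobian\<close>

context heisenberg_frame
begin

lemma oproj_E_in: "oproj E x \<in> H" and oproj_F_in: "oproj F x \<in> V"
  unfolding oproj_def
  using subspace_H subspace_V E_subset F_subset by (auto intro!: subspace_sum subspace_scale)

lemma oproj_E_H [simp]: "z \<in> H \<Longrightarrow> oproj E z = z" and oproj_F_V [simp]: "s \<in> V \<Longrightarrow> oproj F s = s"
  using oproj_eq[OF E] oproj_eq[OF F] by auto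

lemma oproj_E_V [simp]: "s \<in> V \<Longrightarrow> oproj E s = 0" and oproj_F_H [simp]: "z \<in> H \<Longrightarrow> oproj F z = 0"
proof -
  show "oproj E s = 0" if "s \<in> V"
    unfolding oproj_def
    by (rule sum.neutral) (use H_V_orthogonal[OF E_subset that] in \<open>simp add: inner_commute\<close>)
  show "oproj F z = 0" if "z \<in> H"
    unfolding oproj_def by (rule sum.neutral) (use H_V_orthogonal[OF that F_subset] in simp)
qed

lemma oproj_split: "oproj E x + oproj F x = x"
  using point_coordinates[OF heis E F, of x] by simp

lemma norm_oproj_le: "norm (oproj E x) \<le> norm x" "norm (oproj F x) \<le> norm x"
proof -
  have "oproj E x \<bullet> oproj F x = 0" by (rule H_V_orthogonal[OF oproj_E_in oproj_F_in])
  then have "(norm (oproj E x + oproj F x))\<^sup>2 = (norm (oproj E x))\<^sup>2 + (norm (oproj F x))\<^sup>2"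
    by (intro norm_add_Pythagorean) (simp add: orthogonal_def)
  then have *: "(norm x)\<^sup>2 = (norm (oproj E x))\<^sup>2 + (norm (oproj F x))\<^sup>2" by (simp only: oproj_split)
  show "norm (oproj E x) \<le> norm x" "norm (oproj F x) \<le> norm x"
    by (rule power2_le_imp_le; use * in simp)+
qed

lemma br_oproj: "br x y = br (oproj E x) y"
proof -
  have "br x y = br (oproj E x + oproj F x) y" by (simp only: oproj_split)
  then show ?thesis using oproj_F_in by (simp add: br.add_left)
qed

text \<open>The group dilation with factor exp s. The logarithmic parameter makes the dilations a
  one-parameter group with the identity at s = 0.\<close>

definition dil :: "real \<Rightarrow> 'g \<Rightarrow> 'g" where
  "dil s x = exp s *\<^sub>R oproj E x + exp (2 * s) *\<^sub>R oproj F x"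

definition dil_gen :: "'g \<Rightarrow> 'g" where
  "dil_gen x = oproj E x + 2 *\<^sub>R oproj F x"

lemma oproj_dil: "oproj E (dil s x) = exp s *\<^sub>R oproj E x" "oproj F (dil s x) = exp (2 * s) *\<^sub>R oproj F x"
  using oproj_E_in oproj_F_in by (simp_all add: dil_def oproj_add oproj_scaleR)

lemma dil_0 [simp]: "dil 0 x = x"
  by (simp add: dil_def oproj_split)

lemma dil_dil: "dil s (dil t x) = dil (s + t) x"
  unfolding dil_def[of s] dil_def[of "s + t"] oproj_dil by (simp add: exp_add distrib_left)

lemma dil_inverse [simp]: "dil (- s) (dil s x) = x" "dil s (dil (- s) x) = x"
  by (simp_all add: dil_dil)

lemma bounded_linear_dil: "bounded_linear (dil s)"
  unfolding dil_def
  by (intro bounded_linear_add bounded_linear_compose[OF bounded_linear_scaleR_right bounded_linear_oproj])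

lemma dil_has_derivative: "(dil s has_derivative dil s) (at x)"
  by (rule bounded_linear_imp_has_derivative[OF bounded_linear_dil])

lemma continuous_dil: "continuous_on U (dil s)"
  by (rule bounded_linear.continuous_on[OF bounded_linear_dil continuous_on_id])

lemma continuous_dil_gen: "continuous_on U dil_gen"
  unfolding dil_gen_def by (intro continuous_intros)

lemma norm_dil_le: "norm (dil s x) \<le> (exp s + exp (2 * s)) * norm x"
proof -
  have "norm (dil s x) \<le> exp s * norm (oproj E x) + exp (2 * s) * norm (oproj F x)"
    unfolding dil_def by (rule norm_triangle_le) simp
  also have "\<dots> \<le> exp s * norm x + exp (2 * s) * norm x"
    by (intro add_mono mult_left_mono norm_oproj_le) auto
  finally show ?thesis by (simp add: algebra_simps)
qed

text \<open>Horizontal fields are homogeneous of degree one: the bracket with \<open>e\<close> sees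
  only the horizontal part of \<open>x\<close>, which scales by exp s, while its value is vertical
  and is itself scaled by exp (2s).\<close>

lemma dil_lfield: "e \<in> H \<Longrightarrow> dil s (lfield br e x) = exp s *\<^sub>R lfield br e (dil s x)"
proof -
  assume e: "e \<in> H"
  have "br (dil s x) e = exp s *\<^sub>R br x e"
    by (subst (1 2) br_oproj) (simp add: oproj_dil br.scaleR_left)
  moreover have "dil s (lfield br e x) = exp s *\<^sub>R e + exp (2 * s) *\<^sub>R (1/2) *\<^sub>R br x e"
    using e br_in_V by (simp add: dil_def lfield_def oproj_add oproj_scaleR)
  moreover have "exp (2 * s) = exp s * exp s" using exp_add[of s s] by simp
  ultimately show ?thesis by (simp add: lfield_def algebra_simps)
qed

lemma has_real_derivative_integral_dil:
  assumes u: "u \<in> C1c U" and m: "continuous_on UNIV m"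
  shows "((\<lambda>s. LINT x|lborel. m x * u (dil s x)) has_real_derivative (LINT x|lborel. m x * fderiv u x (dil_gen x))) (at 0)"
proof (rule has_real_derivative_integral_flow[OF u m])
  show "((\<lambda>s. dil s x) has_vector_derivative dil_gen x) (at 0)" for x
    unfolding dil_def dil_gen_def by (auto intro!: derivative_eq_intros)
  show "continuous_on UNIV (dil s)" for s by (rule continuous_dil)
  show "\<exists>C. \<forall>x s. norm x \<le> R \<longrightarrow> \<bar>s\<bar> \<le> 1 \<longrightarrow> norm (dil s x - x) \<le> C * \<bar>s\<bar>" for R
  proof (intro exI allI impI)
    fix x :: 'g and s :: real assume *: "norm x \<le> R" "\<bar>s\<bar> \<le> 1"
    have "dil s x - x = (exp (1 * s) - 1) *\<^sub>R oproj E x + (exp (2 * s) - 1) *\<^sub>R oproj F x"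
      by (subst (2) oproj_split[symmetric]) (simp add: dil_def algebra_simps)
    then have "norm (dil s x - x) \<le> \<bar>exp (1 * s) - 1\<bar> * norm (oproj E x) + \<bar>exp (2 * s) - 1\<bar> * norm (oproj F x)"
      using norm_triangle_ineq[of "(exp (1 * s) - 1) *\<^sub>R oproj E x" "(exp (2 * s) - 1) *\<^sub>R oproj F x"]
      unfolding norm_scaleR by metis
    also have "\<dots> \<le> (1 * exp 1 * \<bar>s\<bar>) * R + (2 * exp 2 * \<bar>s\<bar>) * R"
      by (intro add_mono mult_mono abs_exp_minus_1_le order_trans[OF norm_oproj_le(1) *(1)]
          order_trans[OF norm_oproj_le(2) *(1)]) (use * in auto)
    finally show "norm (dil s x - x) \<le> ((exp 1 + 2 * exp 2) * R) * \<bar>s\<bar>" by (simp add: algebra_simps)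
  qed
  show "\<exists>R'. \<forall>x s. \<bar>s\<bar> \<le> 1 \<longrightarrow> norm (dil s x) \<le> R \<longrightarrow> norm x \<le> R'" for R
  proof (intro exI allI impI)
    fix x :: 'g and s :: real assume *: "\<bar>s\<bar> \<le> 1" "norm (dil s x) \<le> R"
    have "norm x = norm (dil (- s) (dil s x))" by simp
    also have "\<dots> \<le> (exp (- s) + exp (2 * - s)) * norm (dil s x)" by (rule norm_dil_le)
    also have "\<dots> \<le> (exp 1 + exp 2) * R" using * by (intro mult_mono add_mono) auto
    finally show "norm x \<le> (exp 1 + exp 2) * R" .
  qed
qed simp

lemma C1c_dil: "u \<in> C1c UNIV \<Longrightarrow> (\<lambda>x. u (dil s x)) \<in> C1c UNIV"
proof -
  assume u: "u \<in> C1c UNIV"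
  obtain K where K: "C1_on UNIV u" "compact K" "\<And>x. x \<notin> K \<Longrightarrow> u x = 0" using C1cE[OF u] by metis
  show ?thesis
  proof (rule C1cI)
    show "C1_on UNIV (\<lambda>x. u (dil s x))"
      by (rule C1_on_compose[OF K(1) dil_has_derivative]) simp
    show "compact (dil (- s) ` K)" by (rule compact_continuous_image[OF continuous_dil K(2)])
    show "u (dil s x) = 0" if "x \<notin> dil (- s) ` K" for x
      using that K(3)[of "dil s x"] by (metis dil_inverse(1) imageI)
  qed simp
qed

text \<open>The divergence of the generator is Q: each horizontal coordinate contributes 1 and each
  vertical coordinate contributes its weight 2.\<close>

lemma integral_dil_gen:
  assumes u: "u \<in> C1c U"
  shows "(LINT x|lborel. fderiv u x (dil_gen x)) = - Q * (LINT x|lborel. u x)"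
proof -
  have C1: "C1_on UNIV u" by (rule C1c_C1_on[OF u])
  have w: "(\<lambda>x. (x \<bullet> b) * u x) \<in> C1c UNIV" for b
    by (rule C1c_mult[OF C1_on_inner open_UNIV C1c_mono[OF u]]) simp
  have fb: "fderiv (\<lambda>x. x \<bullet> b) x c = c \<bullet> b" for x b c :: 'g
    using fderiv_eqI[OF bounded_linear_imp_has_derivative[OF bounded_linear_inner_left]] by metis
  have eq: "(x \<bullet> b) * fderiv u x b = fderiv (\<lambda>x. (x \<bullet> b) * u x) x b - u x" if "b \<in> E \<union> F" for x b
    using frame_orthonormal[OF that that] by (simp add: fderiv_mult[OF C1_on_inner C1] fb)
  have i1: "integrable lborel (\<lambda>x. fderiv (\<lambda>x. (x \<bullet> b) * u x) x b)" for b
    using integrable_C1c_fderiv_mult[OF w, of "\<lambda>_. 1" "\<lambda>_. b"] by simp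
  have i2: "integrable lborel u" by (rule C1c_integrable[OF u])
  have int: "(LINT x|lborel. (x \<bullet> b) * fderiv u x b) = - (LINT x|lborel. u x)"
    "integrable lborel (\<lambda>x. (x \<bullet> b) * fderiv u x b)" if "b \<in> E \<union> F" for b
    using i1 i2 integral_fderiv_eq_0[OF w] by (simp_all add: eq[OF that])
  have "fderiv u x (dil_gen x) = (\<Sum>b\<in>E. (x \<bullet> b) * fderiv u x b) + 2 * (\<Sum>b\<in>F. (x \<bullet> b) * fderiv u x b)" for x
  proof -
    interpret linear "fderiv u x" by (rule C1_on_linear[OF C1 UNIV_I])
    show ?thesis by (simp add: dil_gen_def add scale sum oproj_def)
  qed
  then have "(LINT x|lborel. fderiv u x (dil_gen x)) =
      (\<Sum>b\<in>E. LINT x|lborel. (x \<bullet> b) * fderiv u x b) + 2 * (\<Sum>b\<in>F. LINT x|lborel. (x \<bullet> b) * fderiv u x b)"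
    using int(2) by (simp add: Bochner_Integration.integral_sum)
  also have "\<dots> = - Q * (LINT x|lborel. u x)" using int(1) by (simp add: Q_eq algebra_simps)
  finally show ?thesis .
qed

text \<open>The Jacobian is obtained from a differential equation instead of a determinant: by the
  group property and \<open>integral_dil_gen\<close> the integral J satisfies J' = -Q J.\<close>

lemma integral_C1c_dil:
  assumes u: "u \<in> C1c UNIV"
  shows "(LINT x|lborel. u (dil s x)) = exp (- Q * s) * (LINT x|lborel. u x)"
proof -
  define J where "J s = (LINT x|lborel. u (dil s x))" for s
  have J: "(J has_real_derivative - Q * J t) (at t)" for t
  proof -
    have "((\<lambda>h. LINT x|lborel. 1 * u (dil t (dil h x))) has_real_derivative
        (LINT x|lborel. 1 * fderiv (\<lambda>x. u (dil t x)) x (dil_gen x))) (at 0)"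
      by (rule has_real_derivative_integral_dil[OF C1c_dil[OF u]]) simp
    then have "((\<lambda>h. J (t + h)) has_real_derivative - Q * J t) (at 0)"
      by (simp add: dil_dil J_def integral_dil_gen[OF C1c_dil[OF u]])
    then show ?thesis using DERIV_at_within_shift[of J "- Q * J t" t 0 UNIV] by (simp add: o_def)
  qed
  have "((\<lambda>t. exp (Q * t) * J t) has_real_derivative 0) (at t)" for t
    by (auto intro!: derivative_eq_intros J)
  then have "exp (Q * s) * J s = exp (Q * 0) * J 0" by (intro DERIV_isconst_all) blast
  then have "J s = exp (- Q * s) * J 0"
    by (simp add: exp_minus field_simps)
  then show ?thesis by (simp add: J_def)
qed

text \<open>Later integrands such as |grad f|^p w are only continuous. They are approximated
  uniformly by smooth functions supported in one compact \<open>L\<close>, and both sides are stable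
  under this approximation.\<close>

lemma integral_dil:
  fixes u :: "'g \<Rightarrow> real"
  assumes u: "continuous_on UNIV u" "compact K" "\<And>x. x \<notin> K \<Longrightarrow> u x = 0"
  shows "(LINT x|lborel. u (dil s x)) = exp (- Q * s) * (LINT x|lborel. u x)"
proof -
  define L where "L = {x. \<exists>y\<in>K. dist y x \<le> (1::real)}"
  have "compact L" unfolding L_def by (rule compact_thickening[OF u(2)])
  have KL: "K \<subseteq> L" by (auto simp: L_def intro!: bexI)
  let ?L = "dil (- s) ` L"
  have cL: "compact ?L" by (rule compact_continuous_image[OF continuous_dil \<open>compact L\<close>])
  have vanish: "v (dil s x) = 0" if "x \<notin> ?L" "\<And>x. x \<notin> L \<Longrightarrow> v x = 0" for v :: "'g \<Rightarrow> real" and x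
    using that by (metis dil_inverse(1) imageI)
  have u0: "u x = 0" if "x \<notin> L" for x using u(3) KL that by blast
  have cu: "continuous_on UNIV (\<lambda>x. u (dil s x))" by (rule continuous_on_compose2[OF u(1) continuous_dil]) auto
  have iu: "integrable lborel u"
    by (rule integrable_compact_support[OF u(2)]) (use u in \<open>auto intro: continuous_on_subset\<close>)
  have ius: "integrable lborel (\<lambda>x. u (dil s x))"
    by (rule integrable_compact_support[OF cL]) (use cu vanish u0 in \<open>auto intro: continuous_on_subset\<close>)
  define C where "C = measure lborel ?L + exp (- Q * s) * measure lborel L"
  have bound: "\<bar>(LINT x|lborel. u (dil s x)) - exp (- Q * s) * (LINT x|lborel. u x)\<bar> \<le> e * C" if "e > 0" for e
  proof -
    obtain w where w: "smooth_on UNIV w" "\<And>x. \<bar>w x - u x\<bar> \<le> e" "\<And>x. (\<And>y. y \<in> K \<Longrightarrow> dist y x > 1) \<Longrightarrow> w x = 0"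
      using smooth_approx[OF u \<open>e > 0\<close> zero_less_one] by metis
    have w0: "w x = 0" if "x \<notin> L" for x using w(3)[of x] that by (force simp: L_def)
    have "w \<in> C1c UNIV" by (rule C1cI[OF smooth_on_imp_C1_on[OF w(1)] \<open>compact L\<close>]) (use w0 in auto)
    note wC = this C1c_dil[OF this, of s]
    note iw = C1c_integrable[OF wC(1)] C1c_integrable[OF wC(2)]
    have est: "\<bar>LINT x|lborel. v x\<bar> \<le> e * measure lborel S"
      if "compact S" "\<And>x. x \<notin> S \<Longrightarrow> v x = 0" "\<And>x. \<bar>v x\<bar> \<le> e" "integrable lborel v" for S and v :: "'g \<Rightarrow> real"
    proof -
      have "\<bar>LINT x|lborel. v x\<bar> \<le> (LINT x|lborel. \<bar>v x\<bar>)" by (rule integral_abs_bound)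
      also have "\<dots> \<le> (LINT x|lborel. e * indicator S x)"
      proof (rule integral_mono)
        show "integrable lborel (\<lambda>x. e * indicator S x)"
          using emeasure_compact_finite[OF \<open>compact S\<close>] borel_compact[OF \<open>compact S\<close>]
          by (intro integrable_mult_right integrable_real_indicator) auto
        show "\<bar>v x\<bar> \<le> e * indicator S x" for x using that by (cases "x \<in> S") auto
      qed (use that in auto)
      finally show ?thesis by simp
    qed
    have "\<bar>LINT x|lborel. w x - u x\<bar> \<le> e * measure lborel L"
      by (rule est[OF \<open>compact L\<close>]) (use w0 u0 w(2) iw iu in auto)
    then have A: "\<bar>(LINT x|lborel. w x) - (LINT x|lborel. u x)\<bar> \<le> e * measure lborel L" using iw iu by simp
    have "\<bar>LINT x|lborel. w (dil s x) - u (dil s x)\<bar> \<le> e * measure lborel ?L"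
      by (rule est[OF cL]) (use vanish[of _ w] vanish[of _ u] w0 u0 w(2) iw ius in auto)
    then have B: "\<bar>(LINT x|lborel. w (dil s x)) - (LINT x|lborel. u (dil s x))\<bar> \<le> e * measure lborel ?L"
      using iw ius by simp
    have "exp (- Q * s) * \<bar>(LINT x|lborel. w x) - (LINT x|lborel. u x)\<bar> \<le> exp (- Q * s) * (e * measure lborel L)"
      by (rule mult_left_mono[OF A]) simp
    then have "\<bar>exp (- Q * s) * (LINT x|lborel. w x) - exp (- Q * s) * (LINT x|lborel. u x)\<bar> \<le> exp (- Q * s) * (e * measure lborel L)"
      by (simp add: abs_mult flip: right_diff_distrib)
    then show ?thesis using B integral_C1c_dil[OF wC(1), of s] by (simp add: C_def algebra_simps)
  qed
  have "C \<ge> 0" by (simp add: C_def)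
  have "\<bar>(LINT x|lborel. u (dil s x)) - exp (- Q * s) * (LINT x|lborel. u x)\<bar> \<le> 0 + e" if "e > 0" for e
  proof -
    \<comment> \<open>C + 1 replaces C because both supports may be null.\<close>
    have "e / (C + 1) * C \<le> e" using that \<open>C \<ge> 0\<close> by (simp add: field_simps)
    then show ?thesis using bound[of "e / (C + 1)"] that \<open>C \<ge> 0\<close> by force
  qed
  then have "\<bar>(LINT x|lborel. u (dil s x)) - exp (- Q * s) * (LINT x|lborel. u x)\<bar> \<le> 0"
    by (rule field_le_epsilon)
  then show ?thesis by simp
qed

lemma lgrad_dil:
  assumes "C1_on UNIV u"
  shows "lgrad br E (\<lambda>x. u (dil s x)) x = exp s *\<^sub>R lgrad br E u (dil s x)"
proof -
  have C1: "C1_on UNIV (\<lambda>x. u (dil s x))"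
    by (rule C1_on_compose[OF assms dil_has_derivative]) simp
  have "lderiv br e (\<lambda>x. u (dil s x)) x = exp s * lderiv br e u (dil s x)" if "e \<in> E" for e
  proof -
    have "lderiv br e (\<lambda>x. u (dil s x)) x = fderiv u (dil s x) (dil s (lfield br e x))"
      using C1_on_lderiv[OF C1] fderiv_compose[OF assms dil_has_derivative] by simp
    then show ?thesis
      by (simp add: dil_lfield E_subset[OF that] linear_cmul[OF C1_on_linear[OF assms]] C1_on_lderiv[OF assms])
  qed
  then show ?thesis unfolding lgrad_def by (simp add: scaleR_sum_right)
qed

text \<open>Testing the equation with
  \<open>\<psi> (f \<circ> \<delta>\<^sub>s - f)\<close> and using convexity of \<open>|\<cdot>|\<^sup>p\<close> shows that a certain function of \<open>s\<close> has a minimum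
  at \<open>0\<close>; the change of variables \<open>\<delta>\<^sub>s\<close> moves its \<open>s\<close>-dependence off the gradient of \<open>f\<close>, so
  no second derivatives are needed.\<close>

lemma local_pohozaev:
  assumes p: "p > 1" and f: "f \<in> C1c UNIV" and U: "open U" and k: "continuous_on UNIV k"
    and weak: "\<And>w. w \<in> C1c U \<Longrightarrow>
      (LINT x|lborel. norm (lgrad br E f x) powr (p - 2) * (lgrad br E f x \<bullet> lgrad br E w x)) = (LINT x|lborel. k x * w x)"
    and w: "w \<in> C1c U" and w_nonneg: "\<And>x. 0 \<le> w x"
  shows "p * (LINT x|lborel. (norm (lgrad br E f x) powr (p - 2) * (lgrad br E f x \<bullet> lgrad br E w x)) * fderiv f x (dil_gen x))
      + (p - Q) * (LINT x|lborel. norm (lgrad br E f x) powr p * w x)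
      - (LINT x|lborel. norm (lgrad br E f x) powr p * fderiv w x (dil_gen x))
    = p * (LINT x|lborel. (k x * w x) * fderiv f x (dil_gen x))"
proof -
  define a where "a = lgrad br E f"
  define m where "m x = norm (a x) powr (p - 2) * (a x \<bullet> lgrad br E w x)" for x
  have C1f: "C1_on UNIV f" by (rule C1c_C1_on[OF f])
  have C1w: "C1_on UNIV w" by (rule C1c_C1_on[OF w])
  have wU: "w \<in> C1c UNIV" by (rule C1c_mono[OF w]) simp
  have ca: "continuous_on UNIV a" unfolding a_def by (rule continuous_on_lgrad[OF C1f])
  have cw: "continuous_on UNIV w" by (rule C1_on_imp_continuous_on[OF C1w])
  have cm: "continuous_on UNIV m"
  proof -
    have "continuous_on UNIV (\<lambda>x. (norm (a x) powr (p - 2) *\<^sub>R a x) \<bullet> lgrad br E w x)"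
      by (intro continuous_intros continuous_norm_powr_scaleR[OF p] continuous_on_lgrad[OF C1w] ca)
    then show ?thesis by (simp add: m_def)
  qed
  have cap: "continuous_on UNIV (\<lambda>x. norm (a x) powr p)"
    by (rule continuous_on_norm_powr[OF _ ca]) (use p in simp)
  obtain K where K: "compact K" "K \<subseteq> U" "\<And>x. x \<notin> K \<Longrightarrow> w x = 0" "\<And>x v. x \<notin> K \<Longrightarrow> fderiv w x v = 0"
    using C1cE[OF w] by metis
  have m0: "m x = 0" if "x \<notin> K" for x
    using K(4)[OF that] by (simp add: m_def lgrad_def C1_on_lderiv[OF C1w])
  define fs where "fs s x = f (dil s x) - f x" for s x
  have C1fs: "C1_on UNIV (fs s)" for s
    unfolding fs_def by (intro C1_on_diff C1f C1c_C1_on[OF C1c_dil[OF f]])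
  have cfs: "continuous_on UNIV (fs s)" for s by (rule C1_on_imp_continuous_on[OF C1fs])
  define b where "b s x = exp s *\<^sub>R a (dil s x)" for s x
  have cb: "continuous_on UNIV (b s)" for s
    unfolding b_def by (intro continuous_intros continuous_on_compose2[OF ca continuous_dil]) auto
  have cbp: "continuous_on UNIV (\<lambda>x. norm (b s x) powr p)" for s
    by (rule continuous_on_norm_powr[OF _ cb]) (use p in simp)
  have grad: "lgrad br E (\<lambda>x. fs s x * w x) x = fs s x *\<^sub>R lgrad br E w x + w x *\<^sub>R (b s x - a x)" for s x
  proof -
    have "lgrad br E (fs s) x = b s x - a x"
    proof -
      have C1s: "C1_on UNIV (\<lambda>x. f (dil s x))" by (rule C1c_C1_on[OF C1c_dil[OF f]])
      have "lderiv br e (fs s) x = lderiv br e (\<lambda>x. f (dil s x)) x - lderiv br e f x" for e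
        using C1_on_lderiv[OF C1fs[of s], of x br e] unfolding fs_def
        by (simp add: C1_on_lderiv[OF C1f] C1_on_lderiv[OF C1s] fderiv_diff[OF C1s C1f])
      then have "lgrad br E (fs s) x = lgrad br E (\<lambda>x. f (dil s x)) x - lgrad br E f x"
        by (simp add: lgrad_def scaleR_diff_left sum_subtractf)
      then show ?thesis by (simp add: lgrad_dil[OF C1f] a_def b_def)
    qed
    moreover have "lgrad br E (\<lambda>x. fs s x * w x) x = fs s x *\<^sub>R lgrad br E w x + w x *\<^sub>R lgrad br E (fs s) x"
    proof -
      have "lderiv br e (\<lambda>x. fs s x * w x) x = fs s x * lderiv br e w x + w x * lderiv br e (fs s) x" for e
        using lderiv_mult[OF C1fs[of s] C1w, of x e] by simp
      then show ?thesis unfolding lgrad_def by (simp add: scaleR_add_left sum.distrib scaleR_sum_right)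
    qed
    ultimately show ?thesis by simp
  qed
  define A where "A s = (LINT x|lborel. (k x * w x) * f (dil s x))" for s
  define M where "M s = (LINT x|lborel. m x * f (dil s x))" for s
  define N where "N s = (LINT x|lborel. norm (a x) powr p * w (dil s x))" for s
  have ints: "integrable lborel (\<lambda>x. v x * w x)" if "continuous_on UNIV v" for v
    using integrable_C1c_mult[OF wU that] .
  have intm: "integrable lborel (\<lambda>x. m x * v x)" if "continuous_on UNIV v" for v
    by (rule integrable_compact_support[OF K(1)])
      (use m0 cm that in \<open>auto intro!: continuous_intros intro: continuous_on_subset\<close>)
  have cfd: "continuous_on UNIV (\<lambda>x. f (dil s x))" for s
    by (rule C1_on_imp_continuous_on[OF C1c_C1_on[OF C1c_dil[OF f]]])
  \<comment> \<open>The gradient of the test function has two parts. Where it falls on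
    \<open>w\<close> it produces \<open>M\<close>; the remaining part, \<open>w\<close> times the
    difference b - a of the gradients, is bounded by a difference of p-energies through convexity at
    \<open>a\<close>. The sign of \<open>w\<close> enters here.\<close>
  have key: "p * (A s - A 0) - p * (M s - M 0) \<le> exp ((p - Q) * s) * N (- s) - N 0" for s
  proof -
    have ws: "(\<lambda>x. fs s x * w x) \<in> C1c U" by (rule C1c_mult[OF C1_on_subset[OF C1fs] U w]) simp
    have ib: "integrable lborel (\<lambda>x. norm (b s x) powr p * w x)" by (rule ints[OF cbp])
    have ia: "integrable lborel (\<lambda>x. norm (a x) powr p * w x)" by (rule ints[OF cap])
    have ic: "integrable lborel (\<lambda>x. (norm (a x) powr (p - 2) * (a x \<bullet> (b s x - a x))) * w x)"
    proof (rule ints)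
      have "continuous_on UNIV (\<lambda>x. (norm (a x) powr (p - 2) *\<^sub>R a x) \<bullet> (b s x - a x))"
        by (intro continuous_intros continuous_norm_powr_scaleR[OF p] ca cb)
      then show "continuous_on UNIV (\<lambda>x. norm (a x) powr (p - 2) * (a x \<bullet> (b s x - a x)))" by simp
    qed
    have "(LINT x|lborel. k x * (fs s x * w x)) =
        (LINT x|lborel. norm (a x) powr (p - 2) * (a x \<bullet> lgrad br E (\<lambda>x. fs s x * w x) x))"
      using weak[OF ws] by (simp add: a_def)
    also have "\<dots> = (LINT x|lborel. m x * fs s x + (norm (a x) powr (p - 2) * (a x \<bullet> (b s x - a x))) * w x)"
      by (rule Bochner_Integration.integral_cong[OF refl])
        (simp only: grad m_def inner_add_right inner_scaleR_right, simp add: algebra_simps)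
    also have "\<dots> = (LINT x|lborel. m x * fs s x) + (LINT x|lborel. (norm (a x) powr (p - 2) * (a x \<bullet> (b s x - a x))) * w x)"
      by (rule Bochner_Integration.integral_add[OF intm[OF cfs] ic])
    finally have 1: "(LINT x|lborel. k x * (fs s x * w x)) =
      (LINT x|lborel. m x * fs s x) + (LINT x|lborel. (norm (a x) powr (p - 2) * (a x \<bullet> (b s x - a x))) * w x)" .
    have 2: "(LINT x|lborel. k x * (fs s x * w x)) = A s - A 0"
    proof -
      have "(LINT x|lborel. k x * (fs s x * w x)) = (LINT x|lborel. (k x * f (dil s x)) * w x - (k x * f x) * w x)"
        by (simp add: fs_def algebra_simps)
      also have "\<dots> = (LINT x|lborel. (k x * f (dil s x)) * w x) - (LINT x|lborel. (k x * f x) * w x)"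
        by (intro Bochner_Integration.integral_diff ints continuous_intros k cfd C1_on_imp_continuous_on[OF C1f])
      finally show ?thesis by (simp add: A_def mult_ac)
    qed
    have 3: "(LINT x|lborel. m x * fs s x) = M s - M 0"
      using intm[OF cfd[of s]] intm[OF C1_on_imp_continuous_on[OF C1f]] by (simp add: fs_def M_def right_diff_distrib)
    have "p * (LINT x|lborel. (norm (a x) powr (p - 2) * (a x \<bullet> (b s x - a x))) * w x)
        = (LINT x|lborel. p * ((norm (a x) powr (p - 2) * (a x \<bullet> (b s x - a x))) * w x))" by simp
    also have "\<dots> \<le> (LINT x|lborel. norm (b s x) powr p * w x - norm (a x) powr p * w x)"
    proof (rule integral_mono)
      show "p * ((norm (a x) powr (p - 2) * (a x \<bullet> (b s x - a x))) * w x) \<le> norm (b s x) powr p * w x - norm (a x) powr p * w x" for x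
        using mult_right_mono[OF norm_powr_convex[OF p, of "a x" "b s x"] w_nonneg[of x]] by (simp add: algebra_simps)
    qed (use ic ia ib in auto)
    also have "\<dots> = (LINT x|lborel. norm (b s x) powr p * w x) - N 0" using ia ib by (simp add: N_def)
    \<comment> \<open>The dilation is now shifted from the gradient onto \<open>w\<close>:
      homogeneity of the gradient contributes exp (p s) and the Jacobian exp (-Q s).\<close>
    also have "(LINT x|lborel. norm (b s x) powr p * w x) = exp (p * s) * (LINT x|lborel. norm (a (dil s x)) powr p * w x)"
    proof -
      have "norm (b s x) powr p * w x = exp (p * s) * (norm (a (dil s x)) powr p * w x)" for x
        by (simp add: b_def powr_mult exp_powr_real mult.commute[of p s])
      then show ?thesis by (simp only: integral_mult_right_zero)
    qed
    also have "(LINT x|lborel. norm (a (dil s x)) powr p * w x) = (LINT x|lborel. (\<lambda>y. norm (a y) powr p * w (dil (- s) y)) (dil s x))"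
      by simp
    also have "\<dots> = exp (- Q * s) * N (- s)"
      unfolding N_def
    proof (rule integral_dil)
      show "continuous_on UNIV (\<lambda>y. norm (a y) powr p * w (dil (- s) y))"
        by (intro continuous_intros cap continuous_on_compose2[OF cw continuous_dil]) auto
      show "compact (dil s ` K)" by (rule compact_continuous_image[OF continuous_dil K(1)])
      show "norm (a y) powr p * w (dil (- s) y) = 0" if "y \<notin> dil s ` K" for y
        using that K(3)[of "dil (- s) y"] by (metis dil_inverse(2) imageI mult_zero_right)
    qed
    finally have "p * (LINT x|lborel. (norm (a x) powr (p - 2) * (a x \<bullet> (b s x - a x))) * w x) \<le>
      exp (p * s) * (exp (- Q * s) * N (- s)) - N 0" .
    moreover have "exp (p * s) * (exp (- Q * s) * N (- s)) = exp ((p - Q) * s) * N (- s)"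
    proof -
      have "exp (p * s + - Q * s) = exp (p * s) * exp (- Q * s)" by (rule exp_add)
      moreover have "p * s + - Q * s = (p - Q) * s" by (simp add: algebra_simps)
      ultimately show ?thesis by simp
    qed
    moreover have "(LINT x|lborel. (norm (a x) powr (p - 2) * (a x \<bullet> (b s x - a x))) * w x) = (A s - A 0) - (M s - M 0)"
      using 1 2 3 by simp
    ultimately have "p * ((A s - A 0) - (M s - M 0)) \<le> exp ((p - Q) * s) * N (- s) - N 0"
      by (simp only:)
    then show ?thesis by (simp only: right_diff_distrib)
  qed
  let ?Af = "LINT x|lborel. (k x * w x) * fderiv f x (dil_gen x)" and ?Mf = "LINT x|lborel. m x * fderiv f x (dil_gen x)"
    and ?Nw = "LINT x|lborel. norm (a x) powr p * fderiv w x (dil_gen x)"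
  have dA: "(A has_real_derivative ?Af) (at 0)"
    unfolding A_def by (rule has_real_derivative_integral_dil[OF f]) (intro continuous_intros k cw)
  have dM: "(M has_real_derivative ?Mf) (at 0)"
    unfolding M_def by (rule has_real_derivative_integral_dil[OF f cm])
  have dN: "(N has_real_derivative ?Nw) (at (- 0))"
    unfolding N_def minus_zero by (rule has_real_derivative_integral_dil[OF w cap])
  have dNm: "((\<lambda>s. N (- s)) has_real_derivative - ?Nw) (at 0)"
    using DERIV_chain2[OF dN DERIV_minus[OF DERIV_ident]] by simp
  define G where "G s = exp ((p - Q) * s) * N (- s) - N 0 - (p * (A s - A 0) - p * (M s - M 0))" for s
  have dG: "(G has_real_derivative ((p - Q) * N 0 - ?Nw - (p * ?Af - p * ?Mf))) (at 0)"
    unfolding G_def by (rule derivative_eq_intros dA dM dNm refl)+ simp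
  \<comment> \<open>\<open>key\<close> holds for positive and negative \<open>s\<close>, so 0 is an
    interior minimum of \<open>G\<close>; the vanishing derivative is the identity.\<close>
  have "G 0 = 0" "\<And>s. 0 \<le> G s" using key by (auto simp: G_def)
  then have "(p - Q) * N 0 - ?Nw - (p * ?Af - p * ?Mf) = 0"
    by (intro DERIV_local_min[OF dG zero_less_one]) simp
  then show ?thesis by (simp add: N_def m_def a_def)
qed

end

section \<open>Weak solutions with classical gradient\<close>

lemma in_Lp_compact_support:
  fixes v :: "'g::euclidean_space \<Rightarrow> 'b::euclidean_space"
  assumes "open U" "p > 0" "continuous_on UNIV v" "compact K" "\<And>x. x \<notin> K \<Longrightarrow> v x = 0"
  shows "in_Lp p U v"
  unfolding in_Lp_def
proof
  have U: "U \<in> sets lborel" using \<open>open U\<close> by simp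
  show "set_borel_measurable lborel U v"
    unfolding set_borel_measurable_def
    using U borel_measurable_continuous_onI[OF assms(3)] by (intro borel_measurable_scaleR borel_measurable_indicator) auto
  have "integrable lborel (\<lambda>x. norm (v x) powr p)"
    by (rule integrable_compact_support[OF assms(4)])
      (use assms continuous_on_norm_powr[OF assms(2), of K v] in \<open>auto intro: continuous_on_subset\<close>)
  then show "set_integrable lborel U (\<lambda>x. norm (v x) powr p)"
    unfolding set_integrable_def using U by (rule integrable_mult_indicator[rotated])
qed

lemma Lp_norm_le:
  fixes v :: "'g::euclidean_space \<Rightarrow> 'b::euclidean_space"
  assumes "open U" "p > 0" "continuous_on UNIV v" "compact K" "\<And>x. x \<notin> K \<Longrightarrow> v x = 0"
    and M: "0 \<le> M" "\<And>x. x \<in> K \<Longrightarrow> norm (v x) \<le> M"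
  shows "Lp_norm p U v \<le> M * measure lborel K powr (1 / p)"
proof -
  have "(LINT x:U|lborel. norm (v x) powr p) \<le> (LINT x|lborel. M powr p * indicator K x)"
    unfolding set_lebesgue_integral_def
  proof (rule integral_mono)
    show "integrable lborel (\<lambda>x. indicator U x *\<^sub>R norm (v x) powr p)"
      using in_Lp_compact_support[OF assms(1-5)] by (simp add: in_Lp_def set_integrable_def)
    show "integrable lborel (\<lambda>x. M powr p * indicator K x)"
      using emeasure_compact_finite[OF assms(4)] borel_compact[OF assms(4)]
      by (intro integrable_mult_right integrable_real_indicator) auto
    show "indicator U x *\<^sub>R norm (v x) powr p \<le> M powr p * indicator K x" for x
    proof (cases "x \<in> K")
      case True
      have "norm (v x) powr p \<le> M powr p" using M(2)[OF True] \<open>p > 0\<close> by (intro powr_mono2) auto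
      then show ?thesis using True by (auto simp: indicator_def)
    qed (use assms in simp)
  qed
  then have le: "(LINT x:U|lborel. norm (v x) powr p) \<le> M powr p * measure lborel K" by simp
  have "0 \<le> (LINT x:U|lborel. norm (v x) powr p)"
    unfolding set_lebesgue_integral_def by (intro Bochner_Integration.integral_nonneg) auto
  then have "Lp_norm p U v \<le> (M powr p * measure lborel K) powr (1 / p)"
    unfolding Lp_norm_def using le \<open>p > 0\<close> by (intro powr_mono2) auto
  also have "\<dots> = M * measure lborel K powr (1 / p)"
    using M(1) \<open>p > 0\<close> by (simp add: powr_mult powr_powr)
  finally show ?thesis .
qed

text \<open>As \<open>F 0 0 = 0\<close>, the indicator of \<open>U\<close> may be moved inside the
  arguments of \<open>F\<close>, and measurability of the gradients on \<open>U\<close> is all that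
  is used of them.\<close>

lemma set_integral_cong_AE_pair:
  fixes F :: "'a::euclidean_space \<Rightarrow> 'a \<Rightarrow> real"
  assumes g: "set_borel_measurable lborel U g1" "set_borel_measurable lborel U g2"
    "set_borel_measurable lborel U h1" "set_borel_measurable lborel U h2"
    and F: "(\<lambda>x. F (fst x) (snd x)) \<in> borel_measurable borel" "F 0 0 = 0"
    and ae: "AE x in lborel. x \<in> U \<longrightarrow> g1 x = h1 x" "AE x in lborel. x \<in> U \<longrightarrow> g2 x = h2 x"
  shows "(LINT x:U|lborel. F (g1 x) (g2 x)) = (LINT x:U|lborel. F (h1 x) (h2 x))"
proof -
  have eq: "indicator U x *\<^sub>R F (a x) (b x) = F (indicator U x *\<^sub>R a x) (indicator U x *\<^sub>R b x)" for a b x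
    using F(2) by (cases "x \<in> U") auto
  have meas: "(\<lambda>x. F (indicator U x *\<^sub>R a x) (indicator U x *\<^sub>R b x)) \<in> borel_measurable lborel"
    if "set_borel_measurable lborel U a" "set_borel_measurable lborel U b" for a b
    using measurable_compose[OF borel_measurable_Pair[OF that[unfolded set_borel_measurable_def]] F(1)] by simp
  show ?thesis
    unfolding set_lebesgue_integral_def eq
  proof (rule integral_cong_AE)
    show "AE x in lborel. F (indicator U x *\<^sub>R g1 x) (indicator U x *\<^sub>R g2 x)
        = F (indicator U x *\<^sub>R h1 x) (indicator U x *\<^sub>R h2 x)"
      using ae by eventually_elim (auto simp: indicator_def)
  qed (use g meas in auto)
qed

context heisenberg_frame
begin

lemma lgrad_outside:
  assumes "\<And>y. y \<notin> K \<Longrightarrow> u y = 0" "compact K" "x \<notin> K"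
  shows "lgrad br B u x = 0"
  using lderiv_outside[of K u x, OF assms] by (simp add: lgrad_def)

lemma whgrad_measurable:
  assumes "open U" "C1_on U u"
  shows "set_borel_measurable lborel U (whgrad br E U u)" "set_borel_measurable lborel U (lgrad br E u)"
  using has_whgrad_measurable[OF assms(1)] whgrad_classical(1)[OF assms] has_whgrad_classical[OF assms] by blast+

lemma Lp_norm_whgrad:
  assumes "open U" "C1_on U u"
  shows "Lp_norm p U (whgrad br E U u) = Lp_norm p U (lgrad br E u)"
proof -
  have "(\<lambda>x::'g \<times> 'g. norm (fst x) powr p) \<in> borel_measurable borel"
    using borel_measurable_continuous_onI[of "fst :: 'g \<times> 'g \<Rightarrow> 'g"] by (simp add: continuous_on_fst)
  then have "(LINT x:U|lborel. norm (whgrad br E U u x) powr p) = (LINT x:U|lborel. norm (lgrad br E u x) powr p)"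
    using whgrad_measurable[OF assms] whgrad_classical(2)[OF assms]
    by (intro set_integral_cong_AE_pair[where F="\<lambda>a b. norm a powr p" and ?g2.0="lgrad br E u" and ?h2.0="lgrad br E u"]) auto
  then show ?thesis by (simp add: Lp_norm_def)
qed

lemma C1c_W1H:
  assumes "open U" "p > 0" "u \<in> C1c U"
  shows "u \<in> W1H br E p U"
proof -
  obtain K where K: "C1_on UNIV u" "compact K" "\<And>x. x \<notin> K \<Longrightarrow> u x = 0" using C1cE[OF assms(3)] by metis
  have "in_Lp p U u"
    by (rule in_Lp_compact_support[OF assms(1,2) C1_on_imp_continuous_on[OF K(1)] K(2,3)])
  moreover have "in_Lp p U (lgrad br E u)"
    by (rule in_Lp_compact_support[OF assms(1,2) continuous_on_lgrad[OF K(1)] K(2) lgrad_outside[OF K(3,2)]])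
  ultimately show ?thesis
    unfolding W1H_def using has_whgrad_classical[OF assms(1) C1c_C1_on[OF assms(3)]] by blast
qed

text \<open>This admits test functions of class C1 in the weak equation. Mollifications supported in
  one compact \<open>L\<close> converge uniformly together with their first derivatives, and the
  finite measure of \<open>L\<close> turns this into convergence of the Sobolev norm.\<close>

lemma C1c_W1H0:
  assumes U: "open U" and p: "p > 0" and u: "u \<in> C1c U"
  shows "u \<in> W1H0 br E p U"
proof -
  obtain K where K: "C1_on UNIV u" "compact K" "K \<subseteq> U" "\<And>x. x \<notin> K \<Longrightarrow> u x = 0" using C1cE[OF u] by metis
  obtain \<delta> where \<delta>: "\<delta> > 0" "\<And>r. r \<le> \<delta> \<Longrightarrow> compact {x. \<exists>y\<in>K. dist y x \<le> r}"
    "\<And>r. r \<le> \<delta> \<Longrightarrow> {x. \<exists>y\<in>K. dist y x \<le> r} \<subseteq> U"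
    using compact_cball_neighbourhood[OF K(2) U K(3)] by blast
  define L where "L = {x. \<exists>y\<in>K. dist y x \<le> \<delta>}"
  have L: "compact L" "L \<subseteq> U" using \<delta>(2)[OF order_refl] \<delta>(3)[OF order_refl] by (simp_all add: L_def)
  have KL: "K \<subseteq> L" using \<delta>(1) by (auto simp: L_def intro!: bexI)
  have "\<exists>w. smooth_on UNIV w \<and> (\<forall>x. \<bar>w x - u x\<bar> \<le> 1 / Suc n) \<and> (\<forall>x. x \<notin> L \<longrightarrow> w x = 0) \<and>
      (\<forall>x. \<forall>b\<in>Basis. \<bar>fderiv w x b - fderiv u x b\<bar> \<le> 1 / Suc n)" for n
  proof -
    obtain w where w: "smooth_on UNIV w" "\<And>x. \<bar>w x - u x\<bar> \<le> 1 / Suc n"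
      "\<And>x. (\<And>y. y \<in> K \<Longrightarrow> dist y x > \<delta>) \<Longrightarrow> w x = 0"
      "C1_on UNIV u \<Longrightarrow> (\<forall>x. \<forall>b\<in>Basis. \<bar>fderiv w x b - fderiv u x b\<bar> \<le> 1 / Suc n)"
      by (rule smooth_approx[OF C1_on_imp_continuous_on[OF K(1)] K(2,4), of "1 / Suc n" \<delta>]) (use \<delta>(1) in auto)
    have "w x = 0" if "x \<notin> L" for x
      by (rule w(3)) (use that in \<open>force simp: L_def\<close>)
    then show ?thesis using w(1,2) w(4)[OF K(1)] by blast
  qed
  then obtain w where w: "\<And>n. smooth_on UNIV (w n)" "\<And>n x. \<bar>w n x - u x\<bar> \<le> 1 / Suc n"
    "\<And>n x. x \<notin> L \<Longrightarrow> w n x = 0" "\<And>n x b. b \<in> Basis \<Longrightarrow> \<bar>fderiv (w n) x b - fderiv u x b\<bar> \<le> 1 / Suc n"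
    by metis
  have test: "w n \<in> test_functions U" for n by (rule test_functionsI[OF w(1) L w(3)])
  define d where "d n x = w n x - u x" for n x
  have C1d: "C1_on UNIV (d n)" for n
    unfolding d_def by (intro C1_on_diff smooth_on_imp_C1_on w K)
  have d0: "d n x = 0" if "x \<notin> L" for n x using w(3) K(4) KL that by (auto simp: d_def)
  have "bounded ((\<lambda>x. \<Sum>e\<in>E. norm (lfield br e x)) ` L)"
    by (intro compact_imp_bounded compact_continuous_image L continuous_intros continuous_lfield)
  then obtain B where B: "\<And>x. x \<in> L \<Longrightarrow> (\<Sum>e\<in>E. norm (lfield br e x)) \<le> B"
    unfolding bounded_iff using abs_le_D1 by fastforce
  \<comment> \<open>\<open>B\<close> bounds the coefficients of the horizontal fields on
    \<open>L\<close>, the dimension counts the partial derivatives, and the maximum with 0 covers an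
    empty \<open>L\<close>.\<close>
  define D where "D = real DIM('g) * max B 0"
  have "D \<ge> 0" by (simp add: D_def)
  have grad: "norm (lgrad br E (d n) x) \<le> D / Suc n" if x: "x \<in> L" for n x
  proof -
    have fd: "\<bar>fderiv (d n) x b\<bar> \<le> 1 / Suc n" if "b \<in> Basis" for b
      using w(4)[OF that] fderiv_diff[OF smooth_on_imp_C1_on[OF w(1)] K(1) UNIV_I, of n x b] by (simp add: d_def[abs_def])
    have "norm (lgrad br E (d n) x) \<le> (\<Sum>e\<in>E. norm (lderiv br e (d n) x *\<^sub>R e))"
      unfolding lgrad_def by (rule norm_sum)
    also have "\<dots> = (\<Sum>e\<in>E. \<bar>fderiv (d n) x (lfield br e x)\<bar>)"
      using norm_frame by (intro sum.cong) (auto simp: C1_on_lderiv[OF C1d])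
    also have "\<dots> \<le> (\<Sum>e\<in>E. norm (lfield br e x) * (DIM('g) * (1 / Suc n)))"
    proof (rule sum_mono)
      fix e
      have "\<bar>fderiv (d n) x (lfield br e x)\<bar> \<le> (\<Sum>b\<in>Basis. \<bar>(lfield br e x \<bullet> b) * fderiv (d n) x b\<bar>)"
        by (subst C1_on_fderiv_Basis[OF C1d UNIV_I]) (rule sum_abs)
      also have "\<dots> \<le> (\<Sum>b::'g\<in>Basis. norm (lfield br e x) * (1 / Suc n))"
        unfolding abs_mult using fd by (intro sum_mono mult_mono Basis_le_norm) auto
      finally show "\<bar>fderiv (d n) x (lfield br e x)\<bar> \<le> norm (lfield br e x) * (DIM('g) * (1 / Suc n))"
        by (simp add: mult_ac)
    qed
    also have "\<dots> = (\<Sum>e\<in>E. norm (lfield br e x)) * (DIM('g) * (1 / Suc n))" by (rule sum_distrib_right[symmetric])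
    also have "\<dots> \<le> max B 0 * (DIM('g) * (1 / Suc n))"
      using B[OF x] by (intro mult_right_mono) auto
    finally show ?thesis by (simp add: D_def mult_ac)
  qed
  have W: "W1H_norm br E p U (d n) \<le> ((1 + D) * measure lborel L powr (1 / p)) / Suc n" for n
  proof -
    have "Lp_norm p U (d n) \<le> (1 / Suc n) * measure lborel L powr (1 / p)"
      by (rule Lp_norm_le[OF U p C1_on_imp_continuous_on[OF C1d] L(1)]) (use d0 w(2) in \<open>auto simp: d_def\<close>)
    moreover have "Lp_norm p U (lgrad br E (d n)) \<le> (D / Suc n) * measure lborel L powr (1 / p)"
      by (rule Lp_norm_le[OF U p continuous_on_lgrad[OF C1d] L(1) lgrad_outside[OF d0 L(1)]])
        (use grad \<open>D \<ge> 0\<close> in auto)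
    ultimately show ?thesis
      unfolding W1H_norm_def Lp_norm_whgrad[OF U C1_on_subset[OF C1d subset_UNIV]]
      by (simp add: add_divide_distrib distrib_right)
  qed
  have "(\<lambda>n. W1H_norm br E p U (d n)) \<longlonglongrightarrow> 0"
  proof (rule real_tendsto_sandwich)
    show "\<forall>\<^sub>F n in sequentially. 0 \<le> W1H_norm br E p U (d n)" by (simp add: W1H_norm_def Lp_norm_def)
    show "\<forall>\<^sub>F n in sequentially. W1H_norm br E p U (d n) \<le> ((1 + D) * measure lborel L powr (1 / p)) / Suc n"
      using W by simp
    show "(\<lambda>n. ((1 + D) * measure lborel L powr (1 / p)) / Suc n) \<longlonglongrightarrow> 0"
      by (rule LIMSEQ_Suc[OF lim_const_over_n])
  qed simp
  then show ?thesis
    unfolding W1H0_def using test C1c_W1H[OF U p u] by (auto simp: d_def[abs_def])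
qed

lemma weak_solution_classical:
  assumes U: "open U" and f: "C1_on U f" and weak: "weak_solution br E p U f"
    and w: "w \<in> W1H0 br E p U" "C1_on U w"
  shows "(LINT x:U|lborel. norm (lgrad br E f x) powr (p - 2) * (lgrad br E f x \<bullet> lgrad br E w x)) =
    (LINT x:U|lborel. norm (oproj E x) powr p * w x)"
proof -
  have "fst \<in> borel_measurable (borel :: ('g \<times> 'g) measure)" "snd \<in> borel_measurable (borel :: ('g \<times> 'g) measure)"
    by (intro borel_measurable_continuous_onI continuous_intros)+
  then have "(\<lambda>x::'g \<times> 'g. norm (fst x) powr (p - 2) * (fst x \<bullet> snd x)) \<in> borel_measurable borel"
    by measurable
  then have "(LINT x:U|lborel. norm (whgrad br E U f x) powr (p - 2) * (whgrad br E U f x \<bullet> whgrad br E U w x)) =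
      (LINT x:U|lborel. norm (lgrad br E f x) powr (p - 2) * (lgrad br E f x \<bullet> lgrad br E w x))"
    using whgrad_measurable[OF U f] whgrad_measurable[OF U w(2)] whgrad_classical(2)[OF U f] whgrad_classical(2)[OF U w(2)]
    by (intro set_integral_cong_AE_pair[where F="\<lambda>a b. norm a powr (p - 2) * (a \<bullet> b)"]) auto
  then show ?thesis using weak w(1) by (simp add: weak_solution_def)
qed

end

section \<open>Regularity: from horizontal to Euclidean derivatives\<close>

text \<open>The estimate holds uniformly for base points \<open>y\<close> near \<open>x\<close>, which allows increments along
  successive fields to be added.\<close>

definition strict_deriv_along :: "('g::euclidean_space \<Rightarrow> real) \<Rightarrow> ('g \<Rightarrow> 'g) \<Rightarrow> real \<Rightarrow> 'g \<Rightarrow> bool" where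
  "strict_deriv_along f L c x \<longleftrightarrow>
     (\<forall>\<epsilon>>0. \<exists>\<delta>>0. \<forall>y t. dist y x < \<delta> \<longrightarrow> \<bar>t\<bar> < \<delta> \<longrightarrow> \<bar>f (y + t *\<^sub>R L y) - f y - t * c\<bar> \<le> \<epsilon> * \<bar>t\<bar>)"

lemma strict_deriv_alongD:
  assumes "strict_deriv_along f L c x" "\<epsilon> > 0"
  obtains \<delta> where "\<delta> > 0" "\<And>y t. dist y x < \<delta> \<Longrightarrow> \<bar>t\<bar> < \<delta> \<Longrightarrow> \<bar>f (y + t *\<^sub>R L y) - f y - t * c\<bar> \<le> \<epsilon> * \<bar>t\<bar>"
  using assms unfolding strict_deriv_along_def by blast

lemma strict_deriv_along_add:
  assumes "strict_deriv_along f (\<lambda>_. v) c x" "strict_deriv_along f (\<lambda>_. v') c' x"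
  shows "strict_deriv_along f (\<lambda>_. v + v') (c + c') x"
  unfolding strict_deriv_along_def
proof (intro allI impI)
  fix \<epsilon> :: real assume "\<epsilon> > 0"
  obtain d where d: "d > 0" "\<And>y t. dist y x < d \<Longrightarrow> \<bar>t\<bar> < d \<Longrightarrow> \<bar>f (y + t *\<^sub>R v) - f y - t * c\<bar> \<le> \<epsilon> / 2 * \<bar>t\<bar>"
    using strict_deriv_alongD[OF assms(1), of "\<epsilon> / 2"] \<open>\<epsilon> > 0\<close> by auto
  obtain d' where d': "d' > 0" "\<And>y t. dist y x < d' \<Longrightarrow> \<bar>t\<bar> < d' \<Longrightarrow> \<bar>f (y + t *\<^sub>R v') - f y - t * c'\<bar> \<le> \<epsilon> / 2 * \<bar>t\<bar>"
    using strict_deriv_alongD[OF assms(2), of "\<epsilon> / 2"] \<open>\<epsilon> > 0\<close> by auto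
  \<comment> \<open>The intermediate point \<open>y + t *\<^sub>R v\<close> is then within r (1 +
    |v|), at most d'/2, of \<open>x\<close>, where the second estimate applies.\<close>
  define r where "r = min d (d' / (2 * (1 + norm v)))"
  have n: "1 + norm v > 0" by (simp add: add_pos_nonneg)
  have r: "r > 0" "r \<le> d" using d(1) d'(1) n by (simp_all add: r_def)
  have "r \<le> d' / (2 * (1 + norm v))" by (simp add: r_def)
  then have r3: "r * (1 + norm v) \<le> d' / 2" using n by (simp add: pos_le_divide_eq algebra_simps)
  show "\<exists>\<delta>>0. \<forall>y t. dist y x < \<delta> \<longrightarrow> \<bar>t\<bar> < \<delta> \<longrightarrow> \<bar>f (y + t *\<^sub>R (v + v')) - f y - t * (c + c')\<bar> \<le> \<epsilon> * \<bar>t\<bar>"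
  proof (intro exI[of _ r] conjI allI impI r)
    fix y t assume y: "dist y x < r" and t: "\<bar>t\<bar> < r"
    have "dist (y + t *\<^sub>R v) x \<le> dist y x + \<bar>t\<bar> * norm v"
      using dist_triangle[of "y + t *\<^sub>R v" x y] by (simp add: dist_norm)
    also have "\<dots> \<le> r + r * norm v" using y t by (intro add_mono mult_right_mono) auto
    also have "\<dots> < d'" using r3 d'(1) by (simp add: algebra_simps)
    finally have 1: "dist (y + t *\<^sub>R v) x < d'" .
    have "r * 1 \<le> r * (1 + norm v)" using r(1) by (intro mult_left_mono) auto
    then have "\<bar>t\<bar> < d'" using t r3 d'(1) by linarith
    then have "\<bar>f (y + t *\<^sub>R v + t *\<^sub>R v') - f (y + t *\<^sub>R v) - t * c'\<bar> \<le> \<epsilon> / 2 * \<bar>t\<bar>" using d'(2) 1 by blast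
    moreover have "\<bar>f (y + t *\<^sub>R v) - f y - t * c\<bar> \<le> \<epsilon> / 2 * \<bar>t\<bar>" using d(2) y t r(2) by force
    moreover have "y + t *\<^sub>R (v + v') = y + t *\<^sub>R v + t *\<^sub>R v'" by (simp add: scaleR_add_right)
    moreover have "\<epsilon> * \<bar>t\<bar> = \<epsilon> / 2 * \<bar>t\<bar> + \<epsilon> / 2 * \<bar>t\<bar>" by simp
    ultimately show "\<bar>f (y + t *\<^sub>R (v + v')) - f y - t * (c + c')\<bar> \<le> \<epsilon> * \<bar>t\<bar>"
      unfolding distrib_left by (smt (verit))
  qed
qed

lemma strict_deriv_along_scaleR:
  assumes "strict_deriv_along f (\<lambda>_. v) c x"
  shows "strict_deriv_along f (\<lambda>_. k *\<^sub>R v) (k * c) x"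
  unfolding strict_deriv_along_def
proof (intro allI impI)
  fix \<epsilon> :: real assume "\<epsilon> > 0"
  \<comment> \<open>The factor 1 + |k| in place of |k| admits k = 0.\<close>
  have n: "1 + \<bar>k\<bar> > 0" by simp
  obtain d where d: "d > 0" "\<And>y t. dist y x < d \<Longrightarrow> \<bar>t\<bar> < d \<Longrightarrow> \<bar>f (y + t *\<^sub>R v) - f y - t * c\<bar> \<le> \<epsilon> / (1 + \<bar>k\<bar>) * \<bar>t\<bar>"
    using strict_deriv_alongD[OF assms(1), of "\<epsilon> / (1 + \<bar>k\<bar>)"] \<open>\<epsilon> > 0\<close> n by (metis divide_pos_pos)
  show "\<exists>\<delta>>0. \<forall>y t. dist y x < \<delta> \<longrightarrow> \<bar>t\<bar> < \<delta> \<longrightarrow> \<bar>f (y + t *\<^sub>R (k *\<^sub>R v)) - f y - t * (k * c)\<bar> \<le> \<epsilon> * \<bar>t\<bar>"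
  proof (intro exI[of _ "d / (1 + \<bar>k\<bar>)"] conjI allI impI)
    fix y t assume y: "dist y x < d / (1 + \<bar>k\<bar>)" and t: "\<bar>t\<bar> < d / (1 + \<bar>k\<bar>)"
    have "d / (1 + \<bar>k\<bar>) \<le> d" using d(1) n by (simp add: field_simps)
    moreover have "\<bar>t * k\<bar> < d"
    proof -
      have "\<bar>t\<bar> * (1 + \<bar>k\<bar>) < d" using t n by (simp add: field_simps)
      then show ?thesis by (simp add: abs_mult algebra_simps) 
    qed
    ultimately have "\<bar>f (y + (t * k) *\<^sub>R v) - f y - (t * k) * c\<bar> \<le> \<epsilon> / (1 + \<bar>k\<bar>) * \<bar>t * k\<bar>"
      using y by (intro d(2)) auto
    also have "\<dots> \<le> \<epsilon> * \<bar>t\<bar>"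
    proof -
      have "\<bar>k\<bar> / (1 + \<bar>k\<bar>) \<le> 1" using n by simp
      then have "(\<epsilon> * \<bar>t\<bar>) * (\<bar>k\<bar> / (1 + \<bar>k\<bar>)) \<le> (\<epsilon> * \<bar>t\<bar>) * 1" using \<open>\<epsilon> > 0\<close> by (intro mult_left_mono) auto
      then show ?thesis by (simp add: abs_mult field_simps)
    qed
    finally show "\<bar>f (y + t *\<^sub>R (k *\<^sub>R v)) - f y - t * (k * c)\<bar> \<le> \<epsilon> * \<bar>t\<bar>" by (simp add: mult.assoc)
  qed (use d(1) n in auto)
qed

section \<open>Increments along left-invariant fields and their brackets\<close>

context heisenberg_frame
begin

text \<open>A step along the field changes the base point by a multiple of \<open>w\<close> plus a
  vertical vector, and both have zero bracket with \<open>w\<close>.\<close>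

lemma lfield_flow [simp]: "lfield br w (y + t *\<^sub>R lfield br w y) = lfield br w y"
  by (simp add: lfield_def br.add_left br.scaleR_left scaleR_add_right)

lemma has_derivative_along_flow:
  assumes der: "((\<lambda>t. g (z + t *\<^sub>R lfield br v z)) has_real_derivative g' z) (at 0)"
    and z: "z = y + s *\<^sub>R lfield br v y"
  shows "((\<lambda>t. g (y + t *\<^sub>R lfield br v y)) has_real_derivative g' z) (at s)"
proof -
  have "((\<lambda>h. g (y + (s + h) *\<^sub>R lfield br v y)) has_real_derivative g' z) (at 0)"
    using der unfolding z by (simp add: scaleR_add_left add.assoc)
  then show ?thesis
    using DERIV_at_within_shift[of "\<lambda>t. g (y + t *\<^sub>R lfield br v y)" "g' z" s 0 UNIV] by (simp add: o_def)
qed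

lemma line_in_convex:
  assumes "convex S" "y \<in> S" "y + t *\<^sub>R l \<in> S" "\<tau> \<in> closed_segment 0 t"
  shows "y + \<tau> *\<^sub>R l \<in> S"
proof -
  obtain u where u: "0 \<le> u" "u \<le> 1" "\<tau> = u * t" using assms(4) by (auto simp: in_segment)
  have "(1 - u) *\<^sub>R y + u *\<^sub>R (y + t *\<^sub>R l) \<in> S"
    using assms(1-3) u by (intro convexD) auto
  then show ?thesis using u(3) by (simp add: algebra_simps)
qed

text \<open>Integral curves of left-invariant fields are straight lines, so that convexity of \<open>S\<close> suffices.\<close>

lemma mvt_along:
  assumes S: "convex S" "y \<in> S" "y + t *\<^sub>R lfield br v y \<in> S"
    and der: "\<And>z. z \<in> S \<Longrightarrow> ((\<lambda>t. g (z + t *\<^sub>R lfield br v z)) has_real_derivative g' z) (at 0)"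
    and c: "\<And>z. z \<in> S \<Longrightarrow> \<bar>g' z - c\<bar> \<le> \<epsilon>"
  shows "\<bar>g (y + t *\<^sub>R lfield br v y) - g y - t * c\<bar> \<le> \<epsilon> * \<bar>t\<bar>"
proof -
  let ?G = "\<lambda>\<tau>. g (y + \<tau> *\<^sub>R lfield br v y) - \<tau> * c"
  have "norm (?G t - ?G 0) \<le> \<epsilon> * norm (t - 0)"
  proof (rule field_differentiable_bound[of "closed_segment 0 t" ?G "\<lambda>\<tau>. g' (y + \<tau> *\<^sub>R lfield br v y) - c"])
    fix \<tau> assume "\<tau> \<in> closed_segment 0 t"
    then have in_S: "y + \<tau> *\<^sub>R lfield br v y \<in> S" by (rule line_in_convex[OF S])
    have "((\<lambda>\<tau>. g (y + \<tau> *\<^sub>R lfield br v y)) has_real_derivative g' (y + \<tau> *\<^sub>R lfield br v y)) (at \<tau>)"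
      by (rule has_derivative_along_flow[where g=g and g'=g' and v=v, OF der[OF in_S] refl])
    then have "(?G has_real_derivative g' (y + \<tau> *\<^sub>R lfield br v y) - c) (at \<tau>)"
      by (auto intro!: derivative_eq_intros)
    then show "(?G has_field_derivative g' (y + \<tau> *\<^sub>R lfield br v y) - c) (at \<tau> within closed_segment 0 t)"
      by (rule has_field_derivative_at_within)
    show "norm (g' (y + \<tau> *\<^sub>R lfield br v y) - c) \<le> \<epsilon>" using c[OF in_S] by simp
  qed auto
  then show ?thesis by (simp add: algebra_simps)
qed

text \<open>\<open>mvt_along\<close> for \<open>g'\<close> bounds the derivative of the remainder by
  \<epsilon>|t|, and one more mean value step gives \<epsilon> times the square of
  \<open>t\<close>.\<close>

lemma taylor2_along:
  assumes S: "convex S" "y \<in> S" "y + t *\<^sub>R lfield br v y \<in> S"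
    and der: "\<And>z. z \<in> S \<Longrightarrow> ((\<lambda>t. g (z + t *\<^sub>R lfield br v z)) has_real_derivative g' z) (at 0)"
    and der': "\<And>z. z \<in> S \<Longrightarrow> ((\<lambda>t. g' (z + t *\<^sub>R lfield br v z)) has_real_derivative g'' z) (at 0)"
    and c: "\<And>z. z \<in> S \<Longrightarrow> \<bar>g'' z - c\<bar> \<le> \<epsilon>"
  shows "\<bar>g (y + t *\<^sub>R lfield br v y) - g y - t * g' y - t\<^sup>2 / 2 * c\<bar> \<le> \<epsilon> * t\<^sup>2"
proof -
  let ?G = "\<lambda>\<tau>. g (y + \<tau> *\<^sub>R lfield br v y) - \<tau> * g' y - \<tau>\<^sup>2 / 2 * c"
  have "\<epsilon> \<ge> 0" using c[OF S(2)] by linarith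
  have "norm (?G t - ?G 0) \<le> (\<epsilon> * \<bar>t\<bar>) * norm (t - 0)"
  proof (rule field_differentiable_bound[of "closed_segment 0 t" ?G "\<lambda>\<tau>. g' (y + \<tau> *\<^sub>R lfield br v y) - g' y - \<tau> * c"])
    fix \<tau> assume \<tau>: "\<tau> \<in> closed_segment 0 t"
    then have in_S: "y + \<tau> *\<^sub>R lfield br v y \<in> S" by (rule line_in_convex[OF S])
    have "((\<lambda>\<tau>. g (y + \<tau> *\<^sub>R lfield br v y)) has_real_derivative g' (y + \<tau> *\<^sub>R lfield br v y)) (at \<tau>)"
      by (rule has_derivative_along_flow[where g=g and g'=g' and v=v, OF der[OF in_S] refl])
    then have "(?G has_real_derivative g' (y + \<tau> *\<^sub>R lfield br v y) - g' y - \<tau> * c) (at \<tau>)"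
      by (auto intro!: derivative_eq_intros)
    then show "(?G has_field_derivative g' (y + \<tau> *\<^sub>R lfield br v y) - g' y - \<tau> * c) (at \<tau> within closed_segment 0 t)"
      by (rule has_field_derivative_at_within)
    have "\<bar>g' (y + \<tau> *\<^sub>R lfield br v y) - g' y - \<tau> * c\<bar> \<le> \<epsilon> * \<bar>\<tau>\<bar>"
      by (rule mvt_along[OF S(1,2) in_S der' c])
    also have "\<bar>\<tau>\<bar> \<le> \<bar>t\<bar>" using \<tau> by (auto simp: closed_segment_eq_real_ivl split: if_splits)
    finally show "norm (g' (y + \<tau> *\<^sub>R lfield br v y) - g' y - \<tau> * c) \<le> \<epsilon> * \<bar>t\<bar>"
      using \<open>\<epsilon> \<ge> 0\<close> by (simp add: mult_left_mono)
  qed auto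
  then show ?thesis by (simp add: algebra_simps power2_eq_square abs_mult[symmetric])
qed

lemma lfield_locally_bounded:
  obtains M where "M > 0" "\<And>y. dist y x \<le> 1 \<Longrightarrow> norm (lfield br v y) \<le> M"
proof -
  have "bounded (lfield br v ` cball x 1)"
    by (intro compact_imp_bounded compact_continuous_image continuous_lfield compact_cball)
  then obtain M where "M > 0" "\<forall>y\<in>lfield br v ` cball x 1. norm y \<le> M" by (meson bounded_pos)
  then show ?thesis using that[of M] by (auto simp: dist_commute)
qed

text \<open>On a small ball around \<open>x\<close> the derivative \<open>g'\<close> is within
  \<epsilon> of \<open>g' x\<close>, and this makes the mean value estimate uniform in the base
  point.\<close>

lemma strict_deriv_alongI:
  assumes U: "open U" "x \<in> U"
    and der: "\<And>z. z \<in> U \<Longrightarrow> ((\<lambda>t. g (z + t *\<^sub>R lfield br v z)) has_real_derivative g' z) (at 0)"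
    and cont: "continuous_on U g'"
  shows "strict_deriv_along g (lfield br v) (g' x) x"
  unfolding strict_deriv_along_def
proof (intro allI impI)
  fix \<epsilon> :: real assume "\<epsilon> > 0"
  have "isCont g' x" using cont U by (simp add: continuous_on_eq_continuous_at)
  then obtain d where d: "d > 0" "\<And>z. dist z x < d \<Longrightarrow> \<bar>g' z - g' x\<bar> \<le> \<epsilon>"
    using \<open>\<epsilon> > 0\<close> unfolding continuous_at_eps_delta dist_real_def by (meson less_imp_le)
  obtain r where r: "r > 0" "ball x r \<subseteq> U" using U by (meson openE)
  obtain M where M: "M > 0" "\<And>y. dist y x \<le> 1 \<Longrightarrow> norm (lfield br v y) \<le> M" using lfield_locally_bounded by metis
  define R where "R = min d r"
  \<comment> \<open>A leg from \<open>y\<close> ends within \<delta> (1 + M), hence within R, of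
    \<open>x\<close>; the bound 1 keeps \<open>y\<close> where \<open>M\<close> is valid.\<close>
  define \<delta> where "\<delta> = min 1 (R / (1 + M))"
  have R: "R > 0" using d r by (simp add: R_def)
  have "\<delta> \<le> R / (1 + M)" by (simp add: \<delta>_def)
  then have "\<delta> * (1 + M) \<le> R" using M(1) by (simp add: pos_le_divide_eq)
  then have \<delta>: "\<delta> > 0" "\<delta> \<le> 1" "\<delta> * (1 + M) \<le> R" using R M(1) by (simp_all add: \<delta>_def)
  show "\<exists>\<delta>>0. \<forall>y t. dist y x < \<delta> \<longrightarrow> \<bar>t\<bar> < \<delta> \<longrightarrow> \<bar>g (y + t *\<^sub>R lfield br v y) - g y - t * g' x\<bar> \<le> \<epsilon> * \<bar>t\<bar>"
  proof (intro exI[of _ \<delta>] conjI allI impI \<delta>)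
    fix y t assume y: "dist y x < \<delta>" and t: "\<bar>t\<bar> < \<delta>"
    have "dist (y + t *\<^sub>R lfield br v y) x \<le> dist y x + \<bar>t\<bar> * norm (lfield br v y)"
      using dist_triangle[of "y + t *\<^sub>R lfield br v y" x y] by (simp add: dist_norm)
    also have "\<dots> < \<delta> + \<delta> * M"
    proof (rule add_less_le_mono[OF y])
      show "\<bar>t\<bar> * norm (lfield br v y) \<le> \<delta> * M" using M(2)[of y] y t \<delta> by (intro mult_mono) auto
    qed
    also have "\<dots> \<le> R" using \<delta>(3) by (simp add: algebra_simps)
    finally have 1: "y + t *\<^sub>R lfield br v y \<in> ball x R" by (simp add: dist_commute)
    have "\<delta> * 1 \<le> \<delta> * (1 + M)" using \<delta>(1) M(1) by (intro mult_left_mono) auto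
    then have 2: "y \<in> ball x R" using y \<delta>(3) by (simp add: dist_commute)
    show "\<bar>g (y + t *\<^sub>R lfield br v y) - g y - t * g' x\<bar> \<le> \<epsilon> * \<bar>t\<bar>"
    proof (rule mvt_along[OF convex_ball 2 1, of g g'])
      fix z assume z: "z \<in> ball x R"
      then have "z \<in> U" using r(2) by (auto simp: R_def)
      then show "((\<lambda>t. g (z + t *\<^sub>R lfield br v z)) has_real_derivative g' z) (at 0)" by (rule der)
      show "\<bar>g' z - g' x\<bar> \<le> \<epsilon>" using d(2) z by (simp add: R_def dist_commute)
    qed
  qed
qed

text \<open>The four-leg path \<open>x exp(sd) exp(se) exp(-sd) exp(-se) = x + s\<^sup>2 [d, e]\<close>. Its corners are
  \<open>x\<close>, \<open>x1\<close>, \<open>x2\<close>, \<open>x3\<close>, \<open>y\<close>, and \<open>f(x2)\<close> is expanded to second order both from \<open>x\<close> and from \<open>y\<close>.\<close>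

lemma bracket_increment:
  fixes f fd fe fdd fde fed fee :: "'g \<Rightarrow> real"
  assumes U: "open U" "x \<in> U"
    and der: "\<And>z. z \<in> U \<Longrightarrow> ((\<lambda>t. f (z + t *\<^sub>R lfield br d z)) has_real_derivative fd z) (at 0)"
      "\<And>z. z \<in> U \<Longrightarrow> ((\<lambda>t. f (z + t *\<^sub>R lfield br e z)) has_real_derivative fe z) (at 0)"
      "\<And>z. z \<in> U \<Longrightarrow> ((\<lambda>t. fd (z + t *\<^sub>R lfield br d z)) has_real_derivative fdd z) (at 0)"
      "\<And>z. z \<in> U \<Longrightarrow> ((\<lambda>t. fe (z + t *\<^sub>R lfield br d z)) has_real_derivative fde z) (at 0)"
      "\<And>z. z \<in> U \<Longrightarrow> ((\<lambda>t. fd (z + t *\<^sub>R lfield br e z)) has_real_derivative fed z) (at 0)"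
      "\<And>z. z \<in> U \<Longrightarrow> ((\<lambda>t. fe (z + t *\<^sub>R lfield br e z)) has_real_derivative fee z) (at 0)"
    and cont: "continuous_on U fdd" "continuous_on U fde" "continuous_on U fed" "continuous_on U fee"
    and "\<epsilon> > 0"
  obtains \<delta> where "\<delta> > 0"
    "\<And>r. 0 \<le> r \<Longrightarrow> r < \<delta> \<Longrightarrow> \<bar>f (x + r *\<^sub>R br d e) - f x - r * (fde x - fed x)\<bar> \<le> \<epsilon> * r"
proof -
  \<comment> \<open>Six remainders cost one unit each and the two gradient differences
    \<open>A\<close>, \<open>B\<close> four units each, in all 14.\<close>
  define \<eta> where "\<eta> = \<epsilon> / 14"
  have \<eta>: "\<eta> > 0" using \<open>\<epsilon> > 0\<close> by (simp add: \<eta>_def)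
  have near: "\<exists>a>0. \<forall>z. dist z x < a \<longrightarrow> \<bar>h z - h x\<bar> \<le> \<eta>" if "continuous_on U h" for h :: "'g \<Rightarrow> real"
  proof -
    have "isCont h x" using that U by (simp add: continuous_on_eq_continuous_at)
    then show ?thesis using \<eta> unfolding continuous_at_eps_delta dist_real_def by (meson less_imp_le)
  qed
  obtain a1 a2 a3 a4 where a: "a1 > 0" "a2 > 0" "a3 > 0" "a4 > 0"
    "\<And>z. dist z x < a1 \<Longrightarrow> \<bar>fdd z - fdd x\<bar> \<le> \<eta>" "\<And>z. dist z x < a2 \<Longrightarrow> \<bar>fde z - fde x\<bar> \<le> \<eta>"
    "\<And>z. dist z x < a3 \<Longrightarrow> \<bar>fed z - fed x\<bar> \<le> \<eta>" "\<And>z. dist z x < a4 \<Longrightarrow> \<bar>fee z - fee x\<bar> \<le> \<eta>"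
    using near[OF cont(1)] near[OF cont(2)] near[OF cont(3)] near[OF cont(4)] by metis
  obtain r0 where r0: "r0 > 0" "ball x r0 \<subseteq> U" using U by (meson openE)
  obtain Md where Md: "Md > 0" "\<And>y. dist y x \<le> 1 \<Longrightarrow> norm (lfield br d y) \<le> Md" using lfield_locally_bounded by metis
  obtain Me where Me: "Me > 0" "\<And>y. dist y x \<le> 1 \<Longrightarrow> norm (lfield br e y) \<le> Me" using lfield_locally_bounded by metis
  define M where "M = max Md Me"
  have M: "M > 0" "\<And>y. dist y x \<le> 1 \<Longrightarrow> norm (lfield br d y) \<le> M" "\<And>y. dist y x \<le> 1 \<Longrightarrow> norm (lfield br e y) \<le> M"
    using Md Me by (auto simp: M_def le_max_iff_disj)
  define R where "R = min (min (min a1 a2) (min a3 a4)) (min r0 1)"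
  define S where "S = ball x R"
  have R: "R > 0" "R \<le> 1" using a r0 by (auto simp: R_def)
  have S: "convex S" "x \<in> S" using R by (auto simp: S_def)
  have SU: "z \<in> U" if "z \<in> S" for z using that r0(2) by (auto simp: S_def R_def dist_commute)
  have osc: "\<bar>fdd z - fdd x\<bar> \<le> \<eta>" "\<bar>fde z - fde x\<bar> \<le> \<eta>" "\<bar>fed z - fed x\<bar> \<le> \<eta>" "\<bar>fee z - fee x\<bar> \<le> \<eta>" if "z \<in> S" for z
    using that a by (auto simp: S_def R_def dist_commute)
  \<comment> \<open>Each leg moves by at most R/8, so beginning with R/4 for the first corner all
    corners stay within 5R/8 of \<open>x\<close>, and R at most 1 keeps the bound \<open>M\<close>
    in force.\<close>
  have step: "dist (z + t *\<^sub>R l) x < b + R / 8"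
    if "dist z x < b" "norm l \<le> M" "\<bar>t\<bar> * M \<le> R / 8" for z l b and t :: real
  proof -
    have "dist (z + t *\<^sub>R l) x \<le> dist z x + \<bar>t\<bar> * norm l"
      using dist_triangle[of "z + t *\<^sub>R l" x z] by (simp add: dist_norm)
    also have "\<bar>t\<bar> * norm l \<le> \<bar>t\<bar> * M" using that(2) by (intro mult_left_mono) auto
    finally show ?thesis using that by linarith
  qed
  have main: "\<bar>f (x + s\<^sup>2 *\<^sub>R br d e) - f x - s\<^sup>2 * (fde x - fed x)\<bar> \<le> \<epsilon> * s\<^sup>2" if s: "0 \<le> s" "s * M < R / 8" for s
  proof -
    define x1 where "x1 = x + s *\<^sub>R lfield br d x"
    define x2 where "x2 = x1 + s *\<^sub>R lfield br e x1"
    define x3 where "x3 = x2 + (- s) *\<^sub>R lfield br d x2"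
    define y where "y = x3 + (- s) *\<^sub>R lfield br e x3"
    have sM: "\<bar>s\<bar> * M \<le> R / 8" "\<bar>- s\<bar> * M \<le> R / 8" using s by auto
    have x1S: "dist x1 x < R / 4"
    proof -
      have "dist x1 x \<le> \<bar>s\<bar> * norm (lfield br d x)" by (simp add: x1_def dist_norm)
      also have "\<dots> \<le> \<bar>s\<bar> * M" using M(2)[of x] by (intro mult_left_mono) auto
      finally show ?thesis using sM R(1) by linarith
    qed
    then have x2S: "dist x2 x < R / 4 + R / 8"
      unfolding x2_def using R(2) sM by (intro step M) auto
    then have x3S: "dist x3 x < R / 4 + R / 8 + R / 8"
      unfolding x3_def using R(2) sM by (intro step M) auto
    then have "dist y x < R / 4 + R / 8 + R / 8 + R / 8"
      unfolding y_def using R(2) sM by (intro step M) auto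
    then have yS: "dist y x < R" using R(1) by simp
    have x4: "y = x + s\<^sup>2 *\<^sub>R br d e"
    proof -
      have de: "br e d = - br d e" by (rule br_skew)
      show ?thesis unfolding y_def x3_def x2_def x1_def lfield_def
        by (simp add: br.add_left br.add_right br.scaleR_left br.scaleR_right br.minus_left br.minus_right
            br.diff_left br.diff_right de algebra_simps power2_eq_square scaleR_half_double flip: scaleR_add_left)
    qed
    have inS: "x1 \<in> S" "x2 \<in> S" "x3 \<in> S" "y \<in> S"
      using x1S x2S x3S yS R(1) by (auto simp: S_def dist_commute)
    \<comment> \<open>Fields are constant along their own lines, so the last two legs can be run
      backwards from \<open>y\<close> with step +s; this is the expansion of \<open>f x2\<close>
      from \<open>y\<close>.\<close>
    have lf: "lfield br e y = lfield br e x3" "lfield br d x3 = lfield br d x2"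
      unfolding y_def x3_def by (simp_all only: lfield_flow)
    have legs: "x3 = y + s *\<^sub>R lfield br e y" "x2 = x3 + s *\<^sub>R lfield br d x3"
      by (simp_all only: lf) (simp_all add: y_def x3_def)
    note m = mvt_along[OF S(1)] and t = taylor2_along[OF S(1)]
    note i = der[OF SU]
    have 1: "\<bar>f x1 - f x - s * fd x - s\<^sup>2 / 2 * fdd x\<bar> \<le> \<eta> * s\<^sup>2"
      unfolding x1_def by (rule t[where g=f and g'=fd and g''=fdd and v=d, OF S(2) inS(1)[unfolded x1_def] i(1,3) osc(1)])
    have 2: "\<bar>f x2 - f x1 - s * fe x1 - s\<^sup>2 / 2 * fee x\<bar> \<le> \<eta> * s\<^sup>2"
      unfolding x2_def by (rule t[where g=f and g'=fe and g''=fee and v=e, OF inS(1) inS(2)[unfolded x2_def] i(2,6) osc(4)])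
    have 3: "\<bar>fe x1 - fe x - s * fde x\<bar> \<le> \<eta> * \<bar>s\<bar>"
      unfolding x1_def by (rule m[where g=fe and g'=fde and v=d, OF S(2) inS(1)[unfolded x1_def] i(4) osc(2)])
    have 4: "\<bar>f x3 - f y - s * fe y - s\<^sup>2 / 2 * fee x\<bar> \<le> \<eta> * s\<^sup>2"
      unfolding legs(1) by (rule t[where g=f and g'=fe and g''=fee and v=e, OF inS(4) inS(3)[unfolded legs(1)] i(2,6) osc(4)])
    have 5: "\<bar>f x2 - f x3 - s * fd x3 - s\<^sup>2 / 2 * fdd x\<bar> \<le> \<eta> * s\<^sup>2"
      unfolding legs(2) by (rule t[where g=f and g'=fd and g''=fdd and v=d, OF inS(3) inS(2)[unfolded legs(2)] i(1,3) osc(1)])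
    have 6: "\<bar>fd x3 - fd y - s * fed x\<bar> \<le> \<eta> * \<bar>s\<bar>"
      unfolding legs(1) by (rule m[where g=fd and g'=fed and v=e, OF inS(4) inS(3)[unfolded legs(1)] i(5) osc(3)])
    have 7: "\<bar>fd x1 - fd x - s * fdd x\<bar> \<le> \<eta> * \<bar>s\<bar>"
      unfolding x1_def by (rule m[where g=fd and g'=fdd and v=d, OF S(2) inS(1)[unfolded x1_def] i(3) osc(1)])
    have 8: "\<bar>fd x2 - fd x1 - s * fed x\<bar> \<le> \<eta> * \<bar>s\<bar>"
      unfolding x2_def by (rule m[where g=fd and g'=fed and v=e, OF inS(1) inS(2)[unfolded x2_def] i(5) osc(3)])
    have 9: "\<bar>fd x2 - fd x3 - s * fdd x\<bar> \<le> \<eta> * \<bar>s\<bar>"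
      unfolding legs(2) by (rule m[where g=fd and g'=fdd and v=d, OF inS(3) inS(2)[unfolded legs(2)] i(3) osc(1)])
    have 10: "\<bar>fe x2 - fe x1 - s * fee x\<bar> \<le> \<eta> * \<bar>s\<bar>"
      unfolding x2_def by (rule m[where g=fe and g'=fee and v=e, OF inS(1) inS(2)[unfolded x2_def] i(6) osc(4)])
    have 11: "\<bar>fe x2 - fe x3 - s * fde x\<bar> \<le> \<eta> * \<bar>s\<bar>"
      unfolding legs(2) by (rule m[where g=fe and g'=fde and v=d, OF inS(3) inS(2)[unfolded legs(2)] i(4) osc(2)])
    have 12: "\<bar>fe x3 - fe y - s * fee x\<bar> \<le> \<eta> * \<bar>s\<bar>"
      unfolding legs(1) by (rule m[where g=fe and g'=fee and v=e, OF inS(4) inS(3)[unfolded legs(1)] i(6) osc(4)])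
    have sq: "s * (\<eta> * \<bar>s\<bar>) = \<eta> * s\<^sup>2" using s by (simp add: power2_eq_square)
    have scale: "\<bar>s * A\<bar> \<le> k * (\<eta> * s\<^sup>2)" if "\<bar>A\<bar> \<le> k * (\<eta> * \<bar>s\<bar>)" for A k
    proof -
      have "\<bar>s * A\<bar> \<le> s * (k * (\<eta> * \<bar>s\<bar>))" unfolding abs_mult using that s by (auto intro: mult_mono)
      also have "\<dots> = k * (\<eta> * s\<^sup>2)" by (simp only: mult.left_commute[of s k] sq)
      finally show ?thesis .
    qed
    \<comment> \<open>Opposite legs contribute opposite leading increments of \<open>fd\<close>, and
      likewise of \<open>fe\<close>. Between \<open>x\<close> and \<open>y\<close> both change by
      o(s) only, so the first-order terms at the two ends cancel up to o(s^2).\<close>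
    have A: "\<bar>s * (fd y - fd x)\<bar> \<le> 4 * (\<eta> * s\<^sup>2)" by (rule scale) (use 6 7 8 9 in linarith)
    have B: "\<bar>s * (fe y - fe x)\<bar> \<le> 4 * (\<eta> * s\<^sup>2)" by (rule scale) (use 3 10 11 12 in linarith)
    have C: "\<bar>s * (fe x1 - fe x - s * fde x)\<bar> \<le> 1 * (\<eta> * s\<^sup>2)" by (rule scale) (use 3 in linarith)
    have D: "\<bar>s * (fd x3 - fd y - s * fed x)\<bar> \<le> 1 * (\<eta> * s\<^sup>2)" by (rule scale) (use 6 in linarith)
    have "f y - f x - s\<^sup>2 * (fde x - fed x) =
        (f x1 - f x - s * fd x - s\<^sup>2 / 2 * fdd x) + (f x2 - f x1 - s * fe x1 - s\<^sup>2 / 2 * fee x)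
        + s * (fe x1 - fe x - s * fde x) - (f x3 - f y - s * fe y - s\<^sup>2 / 2 * fee x)
        - (f x2 - f x3 - s * fd x3 - s\<^sup>2 / 2 * fdd x) - s * (fd x3 - fd y - s * fed x)
        - s * (fd y - fd x) - s * (fe y - fe x)"
      by (simp add: algebra_simps power2_eq_square)
    moreover have "\<bar>t1 + t2 + t3 - t4 - t5 - t6 - t7 - t8\<bar> \<le> 14 * q"
      if "\<bar>t1\<bar> \<le> q" "\<bar>t2\<bar> \<le> q" "\<bar>t3\<bar> \<le> 1 * q" "\<bar>t4\<bar> \<le> q" "\<bar>t5\<bar> \<le> q" "\<bar>t6\<bar> \<le> 1 * q"
        "\<bar>t7\<bar> \<le> 4 * q" "\<bar>t8\<bar> \<le> 4 * q" for t1 t2 t3 t4 t5 t6 t7 t8 q :: real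
      using that[THEN abs_le_D1] that[THEN abs_le_D2] by (intro abs_leI) linarith+
    note this[OF 1 2 C 4 5 D A B]
    ultimately have "\<bar>f y - f x - s\<^sup>2 * (fde x - fed x)\<bar> \<le> 14 * (\<eta> * s\<^sup>2)" by (simp only:)
    then show ?thesis by (simp add: x4 \<eta>_def)
  qed
  \<comment> \<open>The path with parameter s ends at distance parameter r = s^2 along the bracket,
    so s is the square root of \<open>r\<close>.\<close>
  define \<delta> where "\<delta> = (R / (8 * M))\<^sup>2"
  show ?thesis
  proof (rule that[of \<delta>])
    show "\<delta> > 0" using R M by (simp add: \<delta>_def)
    fix r :: real assume r: "0 \<le> r" "r < \<delta>"
    have "sqrt r < R / (8 * M)"
      using r R(1) M(1) real_sqrt_less_mono[OF r(2)] by (simp add: \<delta>_def)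
    then have "sqrt r * M < R / 8" using M(1) by (simp add: field_simps)
    then show "\<bar>f (x + r *\<^sub>R br d e) - f x - r * (fde x - fed x)\<bar> \<le> \<epsilon> * r"
      using main[of "sqrt r"] r(1) by simp
  qed
qed

end

context heisenberg_frame
begin

text \<open>The interior part of \<open>\<Gamma>\<^sup>2\<^sup>,\<^sup>\<alpha>\<close>, without Hoelder bounds.\<close>

definition horizontal_C2 :: "'g set \<Rightarrow> ('g \<Rightarrow> real) \<Rightarrow> bool" where
  "horizontal_C2 U f \<longleftrightarrow>
     (\<forall>e\<in>E. (\<forall>x\<in>U. ldifferentiable br e f x) \<and> continuous_on U (lderiv br e f)) \<and>
     (\<forall>d\<in>E. \<forall>e\<in>E. (\<forall>x\<in>U. ldifferentiable br d (lderiv br e f) x) \<and> continuous_on U (lderiv br d (lderiv br e f)))"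

lemma ldifferentiable_has_derivative:
  "ldifferentiable br v f x \<Longrightarrow> ((\<lambda>t. f (x + t *\<^sub>R lfield br v x)) has_real_derivative lderiv br v f x) (at 0)"
  unfolding ldifferentiable_def lderiv_def by (simp add: DERIV_deriv_iff_real_differentiable)

text \<open>\<open>bracket_increment\<close> controls r at least 0. Exchanging \<open>d\<close> and
  \<open>e\<close> reverses the sign of both the bracket and the commutator, which covers negative
  \<open>r\<close>.\<close>

lemma bracket_has_derivative:
  assumes U: "open U" "x \<in> U" and f: "horizontal_C2 U f" and de: "d \<in> E" "e \<in> E"
  shows "((\<lambda>r. f (x + r *\<^sub>R br d e)) has_real_derivative
    (lderiv br d (lderiv br e f) x - lderiv br e (lderiv br d f) x)) (at 0)"
proof -
  let ?c = "lderiv br d (lderiv br e f) x - lderiv br e (lderiv br d f) x"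
  have incr: "\<exists>\<delta>>0. \<forall>r. 0 \<le> r \<longrightarrow> r < \<delta> \<longrightarrow> \<bar>f (x + r *\<^sub>R br a b) - f x - 
      r * (lderiv br a (lderiv br b f) x - lderiv br b (lderiv br a f) x)\<bar> \<le> \<epsilon> * r"
    if "\<epsilon> > 0" "a \<in> E" "b \<in> E" for \<epsilon> a b
  proof -
    have der: "((\<lambda>t. f (z + t *\<^sub>R lfield br i z)) has_real_derivative lderiv br i f z) (at 0)" 
      if "z \<in> U" "i \<in> E" for z i
      using f that by (intro ldifferentiable_has_derivative) (auto simp: horizontal_C2_def)
    have der2: "((\<lambda>t. lderiv br j f (z + t *\<^sub>R lfield br i z)) has_real_derivative lderiv br i (lderiv br j f) z) (at 0)"
      if "z \<in> U" "i \<in> E" "j \<in> E" for z i j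
      using f that by (intro ldifferentiable_has_derivative) (auto simp: horizontal_C2_def)
    have cont: "continuous_on U (lderiv br i (lderiv br j f))" if "i \<in> E" "j \<in> E" for i j
      using f that by (auto simp: horizontal_C2_def)
    show ?thesis
      by (rule bracket_increment[OF U der[OF _ that(2)] der[OF _ that(3)] der2[OF _ that(2) that(2)] der2[OF _ that(2) that(3)]
            der2[OF _ that(3) that(2)] der2[OF _ that(3) that(3)] cont[OF that(2) that(2)] cont[OF that(2) that(3)]
            cont[OF that(3) that(2)] cont[OF that(3) that(3)] that(1)]) blast+
  qed
  have "((\<lambda>r. f (x + r *\<^sub>R br d e)) has_derivative (\<lambda>h. h * ?c)) (at 0)"
    unfolding has_derivative_at_alt
  proof (intro conjI allI impI)
    show "bounded_linear (\<lambda>h. h * ?c)" by (rule bounded_linear_mult_left)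
    fix \<epsilon> :: real assume "\<epsilon> > 0"
    obtain d1 where d1: "d1 > 0" "\<And>r. 0 \<le> r \<Longrightarrow> r < d1 \<Longrightarrow> \<bar>f (x + r *\<^sub>R br d e) - f x - r * ?c\<bar> \<le> \<epsilon> * r"
      using incr[OF \<open>\<epsilon> > 0\<close> de] by blast
    obtain d2 where d2: "d2 > 0" "\<And>r. 0 \<le> r \<Longrightarrow> r < d2 \<Longrightarrow> \<bar>f (x + r *\<^sub>R br e d) - f x - 
        r * (lderiv br e (lderiv br d f) x - lderiv br d (lderiv br e f) x)\<bar> \<le> \<epsilon> * r"
      using incr[OF \<open>\<epsilon> > 0\<close> de(2,1)] by blast
    show "\<exists>\<delta>>0. \<forall>y. norm (y - 0) < \<delta> \<longrightarrow>
        norm (f (x + y *\<^sub>R br d e) - f (x + 0 *\<^sub>R br d e) - (y - 0) * ?c) \<le> \<epsilon> * norm (y - 0)"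
    proof (intro exI[of _ "min d1 d2"] conjI allI impI)
      fix y :: real assume y: "norm (y - 0) < min d1 d2"
      show "norm (f (x + y *\<^sub>R br d e) - f (x + 0 *\<^sub>R br d e) - (y - 0) * ?c) \<le> \<epsilon> * norm (y - 0)"
      proof (cases "0 \<le> y")
        case True
        then show ?thesis using d1(2)[of y] y by simp
      next
        case False
        have "x + (- y) *\<^sub>R br e d = x + y *\<^sub>R br d e" by (subst br_skew) simp
        moreover have "(- y) * (lderiv br e (lderiv br d f) x - lderiv br d (lderiv br e f) x) = y * ?c"
          by (simp add: algebra_simps)
        ultimately show ?thesis using d2(2)[of "- y"] y False by simp
      qed
    qed (use d1 d2 in auto)
  qed
  then show ?thesis by (simp add: has_field_derivative_def mult_commute_abs)
qed

lemma lfield_V [simp]: "v \<in> V \<Longrightarrow> lfield br v = (\<lambda>_. v)"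
  by (simp add: lfield_def fun_eq_iff)

lemma V_eq_span_brackets: "V = span {br d e |d e. d \<in> E \<and> e \<in> E}"
proof
  let ?S = "span {br d e |d e. d \<in> E \<and> e \<in> E}"
  have "br z z' \<in> ?S" if "z \<in> H" "z' \<in> H" for z z'
  proof -
    have "br z z' = br (oproj E z) (oproj E z')" using that by simp
    also have "\<dots> = (\<Sum>e\<in>E. \<Sum>d\<in>E. (z' \<bullet> e) *\<^sub>R (z \<bullet> d) *\<^sub>R br d e)"
      by (simp add: oproj_def br.sum_left br.sum_right br.scaleR_left br.scaleR_right scaleR_sum_right)
    also have "\<dots> \<in> ?S" by (intro span_sum span_scale span_base) blast
    finally show ?thesis .
  qed
  then have "{br z z' |z z'. z \<in> H \<and> z' \<in> H} \<subseteq> ?S" by blast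
  from span_minimal[OF this subspace_span] show "V \<subseteq> ?S" by (simp only: span_brackets)
  show "?S \<subseteq> V" by (rule span_minimal[OF _ subspace_V]) (use br_in_V in auto)
qed

text \<open>The directions with a continuous strict derivative form a subspace. It contains the
  brackets of frame vectors, and these span \<open>V\<close>.\<close>

lemma vertical_strict_deriv:
  assumes U: "open U" and f: "horizontal_C2 U f" and v: "v \<in> V"
  shows "\<exists>c. continuous_on U c \<and> (\<forall>x\<in>U. strict_deriv_along f (\<lambda>_. v) (c x) x)"
proof -
  let ?P = "\<lambda>v. \<exists>c. continuous_on U c \<and> (\<forall>x\<in>U. strict_deriv_along f (\<lambda>_. v) (c x) x)"
  have "subspace {v. ?P v}"
  proof (rule subspaceI)
    show "0 \<in> {v. ?P v}"
      by (intro CollectI exI[of _ "\<lambda>_. 0"]) (auto simp: strict_deriv_along_def intro!: exI[of _ 1])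
    show "v + v' \<in> {v. ?P v}" if v: "v \<in> {v. ?P v}" and v': "v' \<in> {v. ?P v}" for v v'
    proof -
      obtain c c' where "continuous_on U c" "\<forall>x\<in>U. strict_deriv_along f (\<lambda>_. v) (c x) x"
        "continuous_on U c'" "\<forall>x\<in>U. strict_deriv_along f (\<lambda>_. v') (c' x) x" using v v' by blast
      then show ?thesis
        by (intro CollectI exI[of _ "\<lambda>x. c x + c' x"]) (auto intro: continuous_on_add strict_deriv_along_add)
    qed
    show "k *\<^sub>R v \<in> {v. ?P v}" if v: "v \<in> {v. ?P v}" for k v
    proof -
      obtain c where "continuous_on U c" "\<forall>x\<in>U. strict_deriv_along f (\<lambda>_. v) (c x) x" using v by blast
      then show ?thesis
        by (intro CollectI exI[of _ "\<lambda>x. k * c x"]) (auto intro: continuous_on_mult_left strict_deriv_along_scaleR)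
    qed
  qed
  moreover have "?P (br d e)" if de: "d \<in> E" "e \<in> E" for d e
  proof (intro exI conjI ballI)
    let ?c = "\<lambda>x. lderiv br d (lderiv br e f) x - lderiv br e (lderiv br d f) x"
    show c: "continuous_on U ?c" using f de by (intro continuous_on_diff) (auto simp: horizontal_C2_def)
    \<comment> \<open>The left-invariant field of a vertical vector is constant, so its lines are
      those along which \<open>bracket_has_derivative\<close> was proved.\<close>
    have "strict_deriv_along f (lfield br (br d e)) (?c x) x" if "x \<in> U" for x
      by (rule strict_deriv_alongI[OF U that _ c]) (use bracket_has_derivative[OF U _ f de] br_in_V in simp)
    then show "strict_deriv_along f (\<lambda>_. br d e) (?c x) x" if "x \<in> U" for x
      using that br_in_V by simp
  qed
  then have "{br d e |d e. d \<in> E \<and> e \<in> E} \<subseteq> {v. ?P v}" by blast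
  ultimately have "span {br d e |d e. d \<in> E \<and> e \<in> E} \<subseteq> {v. ?P v}" by (intro span_minimal)
  then show ?thesis using v V_eq_span_brackets by blast
qed

text \<open>Strict differentiability in the directions \<open>span A\<close>, with increments taken
  by right multiplication in the group. The base point varies because adjoining a vector to
  \<open>A\<close> evaluates the old estimate and the new one at different points.\<close>

definition frame_differentiable :: "('g \<Rightarrow> real) \<Rightarrow> ('g \<Rightarrow> real) \<Rightarrow> 'g \<Rightarrow> 'g set \<Rightarrow> bool" where
  "frame_differentiable f c x A \<longleftrightarrow> (\<forall>\<epsilon>>0. \<exists>\<delta>>0. \<forall>y u. dist y x < \<delta> \<longrightarrow> u \<in> span A \<longrightarrow> norm u < \<delta> \<longrightarrow>
     \<bar>f (gmul br y u) - f y - (\<Sum>b\<in>A. (u \<bullet> b) * c b)\<bar> \<le> \<epsilon> * norm u)"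

text \<open>With \<open>u = u' + te\<close> and \<open>u'' = u' - (t/2)[u', e]\<close> one has \<open>exp(u) = exp(u'') exp(te)\<close>.\<close>

lemma frame_differentiable_insert:
  assumes A: "finite A" "insert e A \<subseteq> E \<union> F" "e \<notin> A" and e: "e \<in> V \<or> V \<subseteq> span A"
    and fA: "frame_differentiable f c x A" and fe: "strict_deriv_along f (lfield br e) (c e) x"
  shows "frame_differentiable f c x (insert e A)"
  unfolding frame_differentiable_def
proof (intro allI impI)
  fix \<epsilon> :: real assume "\<epsilon> > 0"
  obtain K where K: "K > 0" "\<And>a b. norm (br a b) \<le> norm a * norm b * K" using br.pos_bounded by blast
  define C where "C = (\<Sum>b\<in>A. \<bar>c b\<bar>)"
  define M where "M = 2 + K"
  define L where "L = 1 + M * (1 + K * (norm x + 1))"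
  have C: "C \<ge> 0" by (simp add: C_def sum_nonneg)
  have M: "M \<ge> 2" using K(1) by (simp add: M_def)
  have L: "L > 0" using M K(1) by (simp add: L_def add_pos_nonneg)
  define \<epsilon>' where "\<epsilon>' = \<epsilon> / (2 * (1 + M))"
  have \<epsilon>': "\<epsilon>' > 0" using \<open>\<epsilon> > 0\<close> M by (simp add: \<epsilon>'_def)
  obtain dA where dA: "dA > 0" "\<And>y u. dist y x < dA \<Longrightarrow> u \<in> span A \<Longrightarrow> norm u < dA \<Longrightarrow>
     \<bar>f (gmul br y u) - f y - (\<Sum>b\<in>A. (u \<bullet> b) * c b)\<bar> \<le> \<epsilon>' * norm u"
    using fA[unfolded frame_differentiable_def, rule_format, OF \<epsilon>'] by blast
  obtain de where de: "de > 0" "\<And>y t. dist y x < de \<Longrightarrow> \<bar>t\<bar> < de \<Longrightarrow>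
      \<bar>f (y + t *\<^sub>R lfield br e y) - f y - t * c e\<bar> \<le> \<epsilon>' * \<bar>t\<bar>"
    using strict_deriv_alongD[OF fe \<epsilon>'] by blast
  \<comment> \<open>The entry 1 makes the square of |u| at most |u|, the second absorbs the
    quadratic error from replacing \<open>u''\<close> by \<open>u\<close>, the third keeps
    \<open>u''\<close> in the range of \<open>dA\<close>, and the last keeps \<open>y'\<close> and
    \<open>t\<close> in the range of \<open>de\<close>.\<close>
  define \<delta> where "\<delta> = Min {1, \<epsilon> / (2 * (K * C + 1)), dA / (1 + M), de / L}"
  have KC: "K * C + 1 > 0" using K(1) C by (simp add: add_nonneg_pos)
  have \<delta>0: "\<delta> > 0" using \<open>\<epsilon> > 0\<close> dA(1) de(1) L M KC by (simp add: \<delta>_def)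
  have "\<delta> \<le> 1" "\<delta> \<le> \<epsilon> / (2 * (K * C + 1))" "\<delta> \<le> dA / (1 + M)" "\<delta> \<le> de / L" by (simp_all add: \<delta>_def)
  then have \<delta>: "\<delta> \<le> 1" "\<delta> * (2 * (K * C + 1)) \<le> \<epsilon>" "\<delta> * (1 + M) \<le> dA" "\<delta> * L \<le> de"
    using KC M L by (simp_all add: pos_le_divide_eq)
  show "\<exists>\<delta>>0. \<forall>y u. dist y x < \<delta> \<longrightarrow> u \<in> span (insert e A) \<longrightarrow> norm u < \<delta> \<longrightarrow>
     \<bar>f (gmul br y u) - f y - (\<Sum>b\<in>insert e A. (u \<bullet> b) * c b)\<bar> \<le> \<epsilon> * norm u"
  proof (intro exI[of _ \<delta>] conjI allI impI \<delta>0)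
    fix y u assume y: "dist y x < \<delta>" and u: "u \<in> span (insert e A)" and nu: "norm u < \<delta>"
    define t where "t = u \<bullet> e"
    define u' where "u' = u - t *\<^sub>R e"
    define u'' where "u'' = u' - (t / 2) *\<^sub>R br u' e"
    have ee: "e \<bullet> e = 1" "norm e = 1" using A(2) frame_orthonormal[of e e] norm_frame[of e] by auto
    have eA: "e \<bullet> b = 0" "b \<bullet> e = 0" if "b \<in> A" for b
      using that A frame_orthonormal[of e b] frame_orthonormal[of b e] by auto
    have eS: "z \<bullet> e = 0" if "z \<in> span A" for z
    proof -
      have "orthogonal e z" by (rule orthogonal_to_span[OF that]) (use eA in \<open>auto simp: orthogonal_def\<close>)
      then show ?thesis by (simp add: orthogonal_def inner_commute)
    qed
    obtain k where k: "u - k *\<^sub>R e \<in> span A" using u span_breakdown_eq by metis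
    then have "(u - k *\<^sub>R e) \<bullet> e = 0" by (rule eS)
    then have "k = t" using ee by (simp add: t_def inner_diff_left)
    then have u': "u' \<in> span A" using k by (simp add: u'_def)
    \<comment> \<open>Either \<open>e\<close> is vertical and the bracket is zero, or the bracket
      lies in \<open>V\<close> and hence in \<open>span A\<close>; this keeps \<open>u''\<close> in
      \<open>span A\<close>.\<close>
    have "br u' e \<in> span A" using e br_in_V span_zero by (cases "e \<in> V") auto
    then have u'': "u'' \<in> span A" using u' by (simp add: u''_def span_diff span_scale)
    have t_le: "\<bar>t\<bar> \<le> norm u" using Cauchy_Schwarz_ineq2[of u e] ee by (simp add: t_def)
    have nu': "norm u' \<le> 2 * norm u"
      using norm_triangle_ineq4[of u "t *\<^sub>R e"] t_le ee by (simp add: u'_def)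
    have nbr: "norm (br u' e) \<le> 2 * norm u * K"
    proof -
      have "norm (br u' e) \<le> norm u' * K" using K(2)[of u' e] ee by simp
      also have "\<dots> \<le> 2 * norm u * K" using nu' K(1) by (intro mult_right_mono) auto
      finally show ?thesis .
    qed
    have half: "norm ((t / 2) *\<^sub>R br u' e) \<le> K * (norm u)\<^sup>2"
    proof -
      have "norm ((t / 2) *\<^sub>R br u' e) = \<bar>t\<bar> / 2 * norm (br u' e)" by simp
      also have "\<dots> \<le> norm u / 2 * (2 * norm u * K)" using t_le nbr by (intro mult_mono) auto
      finally show ?thesis by (simp add: power2_eq_square mult_ac)
    qed
    have u_small: "(norm u)\<^sup>2 \<le> norm u"
      using nu \<delta>(1) by (simp add: power2_eq_square mult_left_le)
    have nu'': "norm u'' \<le> M * norm u"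
    proof -
      have "norm u'' \<le> norm u' + norm ((t / 2) *\<^sub>R br u' e)" unfolding u''_def by (rule norm_triangle_ineq4)
      also have "\<dots> \<le> 2 * norm u + K * norm u"
        using nu' half mult_left_mono[OF u_small, of K] K(1) by linarith
      finally show ?thesis by (simp add: M_def algebra_simps)
    qed
    have Mu: "M * norm u \<le> M * \<delta>" using nu M by (intro mult_left_mono) auto
    have yA: "dist y x < dA"
    proof -
      have "\<delta> * 1 \<le> \<delta> * (1 + M)" using \<delta>0 M by (intro mult_left_mono) auto
      then show ?thesis using y \<delta>(3) by linarith
    qed
    have u''A: "norm u'' < dA" using nu'' Mu \<delta>(3) \<delta>0 by (simp add: algebra_simps)
    define y' where "y' = gmul br y u''"
    have y': "dist y' x < de"
    proof -
      have "norm y \<le> norm x + 1"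
        using y \<delta>(1) norm_triangle_ineq2[of y x] by (simp add: dist_norm)
      then have "norm y * norm u'' * K \<le> (norm x + 1) * norm u'' * K" using K(1) by (intro mult_right_mono) auto
      then have "norm (br y u'') \<le> (norm x + 1) * norm u'' * K" using K(2)[of y u''] by linarith
      moreover have "norm ((1/2) *\<^sub>R br y u'') \<le> norm (br y u'')" by simp
      ultimately have "norm u'' + norm ((1/2) *\<^sub>R br y u'') \<le> norm u'' + (norm x + 1) * norm u'' * K" by linarith
      also have "\<dots> = norm u'' * (1 + K * (norm x + 1))" by (simp add: algebra_simps)
      also have "\<dots> \<le> (M * \<delta>) * (1 + K * (norm x + 1))"
        using nu'' Mu K(1) by (intro mult_right_mono) auto
      finally have "norm u'' + norm ((1/2) *\<^sub>R br y u'') \<le> \<delta> * (L - 1)" by (simp add: L_def mult_ac)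
      moreover have "dist y' x \<le> dist y x + norm u'' + norm ((1/2) *\<^sub>R br y u'')"
      proof -
        have yx: "y' - x = (y - x) + u'' + (1/2) *\<^sub>R br y u''" by (simp add: y'_def gmul_def)
        show ?thesis
          unfolding dist_norm yx using norm_triangle_ineq[of "(y - x) + u''" "(1/2) *\<^sub>R br y u''"] norm_triangle_ineq[of "y - x" u'']
          by linarith
      qed
      ultimately have "dist y' x < \<delta> + \<delta> * (L - 1)" using y by linarith
      then show ?thesis using \<delta>(4) by (simp add: algebra_simps)
    qed
    have "\<delta> * 1 \<le> \<delta> * L" using \<delta>0 M K(1) by (intro mult_left_mono) (auto simp: L_def)
    then have t_de: "\<bar>t\<bar> < de" using t_le nu \<delta>(4) by linarith
    have mult: "gmul br y u = y' + t *\<^sub>R lfield br e y'"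
    proof -
      have b1: "br u'' e = br u' e" by (simp add: u''_def br.diff_left br.scaleR_left)
      have b2: "br y u'' = br y u'" by (simp add: u''_def br.diff_right br.scaleR_right)
      have b3: "br y u = br y u' + t *\<^sub>R br y e" by (simp add: u'_def br.diff_right br.scaleR_right)
      have lf: "lfield br e y' = e + (1/2) *\<^sub>R (br y e + br u' e)"
        by (simp add: y'_def gmul_def lfield_def br.add_left br.scaleR_left b1)
      have "y' + t *\<^sub>R lfield br e y' = y + (u' + t *\<^sub>R e) + (1/2) *\<^sub>R br y u"
        unfolding lf b3 unfolding y'_def gmul_def b2 unfolding u''_def
        by (simp add: scaleR_add_right scaleR_diff_right)
      then show ?thesis by (simp add: gmul_def u'_def)
    qed
    have 1: "\<bar>f (gmul br y u) - f y' - t * c e\<bar> \<le> \<epsilon>' * \<bar>t\<bar>" unfolding mult by (rule de(2)[OF y' t_de])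
    have 2: "\<bar>f y' - f y - (\<Sum>b\<in>A. (u'' \<bullet> b) * c b)\<bar> \<le> \<epsilon>' * norm u''"
      unfolding y'_def by (rule dA(2)[OF yA u'' u''A])
    \<comment> \<open>Apart from the component along \<open>e\<close>, which the vectors of
      \<open>A\<close> do not see, \<open>u''\<close> differs from \<open>u\<close> by half a
      bracket, of second order in |u|.\<close>
    have 3: "\<bar>(\<Sum>b\<in>A. (u'' \<bullet> b) * c b) - (\<Sum>b\<in>A. (u \<bullet> b) * c b)\<bar> \<le> K * (norm u)\<^sup>2 * C"
    proof -
      have "(u'' \<bullet> b) * c b - (u \<bullet> b) * c b = - ((((t / 2) *\<^sub>R br u' e) \<bullet> b) * c b)" if "b \<in> A" for b
        using eA[OF that] by (simp add: u''_def u'_def inner_diff_left algebra_simps)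
      then have "(\<Sum>b\<in>A. (u'' \<bullet> b) * c b) - (\<Sum>b\<in>A. (u \<bullet> b) * c b) = - (\<Sum>b\<in>A. (((t / 2) *\<^sub>R br u' e) \<bullet> b) * c b)"
        unfolding sum_subtractf[symmetric] sum_negf[symmetric] by (intro sum.cong) auto
      moreover have "\<bar>\<Sum>b\<in>A. (((t / 2) *\<^sub>R br u' e) \<bullet> b) * c b\<bar> \<le> (\<Sum>b\<in>A. K * (norm u)\<^sup>2 * \<bar>c b\<bar>)"
      proof (rule order_trans[OF sum_abs sum_mono])
        fix b assume "b \<in> A"
        then have "norm b = 1" using A(2) norm_frame[of b] by blast
        have "\<bar>((t / 2) *\<^sub>R br u' e) \<bullet> b\<bar> \<le> norm ((t / 2) *\<^sub>R br u' e) * norm b"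
          by (rule Cauchy_Schwarz_ineq2)
        also have "\<dots> = norm ((t / 2) *\<^sub>R br u' e)" by (simp only: \<open>norm b = 1\<close> mult_1_right)
        also note half
        finally have "\<bar>((t / 2) *\<^sub>R br u' e) \<bullet> b\<bar> \<le> K * (norm u)\<^sup>2" .
        then show "\<bar>(((t / 2) *\<^sub>R br u' e) \<bullet> b) * c b\<bar> \<le> K * (norm u)\<^sup>2 * \<bar>c b\<bar>"
          unfolding abs_mult by (rule mult_right_mono) simp
      qed
      ultimately show ?thesis by (simp add: C_def sum_distrib_left)
    qed
    have 4: "K * (norm u)\<^sup>2 * C \<le> \<epsilon> / 2 * norm u"
    proof -
      have "K * C * norm u \<le> (K * C + 1) * \<delta>" using nu KC K(1) C by (intro mult_mono) auto
      also have "\<dots> \<le> \<epsilon> / 2" using \<delta>(2) by (simp add: algebra_simps)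
      finally have "(K * C * norm u) * norm u \<le> \<epsilon> / 2 * norm u" by (rule mult_right_mono) simp
      then show ?thesis by (simp add: power2_eq_square mult_ac)
    qed
    have 5: "\<epsilon>' * \<bar>t\<bar> + \<epsilon>' * norm u'' \<le> \<epsilon> / 2 * norm u"
    proof -
      have "\<epsilon>' * \<bar>t\<bar> + \<epsilon>' * norm u'' \<le> \<epsilon>' * norm u + \<epsilon>' * (M * norm u)"
        using t_le nu'' \<epsilon>' by (intro add_mono mult_left_mono) auto
      also have "\<dots> = \<epsilon>' * (1 + M) * norm u" by (simp add: algebra_simps)
      also have "\<epsilon>' * (1 + M) = \<epsilon> / 2" using M by (simp add: \<epsilon>'_def field_simps)
      finally show ?thesis .
    qed
    have 6: "(\<Sum>b\<in>insert e A. (u \<bullet> b) * c b) = t * c e + (\<Sum>b\<in>A. (u \<bullet> b) * c b)"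
      unfolding sum.insert[OF A(1,3)] t_def by (rule refl)
    have 7: "\<bar>a - a'' - (s + w)\<bar> \<le> h + h" 
      if "\<bar>a - a' - s\<bar> \<le> e1" "\<bar>a' - a'' - z\<bar> \<le> e2" "\<bar>z - w\<bar> \<le> e3" "e3 \<le> h" "e1 + e2 \<le> h"
      for a a' a'' s w z e1 e2 e3 h :: real
    proof -
      have "a - a'' - (s + w) = (a - a' - s) + (a' - a'' - z) + (z - w)" by simp
      also have "\<bar>\<dots>\<bar> \<le> e1 + e2 + e3" using that(1-3) abs_triangle_ineq[of "(a - a' - s) + (a' - a'' - z)" "z - w"]
          abs_triangle_ineq[of "a - a' - s" "a' - a'' - z"] by linarith
      finally show ?thesis using that(4,5) by linarith
    qed
    have "\<bar>f (gmul br y u) - f y - (\<Sum>b\<in>insert e A. (u \<bullet> b) * c b)\<bar> \<le> \<epsilon> / 2 * norm u + \<epsilon> / 2 * norm u"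
      unfolding 6 by (rule 7[OF 1 2 3 4 5])
    also have "\<dots> = \<epsilon> * norm u" by simp
    finally show "\<bar>f (gmul br y u) - f y - (\<Sum>b\<in>insert e A. (u \<bullet> b) * c b)\<bar> \<le> \<epsilon> * norm u" .
  qed
qed

text \<open>The order matters: vertical vectors are adjoined first, and once all of \<open>V\<close>
  is spanned the brackets created by horizontal vectors stay in the span.\<close>

lemma frame_differentiable_frame:
  assumes "\<And>b. b \<in> E \<union> F \<Longrightarrow> strict_deriv_along f (lfield br b) (c b) x"
  shows "frame_differentiable f c x (E \<union> F)"
proof -
  have "finite A \<Longrightarrow> A \<subseteq> F \<Longrightarrow> frame_differentiable f c x A" for A
  proof (induction A rule: finite_induct)
    case empty
    show ?case unfolding frame_differentiable_def gmul_def
      by (auto intro!: exI[of _ 1] simp: br.zero_right)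
  next
    case (insert b A)
    then show ?case using assms F_subset by (intro frame_differentiable_insert) (auto simp del: lfield_V)
  qed
  then have fF: "frame_differentiable f c x F" using finite_F by blast
  have "finite A \<Longrightarrow> A \<subseteq> E \<Longrightarrow> frame_differentiable f c x (A \<union> F)" for A
  proof (induction A rule: finite_induct)
    case empty
    show ?case using fF by simp
  next
    case (insert b A)
    have "V \<subseteq> span (A \<union> F)" using F span_mono[of F "A \<union> F"] by (auto simp: orthonormal_basis_def)
    then show ?case using insert assms finite_F E_F_disjoint
      by (subst Un_insert_left, intro frame_differentiable_insert) (auto simp del: lfield_V)
  qed
  then show ?thesis using finite_E by blast
qed

lemma horizontal_C2_imp_C1_on:
  assumes U: "open U" and f: "horizontal_C2 U f"
  shows "C1_on U f"
proof -
  have "\<exists>c. continuous_on U c \<and> (\<forall>x\<in>U. strict_deriv_along f (lfield br b) (c x) x)" if b: "b \<in> E \<union> F" for b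
  proof (cases "b \<in> E")
    case True
    have "strict_deriv_along f (lfield br b) (lderiv br b f x) x" if "x \<in> U" for x
      using f True that U by (intro strict_deriv_alongI ldifferentiable_has_derivative) (auto simp: horizontal_C2_def)
    then show ?thesis using f True by (auto simp: horizontal_C2_def)
  next
    case False
    then have "b \<in> V" using b F_subset by auto
    then show ?thesis using vertical_strict_deriv[OF U f, of b] by simp
  qed
  then obtain c where c: "\<And>b. b \<in> E \<union> F \<Longrightarrow> continuous_on U (c b)"
    "\<And>b x. b \<in> E \<union> F \<Longrightarrow> x \<in> U \<Longrightarrow> strict_deriv_along f (lfield br b) (c b x) x" by metis
  \<comment> \<open>The increment h from \<open>x\<close> is right multiplication by u = h -
    (1/2)[x, h], since [x, [x, h]] = 0; inserting this u converts the group derivative into the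
    Euclidean one.\<close>
  let ?D = "\<lambda>x h. \<Sum>b\<in>E \<union> F. ((h - (1/2) *\<^sub>R br x h) \<bullet> b) * c b x"
  show ?thesis
  proof (rule C1_onI)
    show "continuous_on U (\<lambda>x. ?D x h)" for h
      using c(1) by (intro continuous_intros br.continuous_on) auto
    fix x assume x: "x \<in> U"
    have fd: "frame_differentiable f (\<lambda>b. c b x) x (E \<union> F)"
      by (rule frame_differentiable_frame) (use c(2) x in auto)
    have sp: "u \<in> span (E \<union> F)" for u
      by (subst frame_expansion[of u]) (intro span_sum span_scale span_base)
    obtain K where K: "K > 0" "\<And>a b. norm (br a b) \<le> norm a * norm b * K" using br.pos_bounded by blast
    define C where "C = 1 + norm x * K"
    have C: "C > 0" using K(1) by (simp add: C_def add_pos_nonneg)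
    have nu: "norm (h - (1/2) *\<^sub>R br x h) \<le> C * norm h" for h
    proof -
      have "norm (h - (1/2) *\<^sub>R br x h) \<le> norm h + norm ((1/2) *\<^sub>R br x h)" by (rule norm_triangle_ineq4)
      also have "\<dots> \<le> norm h + norm (br x h)" by simp
      also have "\<dots> \<le> norm h + norm x * norm h * K" using K(2) by simp
      finally show ?thesis by (simp add: C_def algebra_simps)
    qed
    show "(f has_derivative ?D x) (at x)"
      unfolding has_derivative_at_alt
    proof (intro conjI allI impI)
      show "bounded_linear (?D x)"
        by (intro bounded_linear_sum bounded_linear_mult_const bounded_linear_inner_left_comp bounded_linear_sub
            bounded_linear_ident bounded_linear_compose[OF bounded_linear_scaleR_right br.bounded_linear_right])
      fix \<epsilon> :: real assume "\<epsilon> > 0"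
      then have "\<epsilon> / C > 0" using C by simp
      then obtain d where d0: "d > 0" "\<And>y u. dist y x < d \<Longrightarrow> u \<in> span (E \<union> F) \<Longrightarrow> norm u < d \<Longrightarrow>
          \<bar>f (gmul br y u) - f y - (\<Sum>b\<in>E \<union> F. (u \<bullet> b) * c b x)\<bar> \<le> \<epsilon> / C * norm u"
        using fd[unfolded frame_differentiable_def, rule_format, of "\<epsilon> / C"] by blast
      have d: "d > 0" "\<And>u. norm u < d \<Longrightarrow>
          \<bar>f (gmul br x u) - f x - (\<Sum>b\<in>E \<union> F. (u \<bullet> b) * c b x)\<bar> \<le> \<epsilon> / C * norm u"
        using d0(1) d0(2)[OF _ sp, of x] by simp_all
      show "\<exists>\<delta>>0. \<forall>y. norm (y - x) < \<delta> \<longrightarrow> norm (f y - f x - ?D x (y - x)) \<le> \<epsilon> * norm (y - x)"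
      proof (intro exI[of _ "d / C"] conjI allI impI)
        fix y assume y: "norm (y - x) < d / C"
        let ?u = "(y - x) - (1/2) *\<^sub>R br x (y - x)"
        have "norm ?u \<le> C * norm (y - x)" by (rule nu)
        also have "\<dots> < d" using y C by (simp add: pos_less_divide_eq mult.commute)
        finally have "\<bar>f (gmul br x ?u) - f x - ?D x (y - x)\<bar> \<le> \<epsilon> / C * norm ?u" by (rule d(2))
        moreover have "gmul br x ?u = y" by (simp add: gmul_def br.diff_right br.scaleR_right)
        moreover have "\<epsilon> / C * norm ?u \<le> \<epsilon> / C * (C * norm (y - x))"
          using nu \<open>\<epsilon> / C > 0\<close> by (intro mult_left_mono) auto
        ultimately show "norm (f y - f x - ?D x (y - x)) \<le> \<epsilon> * norm (y - x)" using C by simp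
      qed (use d(1) C in simp)
    qed
  qed
qed

end

section \<open>Boundary layers\<close>

text \<open>With q the square of the positive part, which is of class C1, the step is q(t - 1) /
  (q(t - 1) + q(2 - t)). The denominator never vanishes, as t > 1 or t < 2.\<close>

lemma C1_step_function:
  obtains h h' :: "real \<Rightarrow> real" where "\<And>t. (h has_real_derivative h' t) (at t)" "continuous_on UNIV h'"
    "\<And>t. 0 \<le> h' t" "\<And>t. t \<le> 1 \<Longrightarrow> h t = 0" "\<And>t. 2 \<le> t \<Longrightarrow> h t = 1" "\<And>t. t \<ge> 2 \<Longrightarrow> h' t = 0"
    "\<And>t. 0 \<le> h t" "\<And>t. h t \<le> 1"
proof -
  define q where "q t = (max 0 t)\<^sup>2" for t :: real
  define q' where "q' t = 2 * max 0 t" for t :: real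
  have q: "(q has_real_derivative q' t) (at t)" for t
  proof -
    consider "t > 0" | "t < 0" | "t = 0" by linarith
    then show ?thesis
    proof cases
      case 1
      have "((\<lambda>t. t\<^sup>2) has_real_derivative q' t) (at t)"
        using 1 by (auto intro!: derivative_eq_intros simp: q'_def)
      then show ?thesis
        by (rule has_field_derivative_transform_within_open[of _ _ _ "{0<..}"]) (use 1 in \<open>auto simp: q_def\<close>)
    next
      case 2
      have "((\<lambda>t. 0) has_real_derivative q' t) (at t)" using 2 by (simp add: q'_def)
      then show ?thesis
        by (rule has_field_derivative_transform_within_open[of _ _ _ "{..<0}"]) (use 2 in \<open>auto simp: q_def\<close>)
    next
      case 3
      have "((\<lambda>t::real. max 0 t * max 0 t / t) \<longlongrightarrow> 0) (at 0)"
      proof (rule Lim_null_comparison)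
        show "\<forall>\<^sub>F t in at 0. norm (max 0 t * max 0 t / t) \<le> \<bar>t::real\<bar>"
          by (rule always_eventually) (auto simp: max_def)
        show "((\<lambda>t::real. \<bar>t\<bar>) \<longlongrightarrow> 0) (at 0)" by (auto intro!: tendsto_eq_intros)
      qed
      then show ?thesis using 3 by (simp add: has_field_derivative_iff q_def q'_def power2_eq_square)
    qed
  qed
  define s where "s t = q (t - 1) + q (2 - t)" for t
  have pos: "s t > 0" for t
    unfolding s_def q_def by (cases "t > 1") (auto intro: add_pos_nonneg add_nonneg_pos simp: max_def)
  define h where "h t = q (t - 1) / s t" for t
  define h' where "h' t = (q' (t - 1) * q (2 - t) + q (t - 1) * q' (2 - t)) / (s t * s t)" for t
  have d1: "((\<lambda>t. q (t - 1)) has_real_derivative q' (t - 1)) (at t)" for t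
    using DERIV_chain2[OF q DERIV_diff[OF DERIV_ident DERIV_const[of 1]]] by simp
  have d2: "((\<lambda>t. q (2 - t)) has_real_derivative - q' (2 - t)) (at t)" for t
    using DERIV_chain2[OF q DERIV_diff[OF DERIV_const[of 2] DERIV_ident]] by simp
  have ds: "(s has_real_derivative (q' (t - 1) + - q' (2 - t))) (at t)" for t
    unfolding s_def by (rule DERIV_add[OF d1 d2])
  have dh: "(h has_real_derivative h' t) (at t)" for t
  proof -
    have "(h has_real_derivative (q' (t - 1) * s t - q (t - 1) * (q' (t - 1) + - q' (2 - t))) / (s t * s t)) (at t)"
      unfolding h_def using pos[of t] by (intro DERIV_divide d1 ds) auto
    then show ?thesis by (rule DERIV_cong) (simp add: h'_def s_def algebra_simps)
  qed
  have cq: "continuous_on UNIV q'" unfolding q'_def by (intro continuous_intros)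
  have cqq: "continuous_on UNIV q" unfolding q_def by (intro continuous_intros)
  show ?thesis
  proof (rule that[OF dh])
    show "continuous_on UNIV h'"
      unfolding h'_def s_def
      by (intro continuous_intros continuous_on_compose2[OF cq] continuous_on_compose2[OF cqq])
        (use pos in \<open>auto simp: s_def less_imp_neq[THEN not_sym]\<close>)
    show "0 \<le> h' t" for t unfolding h'_def q'_def q_def by (intro divide_nonneg_nonneg add_nonneg_nonneg mult_nonneg_nonneg) (use pos[of t] in auto)
    show "h t = 0" if "t \<le> 1" for t using that by (simp add: h_def q_def)
    show "h t = 1" if "2 \<le> t" for t using that by (simp add: h_def s_def q_def)
    show "h' t = 0" if "2 \<le> t" for t using that by (simp add: h'_def q'_def q_def)
    show "0 \<le> h t" "h t \<le> 1" for t using pos[of t] by (auto simp: h_def s_def q_def field_simps)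
  qed
qed

text \<open>The points violating the inequality form an open set of measure zero, hence the empty
  set.\<close>

lemma AE_open_imp_all:
  fixes u :: "'g::euclidean_space \<Rightarrow> real"
  assumes "open U" "continuous_on U u" and ae: "AE x in lborel. x \<in> U \<longrightarrow> u x \<le> t"
  shows "\<forall>x\<in>U. u x \<le> t"
proof -
  have o: "open {x \<in> U. u x > t}"
    using continuous_open_preimage[OF assms(2,1) open_greaterThan[of t]] by (simp add: vimage_def Int_def)
  have "AE x in lborel. x \<notin> {x \<in> U. u x > t}" using ae by eventually_elim auto
  then have "{x \<in> U. u x > t} \<in> null_sets lborel"
    by (subst AE_iff_null_sets) (use o in auto)
  then have "negligible {x \<in> U. u x > t}" by (simp add: negligible_iff_null_sets null_sets_completionI)
  then have "{x \<in> U. u x > t} = {}" using open_not_negligible[OF o] by blast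
  then show ?thesis by (auto simp: not_less)
qed

context heisenberg_frame
begin

lemma fderiv_frame:
  assumes "C1_on U u" "x \<in> U"
  shows "fderiv u x v = (\<Sum>b\<in>E \<union> F. ((v - (1/2) *\<^sub>R br x v) \<bullet> b) * lderiv br b u x)"
proof -
  interpret D: linear "fderiv u x" by (rule C1_on_linear[OF assms])
  \<comment> \<open>This inverts \<open>w \<mapsto> lfield br w x\<close>, because iterated brackets
    vanish.\<close>
  let ?w = "v - (1/2) *\<^sub>R br x v"
  have "lfield br ?w x = v" by (simp add: lfield_def br.diff_right br.scaleR_right)
  moreover have "lfield br ?w x = (\<Sum>b\<in>E \<union> F. (?w \<bullet> b) *\<^sub>R lfield br b x)"
  proof -
    have "linear (\<lambda>w. lfield br w x)"
      unfolding lfield_def by (rule linearI) (simp_all add: br.add_right br.scaleR_right algebra_simps)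
    then interpret L: linear "\<lambda>w. lfield br w x" .
    have "lfield br (\<Sum>b\<in>E \<union> F. (?w \<bullet> b) *\<^sub>R b) x = (\<Sum>b\<in>E \<union> F. (?w \<bullet> b) *\<^sub>R lfield br b x)"
      by (simp only: L.sum L.scale)
    then show ?thesis by (simp only: frame_expansion[symmetric])
  qed
  ultimately have "fderiv u x v = fderiv u x (\<Sum>b\<in>E \<union> F. (?w \<bullet> b) *\<^sub>R lfield br b x)" by simp
  then show ?thesis by (simp add: D.sum D.scale C1_on_lderiv[OF assms])
qed

lemma inner_frame: "x \<bullet> y = (\<Sum>b\<in>E \<union> F. (x \<bullet> b) * (y \<bullet> b))"
  by (subst frame_expansion[of y]) (simp add: inner_sum_right mult.commute)

lemma lgrad_frame_inner: "b \<in> E \<union> F \<Longrightarrow> lgrad br (E \<union> F) u x \<bullet> b = lderiv br b u x"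
  unfolding lgrad_def inner_sum_left
  using finite_E finite_F frame_orthonormal
  by (subst sum.cong[OF refl, of "E \<union> F" _ "\<lambda>d. if d = b then lderiv br b u x else 0"]) auto

lemma lgrad_E_eq: "lgrad br E u x = oproj E (lgrad br (E \<union> F) u x)"
  unfolding oproj_def by (subst lgrad_def) (simp add: lgrad_frame_inner)

text \<open>No derivative falls on |z|^p. By its homogeneity and the Jacobian, the integral of |z|^p
  against \<open>u (dil s x)\<close> is exactly exp (-(Q + p) s) times its value at s = 0, and both
  expressions are differentiated at 0.\<close>

lemma integral_norm_powr_dil_gen:
  assumes p: "p > 0" and u: "u \<in> C1c UNIV"
  shows "(LINT x|lborel. norm (oproj E x) powr p * fderiv u x (dil_gen x)) =
    - (Q + p) * (LINT x|lborel. norm (oproj E x) powr p * u x)"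
proof -
  let ?k = "\<lambda>x. norm (oproj E x) powr p"
  have k: "continuous_on UNIV ?k" by (intro continuous_on_norm_powr[OF p] continuous_intros)
  obtain K where K: "C1_on UNIV u" "compact K" "\<And>x. x \<notin> K \<Longrightarrow> u x = 0" using C1cE[OF u] by metis
  have "(LINT x|lborel. ?k x * u (dil s x)) = exp (- (Q + p) * s) * (LINT x|lborel. ?k x * u x)" for s
  proof -
    have "?k x * u (dil s x) = exp (- p * s) * (?k (dil s x) * u (dil s x))" for x
    proof -
      have "?k (dil s x) = exp (p * s) * ?k x"
        by (simp add: oproj_dil powr_mult exp_powr_real mult.commute[of p s])
      moreover have "exp (- p * s) * exp (p * s) = 1" by (simp add: exp_minus)
      ultimately show ?thesis by (simp add: mult.assoc[symmetric])
    qed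
    then have "(LINT x|lborel. ?k x * u (dil s x)) = exp (- p * s) * (LINT x|lborel. ?k (dil s x) * u (dil s x))"
      by (simp only: integral_mult_right_zero)
    also have "(LINT x|lborel. ?k (dil s x) * u (dil s x)) = exp (- Q * s) * (LINT x|lborel. ?k x * u x)"
      by (rule integral_dil[where u="\<lambda>x. ?k x * u x", OF _ K(2)])
        (use K(3) k C1_on_imp_continuous_on[OF K(1)] in \<open>auto intro: continuous_on_mult\<close>)
    also have "exp (- p * s) * (exp (- Q * s) * (LINT x|lborel. ?k x * u x)) =
        exp (- p * s + - Q * s) * (LINT x|lborel. ?k x * u x)" by (simp only: exp_add mult.assoc)
    also have "- p * s + - Q * s = - (Q + p) * s" by (simp add: algebra_simps)
    finally show ?thesis .
  qed
  then have "((\<lambda>s. exp (- (Q + p) * s) * (LINT x|lborel. ?k x * u x)) has_real_derivative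
      (LINT x|lborel. ?k x * fderiv u x (dil_gen x))) (at 0)"
    using has_real_derivative_integral_dil[OF u k] by simp
  moreover have "((\<lambda>s. exp (- (Q + p) * s) * (LINT x|lborel. ?k x * u x)) has_real_derivative
      - (Q + p) * (LINT x|lborel. ?k x * u x)) (at 0)"
    by (auto intro!: derivative_eq_intros)
  ultimately show ?thesis by (rule DERIV_unique)
qed

lemma E_nonempty: "E \<noteq> {}"
proof
  assume "E = {}"
  then have "V = {0}" using V_eq_span_brackets by simp
  then have "F = {}" using F_subset norm_frame by force
  then have "x = 0" for x :: 'g using frame_expansion[of x] \<open>E = {}\<close> by simp
  then show False using nonempty_Basis nonzero_Basis by blast
qed

end

text \<open>The problem rewritten with classical gradients and pointwise conditions.
  \<open>G\<close> is the continuous extension of the full gradient. \<open>energy\<close>, the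
  equation tested with \<open>f\<close>, stands apart from \<open>weak\<close> because
  \<open>f\<close> itself need not have compact support in \<Omega>.\<close>

locale classical_overdetermined = heisenberg_frame br H V E F
  for br :: "'g::euclidean_space \<Rightarrow> 'g \<Rightarrow> 'g" and H V E F +
  fixes \<Omega> :: "'g set" and f :: "'g \<Rightarrow> real" and p c :: real and G :: "'g \<Rightarrow> 'g"
  assumes p: "1 < p" and open_\<Omega>: "open \<Omega>" and bounded_\<Omega>: "bounded \<Omega>" and nonempty: "\<Omega> \<noteq> {}"
    and C1f: "C1_on \<Omega> f" and f_nonneg: "\<And>x. x \<in> \<Omega> \<Longrightarrow> 0 \<le> f x" and bounded_f: "bounded (f ` \<Omega>)"
    and c: "0 \<le> c"
    and G: "continuous_on (closure \<Omega>) G" "\<And>x. x \<in> \<Omega> \<Longrightarrow> G x = lgrad br (E \<union> F) f x"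
      "\<And>x. x \<in> frontier \<Omega> \<Longrightarrow> G x \<noteq> 0"
    and boundary: "\<And>\<epsilon>. \<epsilon> > 0 \<Longrightarrow> \<exists>W. open W \<and> frontier \<Omega> \<subseteq> W \<and>
      (\<forall>x\<in>\<Omega> \<inter> W. \<bar>norm (lgrad br E f x) - c * norm (oproj E x)\<bar> \<le> \<epsilon> \<and> f x \<le> \<epsilon>)"
    and weak: "\<And>w. w \<in> C1c \<Omega> \<Longrightarrow>
      (LINT x|lborel. norm (lgrad br E f x) powr (p - 2) * (lgrad br E f x \<bullet> lgrad br E w x)) =
      (LINT x|lborel. norm (oproj E x) powr p * w x)"
    and energy: "(LINT x:\<Omega>|lborel. norm (lgrad br E f x) powr p) = (LINT x:\<Omega>|lborel. norm (oproj E x) powr p * f x)"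
begin

definition a :: "'g \<Rightarrow> 'g" where "a = lgrad br E f"
definition Zf :: "'g \<Rightarrow> real" where "Zf x = fderiv f x (dil_gen x)"
definition k :: "'g \<Rightarrow> real" where "k x = norm (oproj E x) powr p"

lemma compact_closure_\<Omega>: "compact (closure \<Omega>)"
  using bounded_\<Omega> by (simp add: compact_closure)

lemma closure_\<Omega>: "closure \<Omega> = \<Omega> \<union> frontier \<Omega>" "\<Omega> \<inter> frontier \<Omega> = {}"
  using open_\<Omega> closure_subset[of \<Omega>] by (auto simp: frontier_def interior_open)

lemma compact_minus_neighbourhood:
  assumes "open W" "frontier \<Omega> \<subseteq> W"
  shows "compact (closure \<Omega> - W)" "closure \<Omega> - W \<subseteq> \<Omega>"
  using assms closure_\<Omega> compact_diff[OF compact_closure_\<Omega> assms(1)] by auto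

lemma a_eq: "x \<in> \<Omega> \<Longrightarrow> a x = oproj E (G x)"
  by (simp add: a_def lgrad_E_eq G(2))

lemma fderiv_f_eq:
  assumes "x \<in> \<Omega>"
  shows "fderiv f x v = (v - (1/2) *\<^sub>R br x v) \<bullet> G x"
  unfolding fderiv_frame[OF C1f assms] using assms
  by (subst inner_frame) (simp add: G(2) lgrad_frame_inner)

lemma Zf_eq: "x \<in> \<Omega> \<Longrightarrow> Zf x = (dil_gen x - (1/2) *\<^sub>R br x (dil_gen x)) \<bullet> G x"
  by (simp add: Zf_def fderiv_f_eq)

lemma continuous_a: "continuous_on \<Omega> a" and continuous_Zf: "continuous_on \<Omega> Zf"
  and continuous_k: "continuous_on U k" and continuous_f: "continuous_on \<Omega> f"
proof -
  show "continuous_on \<Omega> a" unfolding a_def by (rule continuous_on_lgrad[OF C1f])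
  show "continuous_on \<Omega> Zf" unfolding Zf_def
    by (rule C1_on_continuous_fderiv[OF C1f continuous_dil_gen])
  show "continuous_on U k" unfolding k_def
    using p by (intro continuous_on_norm_powr continuous_intros) auto
  show "continuous_on \<Omega> f" by (rule C1_on_imp_continuous_on[OF C1f])
qed

text \<open>\<open>a\<close> and \<open>Zf\<close> are defined through derivatives inside \<Omega>,
  but both are continuous expressions in \<open>G\<close>, which lives on the compact
  closure.\<close>

lemma bounds:
  obtains B where "B > 0" "\<And>x. x \<in> \<Omega> \<Longrightarrow> norm (a x) \<le> B" "\<And>x. x \<in> \<Omega> \<Longrightarrow> \<bar>Zf x\<bar> \<le> B"
    "\<And>x. x \<in> \<Omega> \<Longrightarrow> k x \<le> B" "\<And>x. x \<in> \<Omega> \<Longrightarrow> f x \<le> B" "\<And>x. x \<in> \<Omega> \<Longrightarrow> norm (oproj E x) \<le> B"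
proof -
  have bdd: "\<exists>B. \<forall>x\<in>closure \<Omega>. norm (v x) \<le> B" if "continuous_on (closure \<Omega>) v" for v :: "'g \<Rightarrow> 'b::real_normed_vector"
    using compact_imp_bounded[OF compact_continuous_image[OF that compact_closure_\<Omega>]] by (auto simp: bounded_iff)
  obtain B1 where B1: "\<And>x. x \<in> closure \<Omega> \<Longrightarrow> norm (oproj E (G x)) \<le> B1"
    using bdd[of "\<lambda>x. oproj E (G x)"] G(1) by (auto intro: continuous_intros)
  have "continuous_on (closure \<Omega>) (\<lambda>x. (dil_gen x - (1/2) *\<^sub>R br x (dil_gen x)) \<bullet> G x)"
    by (intro continuous_intros br.continuous_on continuous_dil_gen G(1))
  from bdd[OF this] obtain B2 where
    B2: "\<And>x. x \<in> closure \<Omega> \<Longrightarrow> norm ((dil_gen x - (1/2) *\<^sub>R br x (dil_gen x)) \<bullet> G x) \<le> B2" by blast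
  obtain B3 where B3: "\<And>x. x \<in> closure \<Omega> \<Longrightarrow> norm (k x) \<le> B3" using bdd[OF continuous_k] by auto
  obtain B4 where B4: "\<And>x. x \<in> \<Omega> \<Longrightarrow> norm (f x) \<le> B4" using bounded_f by (auto simp: bounded_iff)
  obtain B5 where B5: "\<And>x. x \<in> closure \<Omega> \<Longrightarrow> norm (oproj E x) \<le> B5"
    using bdd[of "oproj E"] continuous_oproj[OF continuous_on_id, of "closure \<Omega>" E] by auto
  define B where "B = \<bar>B1\<bar> + \<bar>B2\<bar> + \<bar>B3\<bar> + \<bar>B4\<bar> + \<bar>B5\<bar> + 1"
  note cl = subsetD[OF closure_subset]
  show ?thesis
  proof (rule that[of B])
    show "B > 0" by (simp add: B_def)
    fix x assume x: "x \<in> \<Omega>"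
    show "norm (a x) \<le> B" using B1[OF cl[OF x]] by (simp add: a_eq[OF x] B_def)
    show "\<bar>Zf x\<bar> \<le> B" using B2[OF cl[OF x]] by (simp add: Zf_eq[OF x] B_def)
    show "k x \<le> B" using B3[OF cl[OF x]] by (simp add: B_def)
    show "f x \<le> B" using B4[OF x] by (simp add: B_def)
    show "norm (oproj E x) \<le> B" using B5[OF cl[OF x]] by (simp add: B_def)
  qed
qed

text \<open>The bounds confine |grad f| and c|z| to one interval, and the p-th power is uniformly
  continuous there.\<close>

lemma boundary_uniform:
  assumes "\<eta> > 0"
  obtains W where "open W" "frontier \<Omega> \<subseteq> W" "\<And>x. x \<in> \<Omega> \<inter> W \<Longrightarrow> \<bar>norm (a x) powr p - c powr p * k x\<bar> \<le> \<eta>"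
proof -
  obtain B where B: "B > 0" "\<And>x. x \<in> \<Omega> \<Longrightarrow> norm (a x) \<le> B" "\<And>x. x \<in> \<Omega> \<Longrightarrow> norm (oproj E x) \<le> B"
    using bounds by metis
  define R where "R = max B (c * B)"
  have "continuous_on {0..R} (\<lambda>t. t powr p)" using p by (intro continuous_on_powr' continuous_intros) auto
  then have "uniformly_continuous_on {0..R} (\<lambda>t. t powr p)" by (rule compact_uniformly_continuous) simp
  then obtain d where d: "d > 0" "\<And>s t. s \<in> {0..R} \<Longrightarrow> t \<in> {0..R} \<Longrightarrow> dist t s < d \<Longrightarrow> dist (t powr p) (s powr p) < \<eta>"
    unfolding uniformly_continuous_on_def using assms by metis
  obtain W where W: "open W" "frontier \<Omega> \<subseteq> W"
    "\<And>x. x \<in> \<Omega> \<inter> W \<Longrightarrow> \<bar>norm (lgrad br E f x) - c * norm (oproj E x)\<bar> \<le> d / 2"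
    using boundary[of "d / 2"] d(1) by (metis half_gt_zero)
  show ?thesis
  proof (rule that[OF W(1,2)])
    fix x assume x: "x \<in> \<Omega> \<inter> W"
    have "c * norm (oproj E x) \<le> c * B" using B(3) x c by (intro mult_left_mono) auto
    then have "c * norm (oproj E x) \<in> {0..R}" using c by (simp add: R_def)
    moreover have "norm (a x) \<in> {0..R}" using B(2)[of x] x by (simp add: R_def)
    moreover have "dist (norm (a x)) (c * norm (oproj E x)) < d"
      using W(3)[OF x] d(1) by (simp add: a_def dist_real_def)
    ultimately have "dist (norm (a x) powr p) ((c * norm (oproj E x)) powr p) < \<eta>" by (rule d(2))
    then show "\<bar>norm (a x) powr p - c powr p * k x\<bar> \<le> \<eta>"
      using c by (simp add: dist_real_def powr_mult k_def)
  qed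
qed

text \<open>A zero of the nonnegative \<open>f\<close> is an interior minimum, so every derivative
  vanishes there and \<open>G x\<close> would be 0.\<close>

lemma f_pos:
  assumes "x \<in> \<Omega>" "G x \<noteq> 0"
  shows "f x > 0"
proof (rule ccontr)
  assume "\<not> f x > 0"
  then have "f x = 0" using f_nonneg[OF assms(1)] by simp
  then have "fderiv f x = (\<lambda>v. 0)"
    using f_nonneg assms(1)
    by (intro differential_zero_maxmin[OF assms(1) open_\<Omega> C1_on_has_derivative[OF C1f assms(1)]]) auto
  then have "(v - (1/2) *\<^sub>R br x v) \<bullet> G x = 0" for v using fderiv_f_eq[OF assms(1), of v] by simp
  \<comment> \<open>For this direction the frame coefficients are exactly those of
    \<open>G x\<close>.\<close>
  from this[of "lfield br (G x) x"] have "G x \<bullet> G x = 0"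
    by (simp add: lfield_def br.add_right br.scaleR_right)
  then show False using assms(2) by simp
qed

end

context classical_overdetermined
begin

text \<open>Only \<open>f \<ge> 0\<close> is known in the interior. The cutoff \<open>w\<close> makes \<open>f + w\<close> positive there without
  changing \<open>f\<close> near the boundary, which avoids the strong maximum principle.\<close>

lemma transversal_field:
  obtains \<delta> y w S where "\<delta> > 0" "\<And>b. C1_on UNIV (\<lambda>x. y x \<bullet> b)" "C1_on UNIV w" "\<And>x. 0 \<le> w x" "\<And>x. w x \<le> 1"
    "compact S" "S \<subseteq> \<Omega>" "\<And>x. x \<notin> S \<Longrightarrow> w x = 0"
    "\<And>x. x \<in> \<Omega> \<Longrightarrow> x \<notin> S \<Longrightarrow> \<delta> \<le> y x \<bullet> G x" "\<And>x. x \<in> \<Omega> \<Longrightarrow> f x + w x > 0"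
proof -
  have cf: "compact (frontier \<Omega>)" using bounded_\<Omega> by (simp add: compact_frontier_bounded)
  have sub: "frontier \<Omega> \<subseteq> closure \<Omega>" by (simp add: frontier_def)
  have "\<exists>m>0. \<forall>x\<in>frontier \<Omega>. m \<le> norm (G x)"
  proof (cases "frontier \<Omega> = {}")
    case True
    then show ?thesis by (intro exI[of _ 1]) auto
  next
    case False
    have "continuous_on (frontier \<Omega>) (\<lambda>x. norm (G x))"
      by (intro continuous_intros continuous_on_subset[OF G(1) sub])
    from continuous_attains_inf[OF cf False this] obtain x0 where
      "x0 \<in> frontier \<Omega>" "\<forall>x\<in>frontier \<Omega>. norm (G x0) \<le> norm (G x)" by blast
    then show ?thesis using G(3) by (intro exI[of _ "norm (G x0)"]) auto
  qed
  then obtain m where m: "m > 0" "\<And>x. x \<in> frontier \<Omega> \<Longrightarrow> m \<le> norm (G x)" by blast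
  \<comment> \<open>As |G| is at least m on the frontier, the set where it is at most m/2 is compact
    inside \<Omega>.\<close>
  define K where "K = {x \<in> closure \<Omega>. norm (G x) \<le> m / 2}"
  have "closed K" unfolding K_def
    using G(1) by (intro continuous_on_closed_Collect_le continuous_intros) auto
  then have K: "compact K" using compact_Int_closed[OF compact_closure_\<Omega>, of K] by (simp add: K_def Int_def conj_commute)
  have K\<Omega>: "K \<subseteq> \<Omega>"
  proof
    fix x assume "x \<in> K"
    then have "x \<in> closure \<Omega>" "x \<notin> frontier \<Omega>" using m by (force simp: K_def)+
    then show "x \<in> \<Omega>" using closure_\<Omega>(1) by auto
  qed
  obtain w W where w: "w \<in> test_functions \<Omega>" "\<And>x. 0 \<le> w x" "\<And>x. w x \<le> 1" "open W" "K \<subseteq> W" "\<And>x. x \<in> W \<Longrightarrow> w x = 1"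
    using smooth_cutoff[OF K open_\<Omega> K\<Omega>] by blast
  define S where "S = closure {x. w x \<noteq> 0}"
  have S: "compact S" "S \<subseteq> \<Omega>" "\<And>x. x \<notin> S \<Longrightarrow> w x = 0"
    using w(1) closure_subset[of "{x. w x \<noteq> 0}"] by (auto simp: test_functions_def S_def)
  \<comment> \<open>\<open>G\<close> itself would be transversal but is only continuous; a
    polynomial field close to it can be integrated by parts.\<close>
  obtain y where y: "polynomial_function y" "\<And>x. x \<in> closure \<Omega> \<Longrightarrow> norm (G x - y x) < m / 4"
    using Stone_Weierstrass_polynomial_function[OF compact_closure_\<Omega> G(1), of "m / 4"] m(1) by auto
  have KS: "K \<subseteq> S"
  proof
    fix x assume "x \<in> K"
    then have "w x = 1" using w(5,6) by auto
    then show "x \<in> S" using S(3)[of x] by auto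
  qed
  \<comment> \<open>Off \<open>K\<close> one has |G| > m/2 and |y - G| < m/4, and |G| (|G| - m/4) is
    at least (m/2)(m/4).\<close>
  have trans: "m\<^sup>2 / 8 \<le> y x \<bullet> G x" if x: "x \<in> \<Omega>" "x \<notin> K" for x
  proof -
    have xc: "x \<in> closure \<Omega>" using x(1) closure_subset by blast
    then have nG: "norm (G x) > m / 2" using x(2) by (simp add: K_def)
    have "(y x - G x) \<bullet> G x \<ge> - (norm (y x - G x) * norm (G x))"
      using Cauchy_Schwarz_ineq2[of "y x - G x" "G x"] by linarith
    moreover have "norm (y x - G x) * norm (G x) \<le> m / 4 * norm (G x)"
      using y(2)[OF xc] by (intro mult_right_mono) (auto simp: norm_minus_commute)
    moreover have "y x \<bullet> G x = (norm (G x))\<^sup>2 + (y x - G x) \<bullet> G x"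
      by (simp add: inner_diff_left dot_square_norm)
    moreover have "norm (G x) * (norm (G x) - m / 4) = (norm (G x))\<^sup>2 - m / 4 * norm (G x)"
      unfolding power2_eq_square right_diff_distrib by (simp only: mult.commute)
    ultimately have "norm (G x) * (norm (G x) - m / 4) \<le> y x \<bullet> G x" by linarith
    moreover have "(m / 2) * (m / 4) \<le> norm (G x) * (norm (G x) - m / 4)"
      using nG m(1) by (intro mult_mono) auto
    ultimately show ?thesis by (simp add: power2_eq_square)
  qed
  show ?thesis
  proof (rule that[of "m\<^sup>2 / 8" y w S])
    show "0 < m\<^sup>2 / 8" using m(1) by simp
    show "C1_on UNIV (\<lambda>x. y x \<bullet> b)" for b
    proof (rule C1_on_real_polynomial_function)
      show "real_polynomial_function (\<lambda>x. y x \<bullet> b)"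
        using y(1) bounded_linear_inner_left[of b] unfolding polynomial_function_def by (auto simp: o_def)
    qed
    show "C1_on UNIV w" by (rule C1c_C1_on[OF test_functions_C1c[OF w(1)]])
    show "m\<^sup>2 / 8 \<le> y x \<bullet> G x" if "x \<in> \<Omega>" "x \<notin> S" for x using trans that KS by blast
    show "f x + w x > 0" if x: "x \<in> \<Omega>" for x
    proof (cases "x \<in> K")
      case True
      then have "w x = 1" using w(5,6) by auto
      then show ?thesis using f_nonneg[OF x] by simp
    next
      case False
      then have "G x \<noteq> 0" using trans[OF x] m(1) by force
      then show ?thesis using f_pos[OF x] w(2)[of x] by simp
    qed
  qed (use w S in auto)
qed

lemma integrable_closure_continuous:
  assumes "continuous_on UNIV (u :: 'g \<Rightarrow> real)"
  shows "integrable lborel (\<lambda>x. indicator (closure \<Omega>) x * u x)"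
  using borel_integrable_compact[OF compact_closure_\<Omega> continuous_on_subset[OF assms]] by simp

text \<open>For g = f + w0 the cutoff is h(g/\<epsilon>) with density h'(g/\<epsilon>)/\<epsilon>,
  so the layer lies between the levels \<epsilon> and 2\<epsilon> of \<open>g\<close>. On compact
  parts of \<Omega> the positive \<open>g\<close> has a positive minimum; hence the cutoffs tend to
  1 and the layers enter every neighbourhood of the frontier.\<close>

lemma boundary_layers:
  obtains w \<kappa> :: "nat \<Rightarrow> 'g \<Rightarrow> real" and r :: "nat \<Rightarrow> real" and C :: real where
    "\<And>n. w n \<in> C1c \<Omega>" "\<And>n x. 0 \<le> w n x" "\<And>n x. w n x \<le> 1"
    "\<And>n x. 0 \<le> \<kappa> n x" "\<And>n x. x \<notin> \<Omega> \<Longrightarrow> \<kappa> n x = 0" 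
    "\<And>n x v. x \<in> \<Omega> \<Longrightarrow> fderiv (w n) x v = \<kappa> n x * fderiv f x v"
    "\<And>n. \<exists>K. compact K \<and> K \<subseteq> \<Omega> \<and> continuous_on K (\<kappa> n) \<and> (\<forall>x. x \<notin> K \<longrightarrow> \<kappa> n x = 0)"
    "\<And>n. (LINT x|lborel. \<kappa> n x) \<le> C"
    "\<And>n x. \<kappa> n x \<noteq> 0 \<Longrightarrow> f x \<le> r n" "r \<longlonglongrightarrow> 0"
    "\<And>W. open W \<Longrightarrow> frontier \<Omega> \<subseteq> W \<Longrightarrow> eventually (\<lambda>n. \<forall>x. \<kappa> n x \<noteq> 0 \<longrightarrow> x \<in> W) sequentially"
    "\<And>x. x \<in> \<Omega> \<Longrightarrow> (\<lambda>n. w n x) \<longlonglongrightarrow> 1"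
proof -
  obtain \<delta> y w0 S where \<delta>: "\<delta> > 0" and y: "\<And>b. C1_on UNIV (\<lambda>x. y x \<bullet> b)"
    and w0: "C1_on UNIV w0" "\<And>x. 0 \<le> w0 x" "\<And>x. w0 x \<le> 1"
    and S: "compact S" "S \<subseteq> \<Omega>" "\<And>x. x \<notin> S \<Longrightarrow> w0 x = 0"
    and trans: "\<And>x. x \<in> \<Omega> \<Longrightarrow> x \<notin> S \<Longrightarrow> \<delta> \<le> y x \<bullet> G x" and pos: "\<And>x. x \<in> \<Omega> \<Longrightarrow> f x + w0 x > 0"
    by (rule transversal_field) (rule that)
  define g where "g x = f x + w0 x" for x
  have C1g: "C1_on \<Omega> g" unfolding g_def by (rule C1_on_add[OF C1f C1_on_subset[OF w0(1) subset_UNIV]])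
  have cg: "continuous_on \<Omega> g" by (rule C1_on_imp_continuous_on[OF C1g])
  obtain h h' :: "real \<Rightarrow> real" where h: "\<And>t. (h has_real_derivative h' t) (at t)" "continuous_on UNIV h'"
    "\<And>t. 0 \<le> h' t" "\<And>t. t \<le> 1 \<Longrightarrow> h t = 0" "\<And>t. 2 \<le> t \<Longrightarrow> h t = 1" "\<And>t. t \<ge> 2 \<Longrightarrow> h' t = 0"
    "\<And>t. 0 \<le> h t" "\<And>t. h t \<le> 1"
    by (rule C1_step_function) (rule that)
  have h'1: "h' t = 0" if "t < 1" for t
  proof -
    have "(h has_real_derivative 0) (at t)"
    proof (rule has_field_derivative_transform_within_open[of "\<lambda>_. 0" _ _ "{..<1}"])
      show "((\<lambda>_. 0) has_real_derivative 0) (at t)" by simp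
    qed (use that h(4) in auto)
    then show ?thesis using DERIV_unique[OF h(1)] by blast
  qed
  have g_min: "\<exists>\<mu>>0. \<forall>x\<in>K. \<mu> \<le> g x" if K: "compact K" "K \<subseteq> \<Omega>" for K
  proof (cases "K = {}")
    case False
    from continuous_attains_inf[OF K(1) False continuous_on_subset[OF cg K(2)]] obtain x0 where
      "x0 \<in> K" "\<forall>x\<in>K. g x0 \<le> g x" by blast
    then show ?thesis using pos[of x0] K(2) by (intro exI[of _ "g x0"]) (auto simp: g_def)
  qed (auto intro: exI[of _ 1])
  obtain \<mu> where \<mu>: "\<mu> > 0" "\<And>x. x \<in> S \<Longrightarrow> \<mu> \<le> g x" using g_min[OF S(1,2)] by blast
  \<comment> \<open>Since 2 \<epsilon> n is at most \<mu>, the layers miss \<open>S\<close>, the set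
    off which \<open>w0\<close> vanishes; on the layers \<open>g\<close> is locally
    \<open>f\<close>.\<close>
  define \<epsilon> where "\<epsilon> n = \<mu> / (2 * Suc n)" for n
  have \<epsilon>: "\<epsilon> n > 0" "2 * \<epsilon> n \<le> \<mu>" for n
    using \<mu>(1) by (simp_all add: \<epsilon>_def field_simps)
  have \<epsilon>0: "\<epsilon> \<longlonglongrightarrow> 0"
  proof -
    have "(\<lambda>n. (\<mu> / 2) / Suc n) \<longlonglongrightarrow> 0" by (rule LIMSEQ_Suc[OF lim_const_over_n])
    then show ?thesis by (simp add: \<epsilon>_def[abs_def])
  qed
  define w where "w n x = (if x \<in> \<Omega> then h (g x / \<epsilon> n) else 0)" for n x
  define \<kappa> where "\<kappa> n x = (if x \<in> \<Omega> then h' (g x / \<epsilon> n) / \<epsilon> n else 0)" for n x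
  \<comment> \<open>Near the frontier \<open>f\<close> is at most half of \<epsilon> n, and off
    \<open>S\<close> it equals \<open>g\<close>; so the cutoff is zero outside a compact subset of
    \<Omega>.\<close>
  have "\<exists>K. compact K \<and> K \<subseteq> \<Omega> \<and> (\<forall>x\<in>\<Omega>. x \<notin> K \<longrightarrow> g x < \<epsilon> n)" for n
  proof -
    obtain W where W: "open W" "frontier \<Omega> \<subseteq> W" "\<And>x. x \<in> \<Omega> \<inter> W \<Longrightarrow> f x \<le> \<epsilon> n / 2"
      using boundary[of "\<epsilon> n / 2"] \<epsilon>(1)[of n] by (metis half_gt_zero)
    note cW = compact_minus_neighbourhood[OF W(1,2)]
    show ?thesis
    proof (intro exI[of _ "S \<union> (closure \<Omega> - W)"] conjI ballI impI)
      fix x assume x: "x \<in> \<Omega>" "x \<notin> S \<union> (closure \<Omega> - W)"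
      then have "x \<in> \<Omega> \<inter> W" using closure_subset by blast
      then show "g x < \<epsilon> n" using W(3) S(3)[of x] x(2) \<epsilon>(1)[of n] by (force simp: g_def)
    qed (use S cW in auto)
  qed
  then obtain K where K: "\<And>n. compact (K n)" "\<And>n. K n \<subseteq> \<Omega>" "\<And>n x. x \<in> \<Omega> \<Longrightarrow> x \<notin> K n \<Longrightarrow> g x < \<epsilon> n"
    by metis
  have wK: "w n x = 0" "\<kappa> n x = 0" if "x \<notin> K n" for n x
  proof -
    have "g x / \<epsilon> n < 1" if "x \<in> \<Omega>" using K(3)[OF that \<open>x \<notin> K n\<close>] \<epsilon>(1)[of n] by simp
    then show "w n x = 0" "\<kappa> n x = 0" using h(4) h'1 by (auto simp: w_def \<kappa>_def)
  qed
  have hd: "((\<lambda>t. h (t / \<epsilon> n)) has_real_derivative h' (t / \<epsilon> n) / \<epsilon> n) (at t)" for n t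
    using DERIV_chain2[OF h(1) DERIV_cdivide[OF DERIV_ident, of "\<epsilon> n"]] by simp
  have chd: "continuous_on UNIV (\<lambda>t. h' (t / \<epsilon> n) / \<epsilon> n)" for n
    using \<epsilon>(1)[of n] by (intro continuous_intros continuous_on_compose2[OF h(2)]) auto
  have wC1: "C1_on \<Omega> (w n)" for n
    by (rule C1_on_cong[OF C1_on_compose_real[OF C1g hd chd] open_\<Omega>]) (simp add: w_def)
  have wC: "w n \<in> C1c \<Omega>" for n
  proof (rule C1cI[OF _ K(1,2)])
    have "C1_on (- K n) (w n)"
      by (rule C1_on_cong[of _ "\<lambda>_. 0"]) (use K(1)[of n] wK in \<open>auto simp: compact_imp_closed open_Compl\<close>)
    then have "C1_on (\<Omega> \<union> - K n) (w n)"
      using K(1)[of n] by (intro C1_on_Un wC1 open_\<Omega>) (auto simp: compact_imp_closed open_Compl)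
    moreover have "\<Omega> \<union> - K n = UNIV" using K(2) by auto
    ultimately show "C1_on UNIV (w n)" by simp
  qed (rule wK)
  have \<kappa>0: "x \<in> \<Omega> \<and> g x < 2 * \<epsilon> n \<and> x \<notin> S" if "\<kappa> n x \<noteq> 0" for n x
  proof -
    have x: "x \<in> \<Omega>" using that by (auto simp: \<kappa>_def split: if_splits)
    have "g x / \<epsilon> n < 2" using that h(6)[of "g x / \<epsilon> n"] by (auto simp: \<kappa>_def split: if_splits simp: not_less[symmetric])
    then have "g x < 2 * \<epsilon> n" using \<epsilon>(1)[of n] by (simp add: field_simps)
    moreover have "x \<notin> S" using calculation \<mu>(2)[of x] \<epsilon>(2)[of n] by auto
    ultimately show ?thesis using x by simp
  qed
  have fd: "fderiv (w n) x v = \<kappa> n x * fderiv f x v" if x: "x \<in> \<Omega>" for n x v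
  proof -
    have "fderiv (w n) x v = \<kappa> n x * fderiv g x v"
    proof -
      have "fderiv (w n) x = fderiv (\<lambda>x. h (g x / \<epsilon> n)) x"
        by (rule fderiv_cong[OF open_\<Omega> x]) (simp add: w_def)
      then show ?thesis using fderiv_compose_real[OF C1g hd chd x] x by (simp add: \<kappa>_def)
    qed
    moreover have "fderiv g x v = fderiv f x v" if "\<kappa> n x \<noteq> 0"
    proof -
      have "fderiv g x = fderiv f x"
        by (rule fderiv_cong[of "- S"]) (use \<kappa>0[OF that] S in \<open>auto simp: g_def compact_imp_closed open_Compl\<close>)
      then show ?thesis by simp
    qed
    ultimately show ?thesis by (cases "\<kappa> n x = 0") auto
  qed
  have c\<kappa>: "continuous_on \<Omega> (\<kappa> n)" for n
    by (rule continuous_on_eq[OF continuous_on_compose2[OF chd[of n] cg]]) (auto simp: \<kappa>_def)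
  have i\<kappa>: "integrable lborel (\<kappa> n)" for n
    by (rule integrable_compact_support[OF K(1) continuous_on_subset[OF c\<kappa> K(2)] wK(2)])
  let ?div = "\<lambda>x. \<Sum>b\<in>E \<union> F. lderiv br b (\<lambda>x. y x \<bullet> b) x"
  define C where "C = (LINT x|lborel. indicator (closure \<Omega>) x * \<bar>?div x\<bar>) / \<delta>"
  have cdiv: "continuous_on UNIV ?div" by (intro continuous_intros continuous_on_lderiv y)
  \<comment> \<open>Transversality bounds \<delta> times the mass by the integral of Y w, where Y
    has frame coefficients \<open>y\<close>. Left-invariant fields being divergence free, this
    equals minus the integral of \<open>?div\<close> times \<open>w\<close>, bounded independently
    of \<open>n\<close> as \<open>w\<close> lies between 0 and 1.\<close>
  have le_C: "(LINT x|lborel. \<kappa> n x) \<le> C" for n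
  proof -
    have wU: "w n \<in> C1c UNIV" by (rule C1c_mono[OF wC]) simp
    have C1w: "C1_on UNIV (w n)" by (rule C1c_C1_on[OF wC])
    have cy: "continuous_on U (\<lambda>x. y x \<bullet> b)" for b U
      using C1_on_imp_continuous_on[OF y] continuous_on_subset by blast
    have i1: "integrable lborel (\<lambda>x. (y x \<bullet> b) * lderiv br b (w n) x)" for b
      using integrable_C1c_fderiv_mult[OF wU cy continuous_lfield] by (simp add: C1_on_lderiv[OF C1w])
    have i2: "integrable lborel (\<lambda>x. lderiv br b (\<lambda>x. y x \<bullet> b) x * w n x)" for b
      by (rule integrable_C1c_mult[OF wU continuous_on_lderiv[OF y]])
    have eq: "\<kappa> n x * (y x \<bullet> G x) = (\<Sum>b\<in>E \<union> F. (y x \<bullet> b) * lderiv br b (w n) x)" for x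
    proof (cases "x \<in> \<Omega>")
      case True
      have "lderiv br b (w n) x = \<kappa> n x * (G x \<bullet> b)" if "b \<in> E \<union> F" for b
        using that True by (simp add: C1_on_lderiv[OF C1w] fd C1_on_lderiv[OF C1f, symmetric] G(2) lgrad_frame_inner)
      then have "(\<Sum>b\<in>E \<union> F. (y x \<bullet> b) * lderiv br b (w n) x) = (\<Sum>b\<in>E \<union> F. \<kappa> n x * ((y x \<bullet> b) * (G x \<bullet> b)))"
        by (intro sum.cong) auto
      also have "\<dots> = \<kappa> n x * (y x \<bullet> G x)" by (simp add: inner_frame[of "y x" "G x"] sum_distrib_left)
      finally show ?thesis by simp
    next
      case False
      then have "x \<notin> K n" using K(2) by auto
      then show ?thesis using lderiv_outside[OF wK(1) K(1)] wK(2) by simp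
    qed
    have i3: "integrable lborel (\<lambda>x. \<kappa> n x * (y x \<bullet> G x))"
      unfolding eq by (intro Bochner_Integration.integrable_sum i1)
    have "\<delta> * (LINT x|lborel. \<kappa> n x) = (LINT x|lborel. \<kappa> n x * \<delta>)" by simp
    also have "\<dots> \<le> (LINT x|lborel. \<kappa> n x * (y x \<bullet> G x))"
    proof (rule integral_mono)
      show "\<kappa> n x * \<delta> \<le> \<kappa> n x * (y x \<bullet> G x)" for x
      proof (cases "\<kappa> n x = 0")
        case False
        then have "\<delta> \<le> y x \<bullet> G x" using trans \<kappa>0 by blast
        moreover have "\<kappa> n x \<ge> 0" using h(3) \<epsilon>(1)[of n] by (simp add: \<kappa>_def)
        ultimately show ?thesis by (rule mult_left_mono)
      qed simp
    qed (use i\<kappa> i3 in auto)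
    also have "\<dots> = (\<Sum>b\<in>E \<union> F. LINT x|lborel. (y x \<bullet> b) * lderiv br b (w n) x)"
      unfolding eq using i1 by (simp add: Bochner_Integration.integral_sum)
    also have "\<dots> = (\<Sum>b\<in>E \<union> F. - (LINT x|lborel. lderiv br b (\<lambda>x. y x \<bullet> b) x * w n x))"
      by (intro sum.cong refl lderiv_integration_by_parts[OF y open_UNIV wU])
    also have "\<dots> = (LINT x|lborel. - (?div x * w n x))"
      using i2 by (simp add: sum_negf Bochner_Integration.integral_sum sum_distrib_right)
    also have "\<dots> \<le> (LINT x|lborel. indicator (closure \<Omega>) x * \<bar>?div x\<bar>)"
    proof (rule integral_mono)
      show "integrable lborel (\<lambda>x. - (?div x * w n x))"
        using i2 by (simp add: sum_distrib_right)
      show "integrable lborel (\<lambda>x. indicator (closure \<Omega>) x * \<bar>?div x\<bar>)"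
        by (intro integrable_closure_continuous continuous_intros cdiv)
      show "- (?div x * w n x) \<le> indicator (closure \<Omega>) x * \<bar>?div x\<bar>" for x
      proof (cases "x \<in> \<Omega>")
        case True
        have "\<bar>?div x * w n x\<bar> \<le> \<bar>?div x\<bar> * 1"
          unfolding abs_mult using h(7,8) by (intro mult_left_mono) (auto simp: w_def)
        then show ?thesis using True closure_subset[of \<Omega>] by (auto simp: indicator_def)
      qed (simp add: w_def)
    qed
    finally show ?thesis using \<delta> by (simp add: C_def field_simps)
  qed
  show ?thesis
  proof (rule that[of w \<kappa> C "\<lambda>n. 2 * \<epsilon> n"])
    show "w n \<in> C1c \<Omega>" for n by (rule wC)
    show "0 \<le> w n x" "w n x \<le> 1" for n x using h(7,8) by (auto simp: w_def)
    show "0 \<le> \<kappa> n x" for n x using h(3) \<epsilon>(1)[of n] by (simp add: \<kappa>_def)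
    show "\<kappa> n x = 0" if "x \<notin> \<Omega>" for n x using that by (simp add: \<kappa>_def)
    show "fderiv (w n) x v = \<kappa> n x * fderiv f x v" if "x \<in> \<Omega>" for n x v by (rule fd[OF that])
    show "\<exists>K. compact K \<and> K \<subseteq> \<Omega> \<and> continuous_on K (\<kappa> n) \<and> (\<forall>x. x \<notin> K \<longrightarrow> \<kappa> n x = 0)" for n
      using wK(2) by (intro exI[of _ "K n"] conjI K(1,2) continuous_on_subset[OF c\<kappa> K(2)]) blast
    show "(LINT x|lborel. \<kappa> n x) \<le> C" for n by (rule le_C)
    show "f x \<le> 2 * \<epsilon> n" if "\<kappa> n x \<noteq> 0" for n x
      using \<kappa>0[OF that] w0(2)[of x] by (simp add: g_def)
    show "(\<lambda>n. 2 * \<epsilon> n) \<longlonglongrightarrow> 0" using tendsto_mult_right_zero[OF \<epsilon>0, of 2] by simp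
    show "eventually (\<lambda>n. \<forall>x. \<kappa> n x \<noteq> 0 \<longrightarrow> x \<in> W) sequentially" if W: "open W" "frontier \<Omega> \<subseteq> W" for W
    proof -
      obtain \<nu> where \<nu>: "\<nu> > 0" "\<And>x. x \<in> closure \<Omega> - W \<Longrightarrow> \<nu> \<le> g x"
        using g_min[OF compact_minus_neighbourhood[OF W]] by blast
      have "eventually (\<lambda>n. \<epsilon> n < \<nu> / 2) sequentially"
        using order_tendstoD(2)[OF \<epsilon>0, of "\<nu> / 2"] \<nu>(1) by simp
      then show ?thesis
      proof eventually_elim
        case (elim n)
        show ?case
        proof (intro allI impI)
          fix x assume "\<kappa> n x \<noteq> 0"
          then have "x \<in> \<Omega>" "g x < \<nu>" using \<kappa>0[of n x] elim by auto
          then show "x \<in> W" using \<nu>(2)[of x] closure_subset[of \<Omega>] by force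
        qed
      qed
    qed
    show "(\<lambda>n. w n x) \<longlonglongrightarrow> 1" if x: "x \<in> \<Omega>" for x
    proof (rule tendsto_eventually)
      have "g x > 0" using pos[OF x] by (simp add: g_def)
      then have "eventually (\<lambda>n. \<epsilon> n < g x / 2) sequentially"
        using order_tendstoD(2)[OF \<epsilon>0, of "g x / 2"] by simp
      then show "eventually (\<lambda>n. w n x = 1) sequentially"
      proof eventually_elim
        case (elim n)
        then have "2 \<le> g x / \<epsilon> n" using \<epsilon>(1)[of n] by (simp add: field_simps)
        then show ?case using x h(5) by (simp add: w_def)
      qed
    qed
  qed
qed

end

section \<open>The integral identity\<close>

lemma tendsto_0_of_eventually_bound:
  fixes X :: "nat \<Rightarrow> real"
  assumes "D > 0" "\<And>\<eta>. \<eta> > 0 \<Longrightarrow> eventually (\<lambda>n. \<bar>X n\<bar> \<le> \<eta> * D) sequentially"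
  shows "X \<longlonglongrightarrow> 0"
proof (rule tendstoI)
  fix e :: real assume "e > 0"
  then have "e / (2 * D) > 0" using assms(1) by simp
  from assms(2)[OF this] show "eventually (\<lambda>n. dist (X n) 0 < e) sequentially"
  proof eventually_elim
    case (elim n)
    have "e / (2 * D) * D = e / 2" using assms(1) by simp
    then show ?case using elim \<open>e > 0\<close> by (simp add: dist_real_def)
  qed
qed

lemma C1c_outside:
  assumes "u \<in> C1c U" "x \<notin> U"
  shows "u x = 0" "fderiv u x v = 0"
proof -
  obtain K where "C1_on UNIV u" "compact K" "K \<subseteq> U" "\<And>x. x \<notin> K \<Longrightarrow> u x = 0" "\<And>x v. x \<notin> K \<Longrightarrow> fderiv u x v = 0"
    by (rule C1cE[OF assms(1)]) (rule that)
  then show "u x = 0" "fderiv u x v = 0" using assms(2) by auto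
qed

context classical_overdetermined
begin

lemma set_integrable_bounded:
  assumes "continuous_on \<Omega> v" "\<And>x. x \<in> \<Omega> \<Longrightarrow> \<bar>v x\<bar> \<le> (B::real)"
  shows "integrable lborel (\<lambda>x. indicator \<Omega> x * v x)"
proof (rule Bochner_Integration.integrable_bound)
  have "emeasure lborel \<Omega> < \<infinity>" by (rule emeasure_bounded_finite[OF bounded_\<Omega>])
  then show "integrable lborel (\<lambda>x. B * indicator \<Omega> x)"
    using open_\<Omega> by (intro integrable_mult_right integrable_real_indicator) auto
  show "(\<lambda>x. indicator \<Omega> x * v x) \<in> borel_measurable lborel"
    using borel_measurable_continuous_on_indicator[OF _ assms(1)] open_\<Omega> by simp
  show "AE x in lborel. norm (indicator \<Omega> x * v x) \<le> norm (B * indicator \<Omega> x)"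
    using order_trans[OF assms(2) abs_ge_self] by (intro AE_I2) (auto simp: indicator_def)
qed

lemma lgrad_cong:
  assumes "open U" "x \<in> U" "\<And>y. y \<in> U \<Longrightarrow> u y = v y" "C1_on U v"
  shows "lgrad br B u x = lgrad br B v x"
proof -
  have "C1_on U u" by (rule C1_on_cong[OF assms(4,1,3)])
  then have "lderiv br b u x = lderiv br b v x" for b
    using fderiv_cong[OF assms(1-3)] by (simp add: C1_on_lderiv[OF _ assms(2)] assms(4))
  then show ?thesis by (simp add: lgrad_def)
qed

text \<open>\<open>local_pohozaev\<close> needs a globally defined function with compact support, so
  \<open>f\<close> is multiplied by a cutoff that is 1 near the support of \<open>w\<close>. On that
  neighbourhood \<open>U\<close> no gradient changes and the equation persists for test functions
  supported in \<open>U\<close>.\<close>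

lemma layer_pohozaev:
  assumes w: "w \<in> C1c \<Omega>" "\<And>x. 0 \<le> w x"
    and \<kappa>: "\<And>x. x \<notin> \<Omega> \<Longrightarrow> \<kappa> x = 0" "\<And>x v. x \<in> \<Omega> \<Longrightarrow> fderiv w x v = \<kappa> x * fderiv f x v"
  shows "(p - 1) * (LINT x|lborel. norm (a x) powr p * Zf x * \<kappa> x) + (p - Q) * (LINT x|lborel. norm (a x) powr p * w x)
    = p * (LINT x|lborel. k x * Zf x * w x)"
proof -
  obtain K where K: "C1_on UNIV w" "compact K" "K \<subseteq> \<Omega>" "\<And>x. x \<notin> K \<Longrightarrow> w x = 0" "\<And>x v. x \<notin> K \<Longrightarrow> fderiv w x v = 0"
    by (rule C1cE[OF w(1)]) (rule that)
  obtain u W where u: "u \<in> test_functions \<Omega>" "\<And>x. 0 \<le> u x" "\<And>x. u x \<le> 1" "open W" "K \<subseteq> W"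
    "\<And>x. x \<in> W \<Longrightarrow> u x = 1"
    by (rule smooth_cutoff[OF K(2) open_\<Omega> K(3)]) (rule that)
  define U where "U = W \<inter> \<Omega>"
  have U: "open U" "K \<subseteq> U" "U \<subseteq> \<Omega>" using u(4,5) open_\<Omega> K(3) by (auto simp: U_def)
  define fl where "fl x = f x * u x" for x
  have FC: "fl \<in> C1c UNIV"
    unfolding fl_def by (rule C1c_mono[OF C1c_mult[OF C1f open_\<Omega> test_functions_C1c[OF u(1)]]]) simp
  have Ff: "fl x = f x" if "x \<in> U" for x using that u(6) by (auto simp: fl_def U_def)
  have C1fU: "C1_on U f" by (rule C1_on_subset[OF C1f U(3)])
  have gradF: "lgrad br E fl x = a x" if "x \<in> U" for x
    unfolding a_def by (rule lgrad_cong[OF U(1) that Ff C1fU])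
  have derF: "fderiv fl x (dil_gen x) = Zf x" if "x \<in> U" for x
    unfolding Zf_def using fderiv_cong[OF U(1) that Ff] by simp
  have gw0: "lgrad br E v x = 0" if "\<And>y. y \<notin> L \<Longrightarrow> v y = 0" "compact L" "x \<notin> L" for v x and L :: "'g set"
    using lgrad_outside[of L v x, OF that] .
  have weakF: "(LINT x|lborel. norm (lgrad br E fl x) powr (p - 2) * (lgrad br E fl x \<bullet> lgrad br E v x)) =
      (LINT x|lborel. k x * v x)" if v: "v \<in> C1c U" for v
  proof -
    obtain L where L: "compact L" "L \<subseteq> U" "\<And>x. x \<notin> L \<Longrightarrow> v x = 0" using C1cE[OF v] by metis
    have "norm (lgrad br E fl x) powr (p - 2) * (lgrad br E fl x \<bullet> lgrad br E v x) =
        norm (lgrad br E f x) powr (p - 2) * (lgrad br E f x \<bullet> lgrad br E v x)" for x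
    proof (cases "x \<in> L")
      case True
      then have "x \<in> U" using L(2) by blast
      then show ?thesis by (simp only: gradF a_def)
    qed (simp add: gw0[OF L(3,1)])
    then show ?thesis using weak[OF C1c_mono[OF v U(3)]] by (simp add: k_def)
  qed
  have wU: "w \<in> C1c U" by (rule C1cI[OF K(1,2) U(2) K(4)])
  have \<kappa>0: "\<kappa> x * Zf x = 0" if "x \<notin> K" for x
  proof (cases "x \<in> \<Omega>")
    case True
    then show ?thesis using \<kappa>(2)[OF True, of "dil_gen x"] K(5)[OF that] by (simp add: Zf_def)
  qed (simp add: \<kappa>(1))
  have der_w: "fderiv w x (dil_gen x) = \<kappa> x * Zf x" for x
    using K(3) K(5)[of x] \<kappa>0[of x] \<kappa>(2)[of x] by (cases "x \<in> K") (auto simp: Zf_def)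
  have grad_w: "lgrad br E w x = \<kappa> x *\<^sub>R a x" if "x \<in> \<Omega>" for x
    unfolding lgrad_def a_def
    by (simp add: C1_on_lderiv[OF K(1)] C1_on_lderiv[OF C1f that] \<kappa>(2)[OF that] scaleR_sum_right)
  \<comment> \<open>With the gradient of \<open>w\<close> equal to \<kappa> times that of
    \<open>f\<close>, this integrand agrees with the one of \<open>3\<close>; the coefficients p and
    -1 combine to p - 1.\<close>
  have 1: "(norm (lgrad br E fl x) powr (p - 2) * (lgrad br E fl x \<bullet> lgrad br E w x)) * fderiv fl x (dil_gen x) =
      norm (a x) powr p * Zf x * \<kappa> x" for x
  proof (cases "x \<in> K")
    case True
    then have x: "x \<in> U" "x \<in> \<Omega>" using U K(3) by auto
    have "(norm (lgrad br E fl x) powr (p - 2) * (lgrad br E fl x \<bullet> lgrad br E w x)) * fderiv fl x (dil_gen x) =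
        (norm (a x) powr (p - 2) * (a x \<bullet> a x)) * Zf x * \<kappa> x"
      by (simp add: gradF[OF x(1)] derF[OF x(1)] grad_w[OF x(2)])
    then show ?thesis by (simp only: norm_powr_inner_self)
  next
    case False
    then show ?thesis using \<kappa>0[OF False] lgrad_outside[of K w x E, OF K(4,2) False] by auto
  qed
  have 2: "norm (lgrad br E fl x) powr p * w x = norm (a x) powr p * w x" for x
    using gradF[of x] U(2) K(4)[of x] by (cases "x \<in> K") auto
  have 3: "norm (lgrad br E fl x) powr p * fderiv w x (dil_gen x) = norm (a x) powr p * Zf x * \<kappa> x" for x
    using gradF[of x] U(2) \<kappa>0[of x] by (cases "x \<in> K") (auto simp: der_w mult_ac)
  have 4: "(k x * w x) * fderiv fl x (dil_gen x) = k x * Zf x * w x" for x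
    using derF[of x] U(2) K(4)[of x] by (cases "x \<in> K") auto
  have "p * (LINT x|lborel. norm (a x) powr p * Zf x * \<kappa> x) + (p - Q) * (LINT x|lborel. norm (a x) powr p * w x)
      - (LINT x|lborel. norm (a x) powr p * Zf x * \<kappa> x) = p * (LINT x|lborel. k x * Zf x * w x)"
    using local_pohozaev[OF p FC U(1) continuous_k weakF wU w(2)] unfolding 1 2 3 4 .
  then show ?thesis by (simp add: algebra_simps)
qed

text \<open>Both come from \<open>integral_norm_powr_dil_gen\<close>, applied to \<open>w\<close>
  and to the product of \<open>f\<close> and \<open>w\<close>; the product rule in the second case
  produces the two terms on the left.\<close>

lemma layer_dilation:
  assumes w: "w \<in> C1c \<Omega>"
    and \<kappa>: "\<And>x. x \<notin> \<Omega> \<Longrightarrow> \<kappa> x = 0" "\<And>x v. x \<in> \<Omega> \<Longrightarrow> fderiv w x v = \<kappa> x * fderiv f x v"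
    and \<kappa>K: "\<exists>K. compact K \<and> K \<subseteq> \<Omega> \<and> continuous_on K \<kappa> \<and> (\<forall>x. x \<notin> K \<longrightarrow> \<kappa> x = 0)"
  shows "(LINT x|lborel. k x * Zf x * \<kappa> x) = - (Q + p) * (LINT x|lborel. k x * w x)"
    and "(LINT x|lborel. k x * Zf x * w x) + (LINT x|lborel. k x * f x * Zf x * \<kappa> x) = - (Q + p) * (LINT x|lborel. k x * f x * w x)"
proof -
  have p0: "p > 0" using p by simp
  have wU: "w \<in> C1c UNIV" by (rule C1c_mono[OF w]) simp
  note w0 = C1c_outside[OF w]
  have eq0: "k x * fderiv w x (dil_gen x) = k x * Zf x * \<kappa> x" for x
    using \<kappa>(1)[of x] \<kappa>(2)[of x] w0(2)[of x] by (cases "x \<in> \<Omega>") (auto simp: Zf_def)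
  show "(LINT x|lborel. k x * Zf x * \<kappa> x) = - (Q + p) * (LINT x|lborel. k x * w x)"
    using integral_norm_powr_dil_gen[OF p0 wU, folded k_def] unfolding eq0 .
  have fw: "(\<lambda>x. f x * w x) \<in> C1c \<Omega>" by (rule C1c_mult[OF C1f open_\<Omega> w])
  note fw0 = C1c_outside(2)[OF fw]
  have eq: "k x * fderiv (\<lambda>x. f x * w x) x (dil_gen x) = k x * Zf x * w x + k x * f x * Zf x * \<kappa> x" for x
  proof (cases "x \<in> \<Omega>")
    case True
    then show ?thesis
      by (simp add: fderiv_mult[OF C1f C1c_C1_on[OF w] True] \<kappa>(2)[OF True] Zf_def algebra_simps)
  qed (simp add: fw0 w0 \<kappa>(1))
  obtain K where K: "compact K" "K \<subseteq> \<Omega>" "continuous_on K \<kappa>" "\<And>x. x \<notin> K \<Longrightarrow> \<kappa> x = 0" using \<kappa>K by blast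
  have i1: "integrable lborel (\<lambda>x. k x * Zf x * w x)"
    by (rule integrable_C1c_mult[OF w continuous_on_mult[OF continuous_k continuous_Zf]])
  have i2: "integrable lborel (\<lambda>x. k x * f x * Zf x * \<kappa> x)"
    by (rule integrable_compact_support[OF K(1)])
      (use K continuous_k continuous_Zf continuous_f in \<open>auto intro!: continuous_intros intro: continuous_on_subset\<close>)
  have "(LINT x|lborel. k x * Zf x * w x + k x * f x * Zf x * \<kappa> x) = - (Q + p) * (LINT x|lborel. k x * (f x * w x))"
    using integral_norm_powr_dil_gen[OF p0 C1c_mono[OF fw subset_UNIV], folded k_def] unfolding eq .
  then show "(LINT x|lborel. k x * Zf x * w x) + (LINT x|lborel. k x * f x * Zf x * \<kappa> x) = - (Q + p) * (LINT x|lborel. k x * f x * w x)"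
    using i1 i2 by (simp add: mult.assoc)
qed

lemma k_nonneg: "0 \<le> k x"
  by (simp add: k_def)

lemma continuous_norm_a_powr: "continuous_on \<Omega> (\<lambda>x. norm (a x) powr p)"
  using p by (intro continuous_on_norm_powr continuous_a) auto

definition I :: real where "I = (LINT x:\<Omega>|lborel. norm (a x) powr p)"
definition M :: real where "M = (LINT x:\<Omega>|lborel. k x)"

lemma I_eq: "I = (LINT x:\<Omega>|lborel. k x * f x)"
  using energy by (simp add: I_def a_def k_def)

lemma global_pohozaev: "(p - 1) * (Q + p) * c powr p * M = (p - Q + p * (Q + p)) * I"
proof -
  obtain w \<kappa> :: "nat \<Rightarrow> 'g \<Rightarrow> real" and r :: "nat \<Rightarrow> real" and C :: real where
    w: "\<And>n. w n \<in> C1c \<Omega>" "\<And>n x. 0 \<le> w n x" "\<And>n x. w n x \<le> 1"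
    and \<kappa>: "\<And>n x. 0 \<le> \<kappa> n x" "\<And>n x. x \<notin> \<Omega> \<Longrightarrow> \<kappa> n x = 0" 
    "\<And>n x v. x \<in> \<Omega> \<Longrightarrow> fderiv (w n) x v = \<kappa> n x * fderiv f x v"
    and \<kappa>K: "\<And>n. \<exists>K. compact K \<and> K \<subseteq> \<Omega> \<and> continuous_on K (\<kappa> n) \<and> (\<forall>x. x \<notin> K \<longrightarrow> \<kappa> n x = 0)"
    and C: "\<And>n. (LINT x|lborel. \<kappa> n x) \<le> C"
    and r: "\<And>n x. \<kappa> n x \<noteq> 0 \<Longrightarrow> f x \<le> r n" "r \<longlonglongrightarrow> 0"
    and near: "\<And>W. open W \<Longrightarrow> frontier \<Omega> \<subseteq> W \<Longrightarrow> eventually (\<lambda>n. \<forall>x. \<kappa> n x \<noteq> 0 \<longrightarrow> x \<in> W) sequentially"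
    and lim: "\<And>x. x \<in> \<Omega> \<Longrightarrow> (\<lambda>n. w n x) \<longlonglongrightarrow> 1"
    by (rule boundary_layers) (rule that)
  obtain B where B: "B > 0" "\<And>x. x \<in> \<Omega> \<Longrightarrow> norm (a x) \<le> B" "\<And>x. x \<in> \<Omega> \<Longrightarrow> \<bar>Zf x\<bar> \<le> B"
    "\<And>x. x \<in> \<Omega> \<Longrightarrow> k x \<le> B" "\<And>x. x \<in> \<Omega> \<Longrightarrow> f x \<le> B" using bounds by metis
  note w0 = C1c_outside(1)[OF w(1)]
  have int\<kappa>: "integrable lborel (\<lambda>x. v x * \<kappa> n x)" if "continuous_on \<Omega> v" for v :: "'g \<Rightarrow> real" and n
  proof -
    obtain K where K: "compact K" "K \<subseteq> \<Omega>" "continuous_on K (\<kappa> n)" "\<And>x. x \<notin> K \<Longrightarrow> \<kappa> n x = 0" using \<kappa>K by blast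
    show ?thesis
      by (rule integrable_compact_support[OF K(1)])
        (use K that in \<open>auto intro!: continuous_intros intro: continuous_on_subset\<close>)
  qed
  have lim_w: "(\<lambda>n. LINT x|lborel. v x * w n x) \<longlonglongrightarrow> (LINT x:\<Omega>|lborel. v x)"
    if v: "continuous_on \<Omega> v" "\<And>x. x \<in> \<Omega> \<Longrightarrow> \<bar>v x\<bar> \<le> b" for v and b :: real
  proof -
    have iv: "integrable lborel (\<lambda>x. indicator \<Omega> x * v x)" by (rule set_integrable_bounded[OF v])
    have "(\<lambda>n. LINT x|lborel. (indicator \<Omega> x * v x) * w n x) \<longlonglongrightarrow> (LINT x|lborel. indicator \<Omega> x * v x)"
    proof (rule integral_dominated_convergence[where w="\<lambda>x. norm (indicator \<Omega> x * v x)"])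
      show "(\<lambda>x. indicator \<Omega> x * v x * w n x) \<in> borel_measurable lborel" for n
        using borel_measurable_integrable[OF iv] borel_measurable_integrable[OF C1c_integrable[OF w(1)]] by simp
      show "AE x in lborel. (\<lambda>n. indicator \<Omega> x * v x * w n x) \<longlonglongrightarrow> indicator \<Omega> x * v x"
      proof (rule AE_I2)
        fix x
        show "(\<lambda>n. indicator \<Omega> x * v x * w n x) \<longlonglongrightarrow> indicator \<Omega> x * v x"
          using tendsto_mult_left[OF lim, of x "v x"] by (cases "x \<in> \<Omega>") auto
      qed
      show "AE x in lborel. norm (indicator \<Omega> x * v x * w n x) \<le> norm (indicator \<Omega> x * v x)" for n
        using w(2,3) by (intro AE_I2) (simp add: abs_mult mult_left_le)
    qed (use iv in auto)
    moreover have "(indicator \<Omega> x * v x) * w n x = v x * w n x" for n x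
      using w0[of x n] w0 by (cases "x \<in> \<Omega>") auto
    ultimately show ?thesis by (simp add: set_lebesgue_integral_def)
  qed
  define A where "A n = (LINT x|lborel. norm (a x) powr p * Zf x * \<kappa> n x)" for n
  define N where "N n = (LINT x|lborel. k x * Zf x * \<kappa> n x)" for n
  define R where "R n = (LINT x|lborel. k x * f x * Zf x * \<kappa> n x)" for n
  define J where "J n = (LINT x|lborel. k x * Zf x * w n x)" for n
  have eq1: "(p - 1) * A n + (p - Q) * (LINT x|lborel. norm (a x) powr p * w n x) = p * J n" for n
    unfolding A_def J_def by (rule layer_pohozaev[OF w(1,2) \<kappa>(2,3)])
  have eq2: "N n = - (Q + p) * (LINT x|lborel. k x * w n x)" for n
    unfolding N_def by (rule layer_dilation(1)[OF w(1) \<kappa>(2,3) \<kappa>K])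
  have eq3: "J n + R n = - (Q + p) * (LINT x|lborel. k x * f x * w n x)" for n
    unfolding J_def R_def by (rule layer_dilation(2)[OF w(1) \<kappa>(2,3) \<kappa>K])
  have i\<kappa>: "integrable lborel (\<kappa> n)" for n using int\<kappa>[of "\<lambda>_. 1" n] by simp
  \<comment> \<open>The bounded mass of the layers makes each layer integral at most the supremum of
    the weight on the layer times a fixed constant.\<close>
  have est: "\<bar>LINT x|lborel. v x * \<kappa> n x\<bar> \<le> b * \<bar>C\<bar>"
    if v: "continuous_on \<Omega> v" "\<And>x. \<kappa> n x \<noteq> 0 \<Longrightarrow> \<bar>v x\<bar> \<le> b" "b \<ge> 0" for v n b
  proof -
    have "\<bar>LINT x|lborel. v x * \<kappa> n x\<bar> \<le> (LINT x|lborel. \<bar>v x * \<kappa> n x\<bar>)" by (rule integral_abs_bound)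
    also have "\<dots> \<le> (LINT x|lborel. b * \<kappa> n x)"
    proof (rule integral_mono)
      show "\<bar>v x * \<kappa> n x\<bar> \<le> b * \<kappa> n x" for x
        using v(2)[of x] \<kappa>(1)[of n x] by (cases "\<kappa> n x = 0") (auto simp: abs_mult intro: mult_right_mono)
    qed (use int\<kappa>[OF v(1)] i\<kappa> in auto)
    also have "\<dots> = b * (LINT x|lborel. \<kappa> n x)" by simp
    also have "\<dots> \<le> b * \<bar>C\<bar>" using C[of n] v(3) by (intro mult_left_mono) auto
    finally show ?thesis .
  qed
  have \<kappa>\<Omega>: "x \<in> \<Omega>" if "\<kappa> n x \<noteq> 0" for n x using \<kappa>(2) that by blast
  \<comment> \<open>Here the Dirichlet condition enters: \<open>f\<close> is at most
    \<open>r n\<close> on the layer.\<close>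
  have R0: "R \<longlonglongrightarrow> 0"
  proof (rule Lim_null_comparison)
    show "(\<lambda>n. (B * \<bar>r n\<bar> * B) * \<bar>C\<bar>) \<longlonglongrightarrow> 0"
      using r(2) by (auto intro!: tendsto_eq_intros)
    show "eventually (\<lambda>n. norm (R n) \<le> (B * \<bar>r n\<bar> * B) * \<bar>C\<bar>) sequentially"
    proof (rule always_eventually, rule allI)
      fix n
      have "\<bar>LINT x|lborel. (k x * f x * Zf x) * \<kappa> n x\<bar> \<le> (B * \<bar>r n\<bar> * B) * \<bar>C\<bar>"
      proof (rule est)
        show "continuous_on \<Omega> (\<lambda>x. k x * f x * Zf x)"
          by (intro continuous_intros continuous_k continuous_f continuous_Zf)
        show "\<bar>k x * f x * Zf x\<bar> \<le> B * \<bar>r n\<bar> * B" if "\<kappa> n x \<noteq> 0" for x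
          unfolding abs_mult
          using B(3,4)[OF \<kappa>\<Omega>[OF that]] r(1)[OF that] f_nonneg[OF \<kappa>\<Omega>[OF that]] B(1) k_nonneg[of x]
          by (intro mult_mono) auto
      qed (use B(1) in auto)
      then show "norm (R n) \<le> (B * \<bar>r n\<bar> * B) * \<bar>C\<bar>" by (simp add: R_def)
    qed
  qed
  \<comment> \<open>Here the overdetermined condition enters, uniformly on the layers once these lie
    in \<open>W\<close>.\<close>
  have AN: "(\<lambda>n. A n - c powr p * N n) \<longlonglongrightarrow> 0"
  proof (rule tendsto_0_of_eventually_bound[of "B * (\<bar>C\<bar> + 1)"])
    show "B * (\<bar>C\<bar> + 1) > 0" using B(1) by simp
    fix \<eta> :: real assume "\<eta> > 0"
    obtain W where W: "open W" "frontier \<Omega> \<subseteq> W" "\<And>x. x \<in> \<Omega> \<inter> W \<Longrightarrow> \<bar>norm (a x) powr p - c powr p * k x\<bar> \<le> \<eta>"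
      using boundary_uniform[OF \<open>\<eta> > 0\<close>] by blast
    from near[OF W(1,2)] show "eventually (\<lambda>n. \<bar>A n - c powr p * N n\<bar> \<le> \<eta> * (B * (\<bar>C\<bar> + 1))) sequentially"
    proof eventually_elim
      case (elim n)
      have c1: "continuous_on \<Omega> (\<lambda>x. norm (a x) powr p * Zf x)" "continuous_on \<Omega> (\<lambda>x. k x * Zf x)"
        by (intro continuous_intros continuous_norm_a_powr continuous_Zf continuous_k)+
      have "A n - c powr p * N n = (LINT x|lborel. (norm (a x) powr p * Zf x) * \<kappa> n x - c powr p * ((k x * Zf x) * \<kappa> n x))"
        unfolding A_def N_def using int\<kappa>[OF c1(1)] int\<kappa>[OF c1(2)] by simp
      also have "\<dots> = (LINT x|lborel. ((norm (a x) powr p - c powr p * k x) * Zf x) * \<kappa> n x)"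
        by (simp add: algebra_simps)
      also have "\<bar>\<dots>\<bar> \<le> (\<eta> * B) * \<bar>C\<bar>"
      proof (rule est)
        show "continuous_on \<Omega> (\<lambda>x. (norm (a x) powr p - c powr p * k x) * Zf x)"
          by (intro continuous_intros continuous_norm_a_powr continuous_Zf continuous_k)
        show "\<bar>(norm (a x) powr p - c powr p * k x) * Zf x\<bar> \<le> \<eta> * B" if "\<kappa> n x \<noteq> 0" for x
          unfolding abs_mult using W(3)[of x] elim that \<kappa>\<Omega>[OF that] B(3)[OF \<kappa>\<Omega>[OF that]] \<open>\<eta> > 0\<close>
          by (intro mult_mono) auto
      qed (use B(1) \<open>\<eta> > 0\<close> in auto)
      also have "\<dots> \<le> \<eta> * (B * (\<bar>C\<bar> + 1))"
        using B(1) \<open>\<eta> > 0\<close> by (simp add: algebra_simps)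
      finally show ?case .
    qed
  qed
  have lim1: "(\<lambda>n. LINT x|lborel. norm (a x) powr p * w n x) \<longlonglongrightarrow> I"
    unfolding I_def
  proof (rule lim_w[OF continuous_norm_a_powr])
    show "\<bar>norm (a x) powr p\<bar> \<le> B powr p" if "x \<in> \<Omega>" for x
      using B(2)[OF that] p by (simp add: powr_mono2)
  qed
  have lim2: "(\<lambda>n. LINT x|lborel. k x * w n x) \<longlonglongrightarrow> M"
    unfolding M_def by (rule lim_w[OF continuous_k, of B]) (use B(4) k_nonneg in auto)
  have lim3: "(\<lambda>n. LINT x|lborel. k x * f x * w n x) \<longlonglongrightarrow> I"
    unfolding I_eq
  proof (rule lim_w)
    show "continuous_on \<Omega> (\<lambda>x. k x * f x)" by (intro continuous_intros continuous_k continuous_f)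
    show "\<bar>k x * f x\<bar> \<le> B * B" if "x \<in> \<Omega>" for x
      unfolding abs_mult using B(4,5)[OF that] k_nonneg[of x] f_nonneg[OF that] B(1) by (intro mult_mono) auto
  qed
  \<comment> \<open>This is \<open>eq1\<close> with \<open>N n\<close> and \<open>J n\<close>
    eliminated by \<open>eq2\<close> and \<open>eq3\<close>, so it is zero for every
    \<open>n\<close>. Neither \<open>A n\<close> nor \<open>J n\<close> appears alone, and each
    remaining piece has a known limit.\<close>
  have "(\<lambda>n. (p - 1) * ((A n - c powr p * N n) + c powr p * (- (Q + p) * (LINT x|lborel. k x * w n x)))
      + (p - Q) * (LINT x|lborel. norm (a x) powr p * w n x)
      - p * (- (Q + p) * (LINT x|lborel. k x * f x * w n x) - R n)) \<longlonglongrightarrow>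
      (p - 1) * (0 + c powr p * (- (Q + p) * M)) + (p - Q) * I - p * (- (Q + p) * I - 0)"
    by (intro tendsto_intros AN lim1 lim2 lim3 R0)
  moreover have "(p - 1) * ((A n - c powr p * N n) + c powr p * (- (Q + p) * (LINT x|lborel. k x * w n x)))
      + (p - Q) * (LINT x|lborel. norm (a x) powr p * w n x)
      - p * (- (Q + p) * (LINT x|lborel. k x * f x * w n x) - R n) = 0" for n
    unfolding eq2[symmetric] eq3[symmetric] using eq1[of n] by simp
  ultimately have "(p - 1) * (0 + c powr p * (- (Q + p) * M)) + (p - Q) * I - p * (- (Q + p) * I - 0) = 0"
    by (simp add: LIMSEQ_const_iff)
  then show ?thesis by (simp add: algebra_simps)
qed

text \<open>If I = 0 the horizontal gradient vanishes on \<Omega>, and the equation forces |z|^p to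
  vanish there as well. But \<Omega> is open and nonempty, and a small horizontal step changes
  z.\<close>

lemma I_nonzero: "I \<noteq> 0"
proof
  assume "I = 0"
  have zero: "v = 0" if "norm v powr p \<le> 0" for v :: 'g
    using that powr_gt_zero[of "norm v" p] by (cases "v = 0") auto
  have bnd: "\<exists>B. \<forall>x\<in>\<Omega>. \<bar>norm (a x) powr p\<bar> \<le> B"
  proof -
    obtain B where "\<And>x. x \<in> \<Omega> \<Longrightarrow> norm (a x) \<le> B" using bounds by metis
    then show ?thesis using p by (intro exI[of _ "B powr p"]) (auto intro: powr_mono2)
  qed
  have "integrable lborel (\<lambda>x. indicator \<Omega> x * norm (a x) powr p)"
    using bnd set_integrable_bounded[OF continuous_norm_a_powr] by blast
  then have "AE x in lborel. indicator \<Omega> x * norm (a x) powr p = 0"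
    using \<open>I = 0\<close> by (subst integral_nonneg_eq_0_iff_AE[symmetric]) (auto simp: I_def set_lebesgue_integral_def)
  then have "AE x in lborel. x \<in> \<Omega> \<longrightarrow> norm (a x) powr p \<le> 0" by eventually_elim auto
  from AE_open_imp_all[OF open_\<Omega> continuous_norm_a_powr this] have a0: "a x = 0" if "x \<in> \<Omega>" for x
    using that zero by blast
  have "AE x in lborel. x \<in> \<Omega> \<longrightarrow> k x = 0"
  proof (rule AE_zero_of_test_functions[OF open_\<Omega>])
    show "set_integrable lborel K k" if "compact K" "K \<subseteq> \<Omega>" for K
      unfolding set_integrable_def by (rule borel_integrable_compact[OF that(1) continuous_k])
    fix w assume w: "w \<in> test_functions \<Omega>"
    have wC: "w \<in> C1c \<Omega>" by (rule test_functions_C1c[OF w])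
    obtain K where K: "compact K" "K \<subseteq> \<Omega>" "\<And>x. x \<notin> K \<Longrightarrow> w x = 0" using C1cE[OF wC] by metis
    have z0: "norm (lgrad br E f x) powr (p - 2) * (lgrad br E f x \<bullet> lgrad br E w x) = 0" for x
      using a0[of x] K(2) lgrad_outside[of K w x, OF K(3,1)] by (cases "x \<in> K") (auto simp: a_def)
    have "(LINT x|lborel. k x * w x) = 0" using weak[OF wC] unfolding z0 k_def by simp
    then show "(LINT x:\<Omega>|lborel. k x * w x) = 0"
      using K by (subst set_lebesgue_integral_support) auto
  qed
  then have "AE x in lborel. x \<in> \<Omega> \<longrightarrow> k x \<le> 0" by eventually_elim auto
  from AE_open_imp_all[OF open_\<Omega> continuous_k this] have k0: "oproj E x = 0" if "x \<in> \<Omega>" for x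
    using that zero by (simp add: k_def)
  obtain x0 where x0: "x0 \<in> \<Omega>" using nonempty by blast
  obtain e where e: "e \<in> E" using E_nonempty by blast
  obtain \<delta> where \<delta>: "\<delta> > 0" "ball x0 \<delta> \<subseteq> \<Omega>" using open_\<Omega> x0 by (meson openE)
  have "norm e = 1" using norm_frame e by blast
  then have "x0 + (\<delta> / 2) *\<^sub>R e \<in> \<Omega>" using \<delta> by (intro subsetD[OF \<delta>(2)]) (simp add: dist_norm)
  then have "oproj E (x0 + (\<delta> / 2) *\<^sub>R e) = 0" by (rule k0)
  then have "(\<delta> / 2) *\<^sub>R e = 0" using k0[OF x0] E_subset[OF e] by (simp add: oproj_add oproj_scaleR)
  then show False using \<delta>(1) \<open>norm e = 1\<close> by auto
qed

text \<open>For c = 0 the left side of \<open>global_pohozaev\<close> is zero, whereas p - Q + p(Q +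
  p) = (p - 1) Q + p + p^2 is positive and I is nonzero.\<close>

lemma c_pos: "0 < c"
proof (rule ccontr)
  assume "\<not> 0 < c"
  then have "c = 0" using c by simp
  then have "(p - Q + p * (Q + p)) * I = 0" using global_pohozaev by simp
  moreover have "p - Q + p * (Q + p) > 0"
  proof -
    have "Q \<ge> 0" by (simp add: Q_def)
    then have "0 \<le> (p - 1) * Q" using p by simp
    moreover have "p - Q + p * (Q + p) = (p - 1) * Q + p + p * p" by (simp add: algebra_simps)
    moreover have "p * p > 0" using p by simp
    ultimately show ?thesis using p by linarith
  qed
  ultimately show False using I_nonzero by simp
qed

lemma integral_P_function: "(LINT x:\<Omega>|lborel. P_function br E Q p f x) = c powr p * M"
proof -
  obtain B where B: "B > 0" "\<And>x. x \<in> \<Omega> \<Longrightarrow> norm (a x) \<le> B" "\<And>x. x \<in> \<Omega> \<Longrightarrow> k x \<le> B" "\<And>x. x \<in> \<Omega> \<Longrightarrow> f x \<le> B"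
    using bounds by metis
  define d where "d = 2 * p / ((p - 1) * (Q + p))"
  have i1: "integrable lborel (\<lambda>x. indicator \<Omega> x * norm (a x) powr p)"
    by (rule set_integrable_bounded[OF continuous_norm_a_powr, of "B powr p"]) (use B(2) p in \<open>auto intro: powr_mono2\<close>)
  have i2: "integrable lborel (\<lambda>x. indicator \<Omega> x * (k x * f x))"
  proof (rule set_integrable_bounded)
    show "continuous_on \<Omega> (\<lambda>x. k x * f x)" by (intro continuous_intros continuous_k continuous_f)
    show "\<bar>k x * f x\<bar> \<le> B * B" if "x \<in> \<Omega>" for x
      unfolding abs_mult using B(3,4)[OF that] k_nonneg[of x] f_nonneg[OF that] B(1) by (intro mult_mono) auto
  qed
  have "(LINT x:\<Omega>|lborel. P_function br E Q p f x) =
      (LINT x|lborel. indicator \<Omega> x * norm (a x) powr p + d * (indicator \<Omega> x * (k x * f x)))"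
    unfolding set_lebesgue_integral_def
    by (rule Bochner_Integration.integral_cong) (simp_all add: P_function_def a_def k_def d_def algebra_simps)
  also have "\<dots> = I + d * I"
  proof -
    have "(LINT x|lborel. indicator \<Omega> x * norm (a x) powr p) = I" by (simp add: I_def set_lebesgue_integral_def)
    moreover have "(LINT x|lborel. indicator \<Omega> x * (k x * f x)) = I" by (simp add: I_eq set_lebesgue_integral_def)
    ultimately show ?thesis using i1 i2 by simp
  qed
  also have "\<dots> = c powr p * M"
  proof -
    have "Q \<ge> 0" by (simp add: Q_def)
    then have nz: "(p - 1) * (Q + p) \<noteq> 0" using p by simp
    \<comment> \<open>Multiplying by (p - 1)(Q + p) turns \<open>d\<close> into 2p, and (p - 1)(Q +
      p) + 2p is the coefficient of I in \<open>global_pohozaev\<close>.\<close>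
    have "(p - 1) * (Q + p) * (I + d * I) = ((p - 1) * (Q + p)) * I + (((p - 1) * (Q + p)) * d) * I"
      by (simp only: distrib_left mult.assoc)
    also have "((p - 1) * (Q + p)) * d = 2 * p" using nz unfolding d_def by simp
    also have "((p - 1) * (Q + p)) * I + (2 * p) * I = (p - Q + p * (Q + p)) * I" by (simp add: algebra_simps)
    also have "\<dots> = (p - 1) * (Q + p) * (c powr p * M)" by (simp only: global_pohozaev[symmetric] mult.assoc)
    finally show ?thesis using nz mult_left_cancel by blast
  qed
  finally show ?thesis .
qed

end

section \<open>Reduction to the classical setting\<close>

theorem theorem1p2:
  fixes br :: "'g::euclidean_space \<Rightarrow> 'g \<Rightarrow> 'g"
    and H V E F \<Omega> :: "'g set"
    and f :: "'g \<Rightarrow> real"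
    and p c \<alpha> :: real
  assumes "heisenberg_type br H V"
    and "orthonormal_basis E H" and "orthonormal_basis F V"
    and "1 < p"
    and "smooth_domain \<Omega>" and "connected \<Omega>" and "bounded \<Omega>" and "\<Omega> \<noteq> {}"
    and "weak_solution br E p \<Omega> f" and "\<forall>x\<in>\<Omega>. 0 \<le> f x"
    and "0 \<le> c" and "overdetermined br E \<Omega> c f"
    and "0 < \<alpha>" and "\<alpha> < 1" and "f \<in> folland_stein2 br E F \<alpha> \<Omega>"
    and "gradient_nonzero_on_frontier br E F \<Omega> f"
  shows "0 < c \<and>
    (LINT x:\<Omega>|lborel. P_function br E (real (hom_dim H V)) p f x) =
      c powr p * (LINT x:\<Omega>|lborel. norm (oproj E x) powr p)"
proof -
  interpret heisenberg_frame br H V E F by unfold_locales (fact assms(1-3))+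
  have open_\<Omega>: "open \<Omega>" using assms(5) by (simp add: smooth_domain_def)
  have cont: "continuous_on \<Omega> u" if "continuous_up_to \<Omega> u" for u :: "'g \<Rightarrow> real"
  proof -
    from that obtain v where "continuous_on (closure \<Omega>) v \<and> (\<forall>x\<in>\<Omega>. v x = u x)"
      unfolding continuous_up_to_def ..
    then have v: "continuous_on (closure \<Omega>) v" "\<forall>x\<in>\<Omega>. v x = u x" by blast+
    show ?thesis by (rule continuous_on_eq[OF continuous_on_subset[OF v(1) closure_subset]]) (use v(2) in auto)
  qed
  have "horizontal_C2 \<Omega> f"
    using assms(15) cont by (auto simp: folland_stein2_def horizontal_C2_def)
  then have C1f: "C1_on \<Omega> f" by (rule horizontal_C2_imp_C1_on[OF open_\<Omega>])
  have p0: "p > 0" using assms(4) by simp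
  have "continuous_up_to \<Omega> f" using assms(15) by (simp add: folland_stein2_def)
  then obtain v where "continuous_on (closure \<Omega>) v \<and> (\<forall>x\<in>\<Omega>. v x = f x)"
    unfolding continuous_up_to_def ..
  then have v: "continuous_on (closure \<Omega>) v" "\<forall>x\<in>\<Omega>. v x = f x" by blast+
  have "bounded (v ` closure \<Omega>)"
    using assms(7) by (intro compact_imp_bounded compact_continuous_image v(1)) (simp add: compact_closure)
  moreover have "f ` \<Omega> \<subseteq> v ` closure \<Omega>" using v(2) closure_subset[of \<Omega>] by (force simp: image_iff)
  ultimately have bf: "bounded (f ` \<Omega>)" by (rule bounded_subset)
  obtain G where G: "continuous_on (closure \<Omega>) G" "\<And>x. x \<in> \<Omega> \<Longrightarrow> G x = lgrad br (E \<union> F) f x"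
    "\<And>x. x \<in> frontier \<Omega> \<Longrightarrow> G x \<noteq> 0"
    using assms(16) unfolding gradient_nonzero_on_frontier_def by blast
  have whg: "AE x in lborel. x \<in> \<Omega> \<longrightarrow> whgrad br E \<Omega> f x = lgrad br E f x"
    by (rule whgrad_classical(2)[OF open_\<Omega> C1f])
  interpret classical_overdetermined br H V E F \<Omega> f p c G
  proof unfold_locales
    fix \<epsilon> :: real assume "\<epsilon> > 0"
    then obtain W where W: "open W" "frontier \<Omega> \<subseteq> W" "AE x in lborel. x \<in> \<Omega> \<inter> W \<longrightarrow>
        \<bar>norm (whgrad br E \<Omega> f x) - c * norm (oproj E x)\<bar> < \<epsilon> \<and> f x < \<epsilon>"
      using assms(12) unfolding overdetermined_def by blast
    have o: "open (\<Omega> \<inter> W)" using open_\<Omega> W(1) by blast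
    have c1: "continuous_on (\<Omega> \<inter> W) (\<lambda>x. \<bar>norm (lgrad br E f x) - c * norm (oproj E x)\<bar>)"
      by (intro continuous_intros continuous_on_subset[OF continuous_on_lgrad[OF C1f]]) auto
    have c2: "continuous_on (\<Omega> \<inter> W) f"
      by (rule continuous_on_subset[OF C1_on_imp_continuous_on[OF C1f]]) auto
    \<comment> \<open>Replacing the strict inequality by the weak one costs nothing and is what
      passes, by continuity, from almost every point to every point.\<close>
    have "AE x in lborel. x \<in> \<Omega> \<inter> W \<longrightarrow> \<bar>norm (lgrad br E f x) - c * norm (oproj E x)\<bar> \<le> \<epsilon>"
      using W(3) whg by eventually_elim auto
    moreover have "AE x in lborel. x \<in> \<Omega> \<inter> W \<longrightarrow> f x \<le> \<epsilon>"
      using W(3) by eventually_elim auto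
    ultimately show "\<exists>W. open W \<and> frontier \<Omega> \<subseteq> W \<and>
        (\<forall>x\<in>\<Omega> \<inter> W. \<bar>norm (lgrad br E f x) - c * norm (oproj E x)\<bar> \<le> \<epsilon> \<and> f x \<le> \<epsilon>)"
      using AE_open_imp_all[OF o c1] AE_open_imp_all[OF o c2] W(1,2) by blast
  next
    fix w assume w: "w \<in> C1c \<Omega>"
    obtain K where K: "compact K" "K \<subseteq> \<Omega>" "\<And>x. x \<notin> K \<Longrightarrow> w x = 0" using C1cE[OF w] by metis
    have "(LINT x:\<Omega>|lborel. norm (lgrad br E f x) powr (p - 2) * (lgrad br E f x \<bullet> lgrad br E w x)) =
      (LINT x:\<Omega>|lborel. norm (oproj E x) powr p * w x)"
      by (rule weak_solution_classical[OF open_\<Omega> C1f assms(9) C1c_W1H0[OF open_\<Omega> p0 w] C1c_C1_on[OF w]])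
    then show "(LINT x|lborel. norm (lgrad br E f x) powr (p - 2) * (lgrad br E f x \<bullet> lgrad br E w x)) =
      (LINT x|lborel. norm (oproj E x) powr p * w x)"
    proof (subst (asm) (1 2) set_lebesgue_integral_support)
      fix x assume "x \<notin> \<Omega>"
      then have "x \<notin> K" using K(2) by blast
      then show "norm (lgrad br E f x) powr (p - 2) * (lgrad br E f x \<bullet> lgrad br E w x) = 0"
        "norm (oproj E x) powr p * w x = 0"
        using lgrad_outside[of K w x E, OF K(3,1)] K(3) by simp_all
    qed
  next
    \<comment> \<open>\<open>f\<close> belongs to the closure of the test functions by definition of
      a weak solution, so the equation may be tested with it; this gives
      \<open>energy\<close>.\<close>
    have "f \<in> W1H0 br E p \<Omega>" using assms(9) by (simp add: weak_solution_def)
    from weak_solution_classical[OF open_\<Omega> C1f assms(9) this C1f]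
    have "(LINT x:\<Omega>|lborel. norm (lgrad br E f x) powr (p - 2) * (lgrad br E f x \<bullet> lgrad br E f x)) =
      (LINT x:\<Omega>|lborel. norm (oproj E x) powr p * f x)" .
    then show "(LINT x:\<Omega>|lborel. norm (lgrad br E f x) powr p) = (LINT x:\<Omega>|lborel. norm (oproj E x) powr p * f x)"
      by (simp only: norm_powr_inner_self)
  qed (use assms open_\<Omega> C1f bf G in auto)
  show ?thesis using c_pos integral_P_function by (simp add: Q_def M_def k_def)
qed

end
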